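(* For a connected closed $3$-manifold $M$ let $\Psi(M)$ be the minimum number of vertices of a crystallization of $M$ (equivalently, the minimum number of facets of a contracted pseudotriangulation of $M$). Then: (i) $\Psi(L(kq-1,q))\le 4(k+q-1)$ for all integers $k,q\ge2$; and (ii) $\Psi(L(kq+1,q))\le 4(k+q)$ for all integers $k,q\ge1$.
   Context: For relatively prime $p,q$, $L(p,q)=S^3/\mathbb Z_p$ is the lens space, where a generator of $\mathbb Z_p$ acts on $S^3=\{(z_1,z_2)\in\mathbb C^2:|z_1|^2+|z_2|^2=1\}$ by $(z_1,z_2)\mapsto(e^{2\pi i/p}z_1,e^{2\pi iq/p}z_2)$. A simplicial cell complex $K$ of dimension $d$ is the face poset (closed cells together with the empty set, ordered by inclusion) of a $d$-dimensional regular CW complex $W$ such that the boundary complex of each cell is isomorphic, as a poset, to the boundary complex of a simplex of the same dimension; write $|K|=W$. If a space $X$ is homeomorphic to $|K|$, then $K$ is a pseudotriangulation of $X$. A $d$-dimensional simplicial cell complex is contracted if it has exactly $d+1$ vertices ($0$-cells). Facets are the maximal cells (here the $3$-cells). Graphs are finite multigraphs without loops. An edge coloring $\gamma:E\to C$ of $\Gamma=(V,E)$ satisfies $\gamma(e)\neq\gamma(f)$ whenever $e\ne f$ share a vertex; if $|C|=h$, $(\Gamma,\gamma)$ is an $h$-colored graph. For $B\subseteq C$, $\Gamma_B=(V,\gamma^{-1}(B))$. A connected colored graph is contracted if $\Gamma_{C\setminus\{c\}}$ is connected for all $c\in C$. A connected $(d+1)$-colored graph $(\Gamma,\gamma)$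 with colors $1,\dots,d+1$ determines a $d$-dimensional simplicial cell complex $\mathcal K(\Gamma)$: take a $d$-simplex $\sigma_v$ with vertices labelled $1,\dots,d+1$ for each $v\in V$, and for each edge of color $i$ joining $u,v$ identify the $(d-1)$-faces of $\sigma_u$ and $\sigma_v$ opposite to the vertices labelled $i$ so that equally labelled vertices are identified. A crystallization of a connected closed $d$-manifold $M$ is a contracted $(d+1)$-colored graph $(\Gamma,\gamma)$ such that $\mathcal K(\Gamma)$ is a pseudotriangulation of $M$. *)

theory Defs
  imports "HOL-Analysis.Analysis" "HOL-Homology.Homology" "HOL-Library.Extended_Nat"
begin

section \<open>Quotient spaces\<close>

text \<open>The points of the quotient are the equivalence classes of \<open>r\<close>.\<close>

definition quotient_topology :: "'a topology \<Rightarrow> ('a \<times> 'a) set \<Rightarrow> 'a set topology" where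
  "quotient_topology T r =
     topology (\<lambda>U. U \<subseteq> topspace T // r \<and> openin T {x \<in> topspace T. r `` {x} \<in> U})"

lemma openin_quotient_topology:
  "openin (quotient_topology T r) U \<longleftrightarrow>
     U \<subseteq> topspace T // r \<and> openin T {x \<in> topspace T. r `` {x} \<in> U}"
proof -
  let ?L = "\<lambda>U. U \<subseteq> topspace T // r \<and> openin T {x \<in> topspace T. r `` {x} \<in> U}"
  have "istopology ?L"
    unfolding istopology_def
  proof (intro conjI allI impI)
    fix S U assume S: "?L S" and U: "?L U"
    have "{x \<in> topspace T. r `` {x} \<in> S \<inter> U} =
          {x \<in> topspace T. r `` {x} \<in> S} \<inter> {x \<in> topspace T. r `` {x} \<in> U}" by auto
    then show "openin T {x \<in> topspace T. r `` {x} \<in> S \<inter> U}"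
      using S U by (simp add: openin_Int)
    show "S \<inter> U \<subseteq> topspace T // r" using S by blast
  next
    fix \<K> assume K: "\<forall>K\<in>\<K>. ?L K"
    have "{x \<in> topspace T. r `` {x} \<in> \<Union>\<K>} =
          (\<Union>K\<in>\<K>. {x \<in> topspace T. r `` {x} \<in> K})" by auto
    then show "openin T {x \<in> topspace T. r `` {x} \<in> \<Union>\<K>}"
      using K by auto
    show "\<Union>\<K> \<subseteq> topspace T // r" using K by blast
  qed
  then show ?thesis
    by (simp add: quotient_topology_def topology_inverse')
qed

lemma topspace_quotient_topology [simp]:
  "topspace (quotient_topology T r) = topspace T // r"
proof -
  have "{x \<in> topspace T. r `` {x} \<in> topspace T // r} = topspace T"
    by (auto simp: quotient_def)
  then have "openin (quotient_topology T r) (topspace T // r)"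
    by (simp add: openin_quotient_topology)
  then show ?thesis
    by (metis openin_quotient_topology openin_subset openin_topspace subset_antisym)
qed

lemma quotient_map_quotient_topology:
  "quotient_map T (quotient_topology T r) (\<lambda>x. r `` {x})"
  by (auto simp: quotient_map_def openin_quotient_topology quotient_def)


section \<open>Lens spaces\<close>

definition unit_sphere3 :: "(complex \<times> complex) set" where
  "unit_sphere3 = {(z1, z2). (cmod z1)\<^sup>2 + (cmod z2)\<^sup>2 = 1}"

definition lens_generator :: "int \<Rightarrow> int \<Rightarrow> complex \<times> complex \<Rightarrow> complex \<times> complex" where
  "lens_generator p q = (\<lambda>(z1, z2).
     (exp (2 * of_real pi * \<i> / of_int p) * z1,
      exp (2 * of_real pi * \<i> * of_int q / of_int p) * z2))"

text \<open>For \<open>p \<ge> 1\<close> the generator has finite order (dividing \<open>p\<close>), so its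
  nonnegative iterates already exhaust the orbits of the action of the cyclic group.\<close>

definition lens_orbit_rel :: "int \<Rightarrow> int \<Rightarrow> ((complex \<times> complex) \<times> (complex \<times> complex)) set" where
  "lens_orbit_rel p q = {(z, w). z \<in> unit_sphere3 \<and> (\<exists>j::nat. w = (lens_generator p q ^^ j) z)}"

lemma lens_generator_funpow:
  "(lens_generator p q ^^ j) (z1, z2) =
     (exp (2 * of_real pi * \<i> / of_int p) ^ j * z1,
      exp (2 * of_real pi * \<i> * of_int q / of_int p) ^ j * z2)"
  by (induction j) (auto simp: lens_generator_def)

lemma lens_generator_order:
  assumes "p \<ge> 1"
  shows "(lens_generator p q ^^ nat p) z = z"
proof -
  have *: "exp (2 * of_real pi * \<i> * of_int m / of_int p) ^ nat p = (1 :: complex)" for m :: int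
  proof -
    have p: "(of_nat (nat p) :: complex) = of_int p" "(of_int p :: complex) \<noteq> 0"
      using assms by auto
    have "exp (2 * of_real pi * \<i> * of_int m / of_int p) ^ nat p =
          exp (of_nat (nat p) * (2 * of_real pi * \<i> * of_int m / of_int p) :: complex)"
      by (rule exp_of_nat_mult [symmetric])
    also have "of_nat (nat p) * (2 * of_real pi * \<i> * of_int m / of_int p) =
               (\<i> * (of_int m * (of_real pi * 2)) :: complex)"
      unfolding p(1) using p(2) by (simp add: field_simps)
    also have "exp \<dots> = 1" by (rule exp_2pi_1_int)
    finally show ?thesis .
  qed
  show ?thesis
    using *[of 1] *[of q] by (cases z) (simp add: lens_generator_funpow)
qed

lemma cmod_lens_root: "cmod (exp (2 * of_real pi * \<i> * of_int m / of_int p)) = 1"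
  by simp

lemma lens_orbit_rel_subset: "lens_orbit_rel p q \<subseteq> unit_sphere3 \<times> unit_sphere3"
  using cmod_lens_root[of 1 p] cmod_lens_root[of q p]
  by (auto simp: lens_orbit_rel_def unit_sphere3_def lens_generator_funpow norm_mult norm_power)

lemma equiv_lens_orbit_rel:
  assumes "p \<ge> 1"
  shows "equiv unit_sphere3 (lens_orbit_rel p q)"
proof -
  let ?g = "lens_generator p q"
  have "sym (lens_orbit_rel p q)"
  proof (rule symI)
    fix z w assume zw: "(z, w) \<in> lens_orbit_rel p q"
    then obtain j where j: "w = (?g ^^ j) z" by (auto simp: lens_orbit_rel_def)
    have *: "(?g ^^ (i * nat p)) z = z" for i
      by (induction i) (simp_all add: funpow_add lens_generator_order[OF assms])
    have "1 \<le> nat p" using assms by linarith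
    then have le: "j \<le> j * nat p" by simp
    have "(?g ^^ (j * nat p - j)) w = (?g ^^ (j * nat p - j + j)) z"
      by (simp add: j funpow_add)
    also have "\<dots> = z" using le * by simp
    finally have "z = (?g ^^ (j * nat p - j)) w" by simp
    moreover have "w \<in> unit_sphere3" using zw lens_orbit_rel_subset by blast
    ultimately show "(w, z) \<in> lens_orbit_rel p q" unfolding lens_orbit_rel_def by blast
  qed
  moreover have "trans (lens_orbit_rel p q)"
  proof (rule transI)
    fix x y z assume "(x, y) \<in> lens_orbit_rel p q" "(y, z) \<in> lens_orbit_rel p q"
    then obtain i j where "x \<in> unit_sphere3" "y = (?g ^^ i) x" "z = (?g ^^ j) y"
      by (auto simp: lens_orbit_rel_def)
    then have "x \<in> unit_sphere3 \<and> z = (?g ^^ (j + i)) x" by (simp add: funpow_add)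
    then show "(x, z) \<in> lens_orbit_rel p q" unfolding lens_orbit_rel_def by blast
  qed
  moreover have "refl_on unit_sphere3 (lens_orbit_rel p q)"
  proof (rule refl_onI)
    fix x assume "x \<in> unit_sphere3"
    moreover have "x = (?g ^^ 0) x" by simp
    ultimately show "(x, x) \<in> lens_orbit_rel p q" unfolding lens_orbit_rel_def by blast
  qed
  ultimately show ?thesis using lens_orbit_rel_subset by (simp add: equiv_def)
qed

text \<open>To be used for \<open>p \<ge> 1\<close> and coprime \<open>p\<close>, \<open>q\<close>.\<close>

definition lens_space :: "int \<Rightarrow> int \<Rightarrow> (complex \<times> complex) set topology" where
  "lens_space p q = quotient_topology (top_of_set unit_sphere3) (lens_orbit_rel p q)"


section \<open>Regular CW complexes and simplicial cell complexes\<close>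

text \<open>A complex is given by its underlying space \<open>W\<close> and the set \<open>C\<close> of its (nonempty)
  closed cells; its face poset is \<open>insert {} C\<close> ordered by inclusion.\<close>

definition cell_boundary :: "'a set set \<Rightarrow> 'a set \<Rightarrow> 'a set" where
  "cell_boundary C c = \<Union>{c' \<in> C. c' \<subset> c}"

definition closed_disc :: "nat \<Rightarrow> (nat \<Rightarrow> real) topology" where
  "closed_disc n = subtopology (Euclidean_space n) {x. (\<Sum>i<n. (x i)\<^sup>2) \<le> 1}"

definition regular_cell :: "'a topology \<Rightarrow> 'a set set \<Rightarrow> nat \<Rightarrow> 'a set \<Rightarrow> bool" where
  "regular_cell W C n c \<longleftrightarrow>
     (\<exists>h. homeomorphic_map (closed_disc n) (subtopology W c) h \<and>
          h ` {x \<in> topspace (closed_disc n). (\<Sum>i<n. (x i)\<^sup>2) = 1} = cell_boundary C c)"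

text \<open>This is the usual description of regular CW complexes by closed balls: the boundary
  sphere of every ball is a union of balls of the complex, and the open balls partition the
  space. The last two clauses are closure-finiteness and the weak topology; they are automatic
  when \<open>C\<close> is finite.\<close>

definition regular_CW_complex :: "'a topology \<Rightarrow> 'a set set \<Rightarrow> bool" where
  "regular_CW_complex W C \<longleftrightarrow>
     Hausdorff_space W \<and> \<Union>C = topspace W \<and>
     (\<forall>c\<in>C. \<exists>n. regular_cell W C n c) \<and>
     (\<forall>x\<in>topspace W. \<exists>!c. c \<in> C \<and> x \<in> c - cell_boundary C c) \<and>
     (\<forall>c\<in>C. finite {c' \<in> C. c' \<subseteq> c}) \<and>
     (\<forall>A\<subseteq>topspace W. (\<forall>c\<in>C. closedin W (A \<inter> c)) \<longrightarrow> closedin W A)"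

text \<open>The boundary complex of an \<open>n\<close>-simplex is the poset of proper subsets (including
  the empty one) of its \<open>n + 1\<close> vertices.\<close>

definition simplicial_boundary :: "'a set set \<Rightarrow> nat \<Rightarrow> 'a set \<Rightarrow> bool" where
  "simplicial_boundary C n c \<longleftrightarrow>
     (\<exists>f :: 'a set \<Rightarrow> nat set.
        bij_betw f {a \<in> insert {} C. a \<subset> c} {S. S \<subset> {..n}} \<and>
        (\<forall>a\<in>insert {} C. \<forall>b\<in>insert {} C. a \<subset> c \<longrightarrow> b \<subset> c \<longrightarrow> (a \<subseteq> b \<longleftrightarrow> f a \<subseteq> f b)))"

definition simplicial_cell_complex :: "nat \<Rightarrow> 'a topology \<Rightarrow> 'a set set \<Rightarrow> bool" where
  "simplicial_cell_complex d W C \<longleftrightarrow>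
     regular_CW_complex W C \<and>
     (\<forall>c\<in>C. \<exists>n\<le>d. regular_cell W C n c \<and> simplicial_boundary C n c) \<and>
     (\<exists>c\<in>C. regular_cell W C d c)"

definition pseudotriangulation :: "nat \<Rightarrow> 'a topology \<Rightarrow> 'a set set \<Rightarrow> 'b topology \<Rightarrow> bool" where
  "pseudotriangulation d W C X \<longleftrightarrow> simplicial_cell_complex d W C \<and> X homeomorphic_space W"


section \<open>Colored graphs\<close>

text \<open>Finite loopless multigraphs: \<open>ends e\<close> is the two-element set of end vertices of \<open>e\<close>.
  The color set of an \<open>h\<close>-colored graph is \<open>{..<h}\<close>, i.e. colors start at 0, in accordance
  with the vertices \<open>0, \<dots>, d\<close> of the library's \<^const>\<open>standard_simplex\<close>.\<close>

record ('v, 'e) cgraph =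
  verts :: "'v set"
  edges :: "'e set"
  ends :: "'e \<Rightarrow> 'v set"
  color :: "'e \<Rightarrow> nat"

definition colored_graph :: "nat \<Rightarrow> ('v, 'e) cgraph \<Rightarrow> bool" where
  "colored_graph h G \<longleftrightarrow>
     finite (verts G) \<and> finite (edges G) \<and>
     (\<forall>e\<in>edges G. ends G e \<subseteq> verts G \<and> card (ends G e) = 2) \<and>
     (\<forall>e\<in>edges G. color G e < h) \<and>
     (\<forall>e\<in>edges G. \<forall>f\<in>edges G.
        e \<noteq> f \<and> ends G e \<inter> ends G f \<noteq> {} \<longrightarrow> color G e \<noteq> color G f)"

definition color_subgraph :: "('v, 'e) cgraph \<Rightarrow> nat set \<Rightarrow> ('v, 'e) cgraph" where
  "color_subgraph G B = G\<lparr>edges := {e \<in> edges G. color G e \<in> B}\<rparr>"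

definition connected_graph :: "('v, 'e) cgraph \<Rightarrow> bool" where
  "connected_graph G \<longleftrightarrow> verts G \<noteq> {} \<and>
     (\<forall>u\<in>verts G. \<forall>v\<in>verts G. (u, v) \<in> {(a, b). \<exists>e\<in>edges G. ends G e = {a, b}}\<^sup>*)"

definition contracted_graph :: "nat \<Rightarrow> ('v, 'e) cgraph \<Rightarrow> bool" where
  "contracted_graph h G \<longleftrightarrow> colored_graph h G \<and> connected_graph G \<and>
     (\<forall>c<h. connected_graph (color_subgraph G ({..<h} - {c})))"


section \<open>The simplicial cell complex of a colored graph\<close>

text \<open>A point \<open>(v, x)\<close> of the disjoint union is the point of the simplex of \<open>v\<close> with
  barycentric coordinates \<open>x\<close>; the face opposite to the vertex labelled \<open>i\<close> is \<open>x i = 0\<close>.\<close>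

definition simplex_sum :: "nat \<Rightarrow> ('v, 'e) cgraph \<Rightarrow> ('v \<times> (nat \<Rightarrow> real)) topology" where
  "simplex_sum d G =
     sum_topology (\<lambda>_. subtopology (powertop_real UNIV) (standard_simplex d)) (verts G)"

definition glue_step ::
    "nat \<Rightarrow> ('v, 'e) cgraph \<Rightarrow> (('v \<times> (nat \<Rightarrow> real)) \<times> ('v \<times> (nat \<Rightarrow> real))) set" where
  "glue_step d G = {((u, x), (v, y)).
     x \<in> standard_simplex d \<and> y = x \<and> (\<exists>e\<in>edges G. ends G e = {u, v} \<and> x (color G e) = 0)}"

definition glue_rel ::
    "nat \<Rightarrow> ('v, 'e) cgraph \<Rightarrow> (('v \<times> (nat \<Rightarrow> real)) \<times> ('v \<times> (nat \<Rightarrow> real))) set" where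
  "glue_rel d G = (glue_step d G)\<^sup>* \<inter> (topspace (simplex_sum d G) \<times> topspace (simplex_sum d G))"

lemma equiv_glue_rel: "equiv (topspace (simplex_sum d G)) (glue_rel d G)"
proof -
  have "sym (glue_step d G)"
    by (auto simp: sym_def glue_step_def insert_commute)
  then have "sym ((glue_step d G)\<^sup>*)" by (rule sym_rtrancl)
  then have "sym (glue_rel d G)"
    by (auto simp: glue_rel_def sym_def)
  moreover have "trans (glue_rel d G)"
    by (rule transI) (auto simp: glue_rel_def)
  ultimately show ?thesis
    by (auto simp: equiv_def refl_on_def glue_rel_def)
qed

definition graph_space :: "nat \<Rightarrow> ('v, 'e) cgraph \<Rightarrow> ('v \<times> (nat \<Rightarrow> real)) set topology" where
  "graph_space d G = quotient_topology (simplex_sum d G) (glue_rel d G)"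

definition graph_cells :: "nat \<Rightarrow> ('v, 'e) cgraph \<Rightarrow> ('v \<times> (nat \<Rightarrow> real)) set set set" where
  "graph_cells d G =
     {(\<lambda>x. glue_rel d G `` {(v, x)}) ` {x \<in> standard_simplex d. \<forall>i. i \<notin> S \<longrightarrow> x i = 0} | v S.
        v \<in> verts G \<and> S \<subseteq> {..d} \<and> S \<noteq> {}}"

definition crystallization :: "nat \<Rightarrow> ('v, 'e) cgraph \<Rightarrow> 'b topology \<Rightarrow> bool" where
  "crystallization d G M \<longleftrightarrow>
     contracted_graph (d + 1) G \<and> pseudotriangulation d (graph_space d G) (graph_cells d G) M"

text \<open>Every finite multigraph is isomorphic to one whose vertices and edges are natural numbers.
  The infimum in \<^typ>\<open>enat\<close> is \<open>\<infinity>\<close> if \<open>M\<close> has no crystallization and is an attained minimum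
  otherwise. The notion is meant for connected closed 3-manifolds \<open>M\<close>.\<close>

definition Psi :: "'b topology \<Rightarrow> enat" where
  "Psi M = Inf {enat (card (verts G)) | G :: (nat, nat) cgraph. crystallization 3 G M}"

end

theory Submission
  imports Defs
begin

text \<open>The space \<open>L(p,r)\<close> is the quotient of the 3-sphere by a cyclic group, so a crystallization of it
amounts to an invariant triangulation of the sphere whose vertices are labelled by four labels,
each label forming a single orbit; its size is the number of orbits of tetrahedra. The triangulation
used here is the boundary of a convex polytope, projected radially to the sphere.

Send \<open>(x, y)\<close> in \<open>\<int>\<^sup>2\<close> to the point
\<open>(exp (\<i> \<pi> y / p), exp (\<i> \<pi> (r y / p - x)))\<close> of the sphere. The points \<open>(2, 0)\<close> and \<open>(2 r, 2 p)\<close>,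
twice the primitive vectors of two meridians, act trivially, so this gives \<open>4 p\<close> points on the
Clifford torus, and the generator of the group acts by translation by \<open>(0, 2)\<close>. Label a point by its
class modulo 2; the four labels are the four orbits. A tetrahedron is spanned by a lattice
parallelogram with vertices \<open>P\<close>, \<open>P + a\<close>, \<open>P + b\<close>, \<open>P + a + b\<close>, where \<open>a\<close>, \<open>b\<close> is a basis of \<open>\<int>\<^sup>2\<close>; its
vertices automatically carry the four labels. The bases run through a Farey path: it starts at
\<open>(1, 0)\<close>, \<open>(0, 1)\<close>, every step replaces \<open>a\<close> or \<open>b\<close> by \<open>a + b\<close>, and the sum that is created by the last
step is the slope \<open>(r, p)\<close>. The triangles with edge vectors \<open>a\<close>, \<open>b\<close>, \<open>a + b\<close> occur both in the parallelograms of
one basis and in those of the next one, so every such triangle lies in one tetrahedron of each of two consecutive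
layers; in the first and the last layer the meridians fold the remaining triangles together in pairs. Modulo the group, an
interior layer has four tetrahedra and each of the two end layers has two, because there \<open>P\<close> and \<open>P\<close>
plus the meridian vector span the same tetrahedron. A path of \<open>N\<close> steps therefore gives at most
\<open>2 + 4 (N - 1) + 2 = 4 N\<close> tetrahedra. The slope \<open>(q, k q + 1)\<close> is reached by \<open>k\<close> steps of one kind followed by \<open>q\<close>
steps of the other kind, and \<open>(q, k q - 1)\<close> by \<open>k - 1\<close> steps, one step of the other kind and
\<open>q - 1\<close> steps of the first kind again.

For every tetrahedron there is a linear functional that is 1 on its vertices and less
than 1 on the rest of the \<open>4 p\<close> points (\<open>height_le_1\<close>). In angular coordinates centred at the
parallelogram it is a sum \<open>w1 cos \<theta>1 + w2 cos \<theta>2\<close>, and concavity of the cosine on \<open>[-\<pi>/2, \<pi>/2]\<close> bounds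
it: a lattice point with larger value would force one of the four vertices into the interior of
a convex superlevel set, on whose boundary it lies.

Supporting functionals imply that the cones over
two facets meet in the cone over their common vertices (\<open>cone_inj\<close>). If moreover every facet has a
neighbour across each of its faces, then a generic line segment can never leave the union of
the cones. Hence the cones cover the whole space (\<open>cones_cover\<close>), and two facets with a common face are joined by a
chain of neighbours containing that face (\<open>star_connected\<close>). The second statement says that gluing
simplices along the edges of the graph makes exactly the identifications that hold in the sphere. It also
makes the graph contracted, since each label is one orbit. So the glued space is compact and
maps bijectively onto the Hausdorff quotient of the sphere
(\<open>graph_space_homeomorphic\<close>).

The identifications preserve barycentric coordinates, so every face of every
simplex is embedded in the glued space, and faces of a cell correspond to subsets of its vertex set
(\<open>simplicial_cell_complex_graph_space\<close>).\<close>


section \<open>Faces of a simplex are discs\<close>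

text \<open>The homeomorphism from a simplex to a disc is the radial one. For a vector \<open>u\<close> with coordinate sum 0,
regarded as the displacement from the barycenter of an \<open>n\<close>-simplex, this is the Minkowski gauge of the
simplex: it is 1 exactly on the boundary.\<close>

definition simplex_gauge :: "nat \<Rightarrow> (nat \<Rightarrow> real) \<Rightarrow> real" where
  "simplex_gauge n u = - (1 + real n) * Min (u ` {..n})"

lemma simplex_gauge_ge: "i \<le> n \<Longrightarrow> - (1 + real n) * u i \<le> simplex_gauge n u"
  by (simp add: simplex_gauge_def)

lemma simplex_gauge_attained: "\<exists>i\<le>n. simplex_gauge n u = - (1 + real n) * u i"
proof -
  have "Min (u ` {..n}) \<in> u ` {..n}" by (rule Min_in) auto
  then obtain i where "i \<le> n" "Min (u ` {..n}) = u i" by (elim imageE) simp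
  then show ?thesis by (intro exI[of _ i]) (simp add: simplex_gauge_def)
qed

lemma simplex_gauge_cong: "(\<And>i. i \<le> n \<Longrightarrow> u i = v i) \<Longrightarrow> simplex_gauge n u = simplex_gauge n v"
  unfolding simplex_gauge_def by (metis (mono_tags, lifting) atMost_iff image_cong)

lemma simplex_gauge_scale: "0 \<le> s \<Longrightarrow> simplex_gauge n (\<lambda>i. s * u i) = s * simplex_gauge n u"
proof -
  assume "0 \<le> s"
  then have "mono (\<lambda>t. s * t)" by (intro monoI mult_left_mono) auto
  then have "s * Min (u ` {..n}) = Min ((\<lambda>t. s * t) ` u ` {..n})"
    by (intro mono_Min_commute) auto
  then show ?thesis by (simp add: simplex_gauge_def image_image)
qed

lemma simplex_gauge_nonneg: "sum u {..n} = 0 \<Longrightarrow> 0 \<le> simplex_gauge n u"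
  and simplex_gauge_eq_0: "sum u {..n} = 0 \<Longrightarrow> simplex_gauge n u = 0 \<Longrightarrow> i \<le> n \<Longrightarrow> u i = 0"
proof -
  assume s: "sum u {..n} = 0"
  have "- (1 + real n) * u i \<le> simplex_gauge n u" if "i \<le> n" for i by (rule simplex_gauge_ge[OF that])
  then have "(\<Sum>i\<le>n. - (1 + real n) * u i) \<le> (\<Sum>i\<le>n. simplex_gauge n u)" by (intro sum_mono) auto
  then have "0 \<le> (1 + real n) * simplex_gauge n u" using s by (simp flip: sum_distrib_left add: sum_negf)
  then show "0 \<le> simplex_gauge n u" by (simp add: zero_le_mult_iff)
  assume g: "simplex_gauge n u = 0" and i: "i \<le> n"
  have "0 \<le> u i" if "i \<le> n" for i
  proof -
    have "0 \<le> (1 + real n) * u i" using simplex_gauge_ge[OF that, of u] g by (simp add: algebra_simps)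
    then show ?thesis by (simp add: zero_le_mult_iff)
  qed
  then show "u i = 0" using s i sum_nonneg_eq_0_iff[of "{..n}" u] by auto
qed

lemma continuous_on_Min:
  fixes f :: "'i \<Rightarrow> 'a::topological_space \<Rightarrow> real"
  assumes "finite I" "I \<noteq> {}" "\<And>i. i \<in> I \<Longrightarrow> continuous_on A (f i)"
  shows "continuous_on A (\<lambda>x. Min ((\<lambda>i. f i x) ` I))"
  using assms
proof (induction rule: finite_ne_induct)
  case (insert i I)
  have "continuous_on A (\<lambda>x. min (f i x) (Min ((\<lambda>i. f i x) ` I)))"
    using insert by (intro continuous_on_min) auto
  then show ?case using insert by simp
qed simp

definition disc_norm :: "nat \<Rightarrow> (nat \<Rightarrow> real) \<Rightarrow> real" where
  "disc_norm n u = sqrt (\<Sum>i<n. (u i)\<^sup>2)"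

lemma disc_norm_scale: "disc_norm n (\<lambda>i. s * u i) = \<bar>s\<bar> * disc_norm n u"
  by (simp add: disc_norm_def power_mult_distrib real_sqrt_mult flip: sum_distrib_left)

lemma disc_norm_ge: "i < n \<Longrightarrow> \<bar>u i\<bar> \<le> disc_norm n u"
proof -
  assume "i < n"
  then have "(u i)\<^sup>2 \<le> (\<Sum>i<n. (u i)\<^sup>2)" by (intro member_le_sum) auto
  then show ?thesis unfolding disc_norm_def by (metis real_sqrt_abs real_sqrt_le_mono)
qed

lemma disc_norm_nonneg: "0 \<le> disc_norm n u"
  by (simp add: disc_norm_def sum_nonneg)

lemma disc_norm_sq: "(disc_norm n u)\<^sup>2 = (\<Sum>i<n. (u i)\<^sup>2)"
  by (simp add: disc_norm_def sum_nonneg)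

lemma disc_norm_eq_0:
  assumes "sum u {..n} = 0" "disc_norm n u = 0" "i \<le> n"
  shows "u i = 0"
proof -
  have *: "u i = 0" if "i < n" for i using disc_norm_ge[OF that, of u] assms(2) by simp
  then have "sum u {..<n} = 0" by simp
  then have "u n = 0" using assms(1) by (simp add: lessThan_Suc_atMost[symmetric])
  then show ?thesis using * assms(3) by (cases "i = n") auto
qed

text \<open>The first \<open>n\<close> of the \<open>n + 1\<close> coordinates serve as linear coordinates. Each ray from the barycenter is
rescaled so that the gauge of a point becomes the Euclidean norm of its image; at the barycenter
itself the division by 0 yields the correct value 0.\<close>

definition radial :: "nat \<Rightarrow> (nat \<Rightarrow> real) \<Rightarrow> nat \<Rightarrow> real" where
  "radial n u = (\<lambda>i. if i < n then simplex_gauge n u / disc_norm n u * u i else 0)"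

lemma radial_norm:
  assumes "sum u {..n} = 0"
  shows "disc_norm n (radial n u) = simplex_gauge n u"
proof -
  have "disc_norm n (radial n u) = disc_norm n (\<lambda>i. simplex_gauge n u / disc_norm n u * u i)"
    unfolding disc_norm_def radial_def by (intro arg_cong[of _ _ sqrt] sum.cong) auto
  also have "\<dots> = \<bar>simplex_gauge n u / disc_norm n u\<bar> * disc_norm n u" by (rule disc_norm_scale)
  also have "\<dots> = simplex_gauge n u"
  proof (cases "disc_norm n u = 0")
    case True
    then have "u i = 0" if "i \<le> n" for i using disc_norm_eq_0 assms that by blast
    then have "simplex_gauge n u = simplex_gauge n (\<lambda>i. 0 * u i)" by (intro simplex_gauge_cong) auto
    also have "\<dots> = 0" by (subst simplex_gauge_scale) auto
    finally show ?thesis by simp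
  next
    case False
    then show ?thesis using disc_norm_nonneg[of n u] simplex_gauge_nonneg[OF assms] by simp
  qed
  finally show ?thesis .
qed

text \<open>The norm of the image determines the gauge, and equal images differ by a positive factor before the
rescaling, which the gauge forces to be 1.\<close>

lemma radial_inj:
  assumes u: "sum u {..n} = 0" and v: "sum v {..n} = 0" and eq: "radial n u = radial n v" and i: "i \<le> n"
  shows "u i = v i"
proof -
  have g: "simplex_gauge n u = simplex_gauge n v" using radial_norm u v eq by metis
  show ?thesis
  proof (cases "simplex_gauge n u = 0")
    case True
    then show ?thesis using simplex_gauge_eq_0[OF u _ i] simplex_gauge_eq_0[OF v _ i] g by simp
  next
    case False
    have nz: "disc_norm n w \<noteq> 0" if "sum w {..n} = 0" "simplex_gauge n w \<noteq> 0" for w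
    proof
      assume "disc_norm n w = 0"
      then have "simplex_gauge n w = simplex_gauge n (\<lambda>i. 0 * w i)"
        using disc_norm_eq_0[OF that(1)] by (intro simplex_gauge_cong) auto
      then show False using that(2) simplex_gauge_scale[of 0 n w] by simp
    qed
    define s where "s = disc_norm n v / disc_norm n u"
    have s: "s > 0" using nz[OF u] nz[OF v] g False disc_norm_nonneg[of n u] disc_norm_nonneg[of n v]
      by (simp add: s_def)
    have less: "v j = s * u j" if "j < n" for j
      using fun_cong[OF eq, of j] that g False nz[OF u] nz[OF v]
      by (simp add: radial_def s_def field_simps)
    have "sum v {..<n} = s * sum u {..<n}" by (simp add: less sum_distrib_left)
    moreover have "u n = - sum u {..<n}" "v n = - sum v {..<n}"
      using u v by (simp_all add: lessThan_Suc_atMost[symmetric])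
    ultimately have "v n = s * u n" by simp
    then have all: "v j = s * u j" if "j \<le> n" for j using less that by (cases "j = n") auto
    then have "simplex_gauge n v = s * simplex_gauge n u"
      using simplex_gauge_cong[of n v "\<lambda>i. s * u i"] simplex_gauge_scale[of s n u] s by simp
    then have "s = 1" using g False by simp
    then show ?thesis using all i by simp
  qed
qed

lemma radial_surj:
  assumes z: "\<And>i. n \<le> i \<Longrightarrow> z i = 0"
  obtains u where "sum u {..n} = 0" "radial n u = z" "simplex_gauge n u = disc_norm n z"
proof -
  define v where "v = (\<lambda>i. if i < n then z i else - sum z {..<n})"
  have v: "sum v {..n} = 0" by (simp add: v_def lessThan_Suc_atMost[symmetric])
  have nv: "disc_norm n v = disc_norm n z" by (simp add: disc_norm_def v_def)
  define s where "s = disc_norm n z / simplex_gauge n v"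
  have s: "s \<ge> 0" using simplex_gauge_nonneg[OF v] disc_norm_nonneg[of n z] by (simp add: s_def)
  have gs: "s * simplex_gauge n v = disc_norm n z"
  proof (cases "simplex_gauge n v = 0")
    case True
    then have "disc_norm n v = 0" using simplex_gauge_eq_0[OF v True] by (simp add: disc_norm_def)
    then show ?thesis using True nv by simp
  qed (simp add: s_def)
  show thesis
  proof (rule that[of "\<lambda>i. s * v i"])
    show "(\<Sum>i\<le>n. s * v i) = 0" using v by (simp flip: sum_distrib_left)
    show g: "simplex_gauge n (\<lambda>i. s * v i) = disc_norm n z" using simplex_gauge_scale[OF s] gs by simp
    show "radial n (\<lambda>i. s * v i) = z"
    proof
      fix i
      show "radial n (\<lambda>i. s * v i) i = z i"
      proof (cases "disc_norm n z = 0")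
        case True
        then show ?thesis using z[of i] disc_norm_ge[of i n z] by (auto simp: radial_def g not_less)
      next
        case False
        then have "s \<noteq> 0" using gs by auto
        then show ?thesis using False s z[of i] unfolding radial_def g disc_norm_scale nv
          by (auto simp: v_def)
      qed
    qed
  qed
qed

text \<open>Only the barycenter needs an argument: there the image is dominated by the gauge, which tends to 0.\<close>

lemma continuous_on_radial:
  assumes "\<And>i. i \<le> n \<Longrightarrow> continuous_on A (\<lambda>x. u x i)" and s: "\<And>x. x \<in> A \<Longrightarrow> sum (u x) {..n} = 0"
  shows "continuous_on A (\<lambda>x. radial n (u x))"
proof (rule continuous_on_coordinatewise_then_product)
  fix i
  have "continuous_on A (\<lambda>x. Min (u x ` {..n}))"
    using assms(1) by (intro continuous_on_Min) auto
  then have g: "continuous_on A (\<lambda>x. simplex_gauge n (u x))"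
    unfolding simplex_gauge_def by (intro continuous_intros)
  have N: "continuous_on A (\<lambda>x. disc_norm n (u x))"
    unfolding disc_norm_def using assms(1) by (intro continuous_intros) auto
  show "continuous_on A (\<lambda>x. radial n (u x) i)"
  proof (cases "i < n")
    case i: True
    show ?thesis unfolding continuous_on_def
    proof
      fix x assume x: "x \<in> A"
      have tg: "((\<lambda>x. simplex_gauge n (u x)) \<longlongrightarrow> simplex_gauge n (u x)) (at x within A)"
        and tN: "((\<lambda>x. disc_norm n (u x)) \<longlongrightarrow> disc_norm n (u x)) (at x within A)"
        and tu: "((\<lambda>x. u x i) \<longlongrightarrow> u x i) (at x within A)"
        using g N assms(1)[of i] i x by (auto simp: continuous_on_def)
      show "((\<lambda>x. radial n (u x) i) \<longlongrightarrow> radial n (u x) i) (at x within A)"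
      proof (cases "disc_norm n (u x) = 0")
        case False
        then have "((\<lambda>x. simplex_gauge n (u x) / disc_norm n (u x) * u x i) \<longlongrightarrow>
            simplex_gauge n (u x) / disc_norm n (u x) * u x i) (at x within A)"
          by (intro tendsto_intros tg tN tu)
        then show ?thesis using i by (simp add: radial_def)
      next
        case True
        have "simplex_gauge n (u x) = 0"
          using simplex_gauge_cong[of n "u x" "\<lambda>i. 0 * u x i"] simplex_gauge_scale[of 0 n "u x"]
            disc_norm_eq_0[OF s[OF x] True] by simp
        then have "((\<lambda>x. simplex_gauge n (u x)) \<longlongrightarrow> 0) (at x within A)" using tg by simp
        moreover have "norm (radial n (u y) i) \<le> simplex_gauge n (u y)" if "y \<in> A" for y
          using disc_norm_ge[OF i, of "radial n (u y)"] radial_norm[OF s[OF that]] by simp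
        then have "eventually (\<lambda>y. norm (radial n (u y) i) \<le> simplex_gauge n (u y)) (at x within A)"
          by (simp add: eventually_at_filter)
        ultimately have "((\<lambda>y. radial n (u y) i) \<longlongrightarrow> 0) (at x within A)"
          by (rule Lim_null_comparison[rotated])
        moreover have "radial n (u x) i = 0" using True by (simp add: radial_def)
        ultimately show ?thesis by simp
      qed
    qed
  qed (simp add: radial_def)
qed

definition simplex_face :: "nat \<Rightarrow> nat set \<Rightarrow> (nat \<Rightarrow> real) set" where
  "simplex_face d S = {x \<in> standard_simplex d. \<forall>i. i \<notin> S \<longrightarrow> x i = 0}"

lemma compact_simplex_face: "compact (simplex_face d S)"
proof -
  have "compact (standard_simplex d)"
    using compactin_standard_simplex[of d] by (simp add: euclidean_product_topology)
  moreover have "closed {x. \<forall>i. i \<notin> S \<longrightarrow> x i = (0::real)}"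
    by (intro closed_Collect_all closed_Collect_imp closed_Collect_eq) (auto intro: continuous_intros)
  moreover have "simplex_face d S = standard_simplex d \<inter> {x. \<forall>i. i \<notin> S \<longrightarrow> x i = 0}"
    by (auto simp: simplex_face_def)
  ultimately show ?thesis by (simp add: compact_Int_closed)
qed

lemma sum_simplex_face: "T \<subseteq> {..d} \<Longrightarrow> x \<in> simplex_face d T \<Longrightarrow> sum x T = 1"
  unfolding simplex_face_def standard_simplex_def
  by (smt (verit) DiffE finite_atMost mem_Collect_eq sum.mono_neutral_left)

lemma simplex_face_homeomorphic_disc:
  assumes T: "T \<subseteq> {..d}" "card T = Suc n"
  obtains \<psi> where "homeomorphic_map (top_of_set (simplex_face d T)) (closed_disc n) \<psi>"
    "\<And>x. x \<in> simplex_face d T \<Longrightarrow> (\<Sum>i<n. (\<psi> x i)\<^sup>2) = 1 \<longleftrightarrow> (\<exists>i\<in>T. x i = 0)"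
proof -
  have fT: "finite T" using T finite_subset by blast
  obtain t where t: "bij_betw t {..n} T"
    using ex_bij_betw_nat_finite[OF fT] T(2) by (metis atLeast0LessThan lessThan_Suc_atMost)
  define c where "c = 1 / (1 + real n)"
  define u where "u = (\<lambda>x i. x (t i) - c)"
  have u0: "sum (u x) {..n} = 0" if "x \<in> simplex_face d T" for x
    using sum_simplex_face[OF T(1) that] sum.reindex_bij_betw[OF t, of x]
    by (simp add: u_def sum_subtractf c_def)
  have gu: "simplex_gauge n (u x) \<le> 1" "simplex_gauge n (u x) = 1 \<longleftrightarrow> (\<exists>i\<in>T. x i = 0)" if x: "x \<in> simplex_face d T" for x
  proof -
    obtain i where i: "i \<le> n" "simplex_gauge n (u x) = - (1 + real n) * u x i" using simplex_gauge_attained by blast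
    have pos: "0 \<le> x j" for j using x by (simp add: simplex_face_def standard_simplex_def)
    have e: "- (1 + real n) * u x j = 1 - (1 + real n) * x (t j)" for j
      by (simp add: u_def c_def field_simps)
    show 1: "simplex_gauge n (u x) \<le> 1" using i e[of i] pos[of "t i"] by simp
    show "simplex_gauge n (u x) = 1 \<longleftrightarrow> (\<exists>i\<in>T. x i = 0)"
    proof
      assume "simplex_gauge n (u x) = 1"
      then have "x (t i) = 0" using i e[of i] by auto
      then show "\<exists>i\<in>T. x i = 0" using t i by (auto simp: bij_betw_def)
    next
      assume "\<exists>i\<in>T. x i = 0"
      then obtain j where "j \<le> n" "x (t j) = 0" using t by (auto simp: bij_betw_def)
      then show "simplex_gauge n (u x) = 1" using simplex_gauge_ge[of j n "u x"] e[of j] 1 by simp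
    qed
  qed
  let ?\<psi> = "\<lambda>x. radial n (u x)"
  have top: "topspace (closed_disc n) = {x. (\<forall>i\<ge>n. x i = 0) \<and> (\<Sum>i<n. (x i)\<^sup>2) \<le> 1}"
    by (auto simp: closed_disc_def topspace_Euclidean_space)
  have sq: "(\<Sum>i<n. (?\<psi> x i)\<^sup>2) = (simplex_gauge n (u x))\<^sup>2" if "x \<in> simplex_face d T" for x
    using disc_norm_sq[of n "?\<psi> x"] radial_norm[OF u0[OF that]] by simp
  have "homeomorphic_map (top_of_set (simplex_face d T)) (closed_disc n) ?\<psi>"
  proof (rule continuous_imp_homeomorphic_map)
    show "compact_space (top_of_set (simplex_face d T))"
      using compact_simplex_face by (simp add: compact_space_subtopology)
    show "Hausdorff_space (closed_disc n)"
      unfolding closed_disc_def by (intro Hausdorff_space_subtopology Hausdorff_Euclidean_space)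
    have into: "?\<psi> x \<in> topspace (closed_disc n)" if "x \<in> simplex_face d T" for x
    proof -
      have "(simplex_gauge n (u x))\<^sup>2 \<le> 1" using gu(1)[OF that] simplex_gauge_nonneg[OF u0[OF that]] by (simp add: power_le_one)
      moreover have "\<forall>i\<ge>n. ?\<psi> x i = 0" by (simp add: radial_def)
      ultimately show ?thesis using sq[OF that] unfolding top by simp
    qed
    have "continuous_on (simplex_face d T) ?\<psi>"
      using u0 by (intro continuous_on_radial)
        (auto simp: u_def intro!: continuous_intros continuous_on_subset[OF continuous_on_product_coordinates])
    then have "continuous_map (top_of_set (simplex_face d T)) (top_of_set (topspace (closed_disc n))) ?\<psi>"
      using into by (auto simp: continuous_map_in_subtopology)
    moreover have eq: "closed_disc n = top_of_set (topspace (closed_disc n))"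
      unfolding closed_disc_def Euclidean_space_def
      by (simp add: subtopology_subtopology euclidean_product_topology)
    ultimately show "continuous_map (top_of_set (simplex_face d T)) (closed_disc n) ?\<psi>"
      by (subst eq)
    show "inj_on ?\<psi> (topspace (top_of_set (simplex_face d T)))"
    proof (rule inj_onI)
      fix x y assume xy: "x \<in> topspace (top_of_set (simplex_face d T))"
        "y \<in> topspace (top_of_set (simplex_face d T))" and eq: "?\<psi> x = ?\<psi> y"
      have uv: "u x j = u y j" if "j \<le> n" for j
        using radial_inj[OF u0 u0 eq that] xy by simp
      show "x = y"
      proof
        fix i show "x i = y i"
        proof (cases "i \<in> T")
          case True
          then obtain j where "j \<le> n" "i = t j" using t by (auto simp: bij_betw_def)
          then show ?thesis using uv[of j] by (simp add: u_def)
        qed (use xy in \<open>auto simp: simplex_face_def\<close>)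
      qed
    qed
    show "?\<psi> ` topspace (top_of_set (simplex_face d T)) = topspace (closed_disc n)"
    proof
      show "topspace (closed_disc n) \<subseteq> ?\<psi> ` topspace (top_of_set (simplex_face d T))"
      proof
        fix z assume z: "z \<in> topspace (closed_disc n)"
        obtain w where w: "sum w {..n} = 0" "radial n w = z" "simplex_gauge n w = disc_norm n z"
          using radial_surj[of n z] z unfolding top by blast
        have g1: "simplex_gauge n w \<le> 1" using z w(3) by (simp add: top disc_norm_def)
        define x where "x = (\<lambda>i. if i \<in> T then c + w (the_inv_into {..n} t i) else 0)"
        have xt: "x (t j) = c + w j" if "j \<le> n" for j
          using that t by (auto simp: x_def bij_betw_def the_inv_into_f_f)
        have xn: "0 \<le> x i" for i
        proof (cases "i \<in> T")
          case True
          then obtain j where j: "j \<le> n" "i = t j" using t by (auto simp: bij_betw_def)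
          then have "- (1 + real n) * w j \<le> 1" using simplex_gauge_ge[of j n w] g1 by simp
          then have "- ((1 + real n) * w j) \<le> 1" by (simp only: minus_mult_left)
          moreover have "(1 + real n) * c = 1" by (simp add: c_def)
          ultimately have "0 \<le> (1 + real n) * (c + w j)" by (simp add: distrib_left)
          then show ?thesis using j xt[of j] by (simp add: zero_le_mult_iff)
        qed (simp add: x_def)
        have "sum x T = (\<Sum>j\<le>n. c + w j)"
          using sum.reindex_bij_betw[OF t, of x] xt by simp
        then have "sum x T = 1" using w(1) by (simp add: sum.distrib c_def)
        then have xs: "sum x {..d} = 1"
          using T(1) by (metis (no_types, lifting) DiffE finite_atMost sum.mono_neutral_left x_def)
        have "x i \<le> 1" for i
        proof (cases "i \<le> d")
          case True
          then have "x i \<le> sum x {..d}" using xn by (intro member_le_sum) auto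
          then show ?thesis using xs by simp
        qed (use T(1) in \<open>auto simp: x_def\<close>)
        then have "x \<in> simplex_face d T"
          using xn xs T(1) by (auto simp: simplex_face_def standard_simplex_def x_def)
        moreover have "?\<psi> x = z"
        proof -
          have "u x j = w j" if "j \<le> n" for j using xt[OF that] by (simp add: u_def)
          moreover from this have "simplex_gauge n (u x) = simplex_gauge n w" "disc_norm n (u x) = disc_norm n w"
            by (auto intro: simplex_gauge_cong simp: disc_norm_def)
          ultimately have "?\<psi> x = radial n w" by (auto simp: radial_def)
          then show ?thesis using w(2) by simp
        qed
        ultimately show "z \<in> ?\<psi> ` topspace (top_of_set (simplex_face d T))" by force
      qed
    qed (use into in auto)
  qed
  moreover have "(\<Sum>i<n. (?\<psi> x i)\<^sup>2) = 1 \<longleftrightarrow> (\<exists>i\<in>T. x i = 0)" if x: "x \<in> simplex_face d T" for x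
    using sq[OF x] gu(2)[OF x] simplex_gauge_nonneg[OF u0[OF x]] by (simp add: power2_eq_1_iff)
  ultimately show thesis using that by blast
qed


section \<open>The cells of the space of a colored graph\<close>

text \<open>Reachability by edges with colors in \<open>B\<close>. Two copies of a point with support \<open>S\<close> are glued if and only if
their simplices are linked by colors outside \<open>S\<close>, so this relation governs all identifications.\<close>

definition linked :: "('v, 'e) cgraph \<Rightarrow> nat set \<Rightarrow> ('v \<times> 'v) set" where
  "linked G B = {(u, v). \<exists>e\<in>edges G. ends G e = {u, v} \<and> color G e \<in> B}\<^sup>*"

lemma linked_mono: "B \<subseteq> B' \<Longrightarrow> linked G B \<subseteq> linked G B'"
  unfolding linked_def by (rule rtrancl_mono) auto

lemma linked_refl [simp]: "(v, v) \<in> linked G B"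
  by (simp add: linked_def)

lemma linked_sym: "(u, v) \<in> linked G B \<Longrightarrow> (v, u) \<in> linked G B"
proof -
  have "sym {(u, v). \<exists>e\<in>edges G. ends G e = {u, v} \<and> color G e \<in> B}"
    by (auto simp: sym_def insert_commute)
  then show "(u, v) \<in> linked G B \<Longrightarrow> (v, u) \<in> linked G B"
    unfolding linked_def by (meson sym_rtrancl symD)
qed

lemma linked_trans: "(u, v) \<in> linked G B \<Longrightarrow> (v, w) \<in> linked G B \<Longrightarrow> (u, w) \<in> linked G B"
  unfolding linked_def by (rule rtrancl_trans)

lemma topspace_simplex_sum: "topspace (simplex_sum d G) = verts G \<times> standard_simplex d"
  by (auto simp: simplex_sum_def)

text \<open>A gluing step never changes barycentric coordinates, and the colors that it may use are the zeros of
the point, which therefore are the same along a chain of steps.\<close>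

lemma glue_rel_iff:
  "((u, x), (v, y)) \<in> glue_rel d G \<longleftrightarrow>
     u \<in> verts G \<and> v \<in> verts G \<and> x \<in> standard_simplex d \<and> y = x \<and> (u, v) \<in> linked G {i. x i = 0}"
proof -
  have 1: "snd q = snd p \<and> (fst p, fst q) \<in> linked G {i. snd p i = 0}" if "(p, q) \<in> (glue_step d G)\<^sup>*" for p q
    using that
  proof (induction rule: rtrancl_induct)
    case (step q r)
    obtain e where e: "e \<in> edges G" "ends G e = {fst q, fst r}" "snd r = snd q" "snd q (color G e) = 0"
      using step.hyps(2) by (auto simp: glue_step_def)
    then have "(fst q, fst r) \<in> {(u, v). \<exists>e\<in>edges G. ends G e = {u, v} \<and> color G e \<in> {i. snd p i = 0}}"
      using step.IH by auto
    then have "(fst p, fst r) \<in> linked G {i. snd p i = 0}"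
      using step.IH unfolding linked_def by (blast intro: rtrancl_into_rtrancl)
    then show ?case using step.IH e(3) by simp
  qed simp
  have 2: "((u, x), (v, x)) \<in> (glue_step d G)\<^sup>*"
    if "x \<in> standard_simplex d" "(u, v) \<in> linked G {i. x i = 0}" for u v
    using that(2) unfolding linked_def
  proof (induction rule: rtrancl_induct)
    case (step v w)
    then have "((v, x), (w, x)) \<in> glue_step d G" using that(1) by (auto simp: glue_step_def)
    then show ?case using step.IH by (rule rtrancl_into_rtrancl[rotated])
  qed simp
  show ?thesis using 1[of "(u, x)" "(v, y)"] 2[of u v] by (auto simp: glue_rel_def topspace_simplex_sum)
qed

definition graph_point :: "nat \<Rightarrow> ('v, 'e) cgraph \<Rightarrow> 'v \<Rightarrow> (nat \<Rightarrow> real) \<Rightarrow> ('v \<times> (nat \<Rightarrow> real)) set" where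
  "graph_point d G v x = glue_rel d G `` {(v, x)}"

lemma graph_point_eq_iff:
  assumes "v \<in> verts G" "w \<in> verts G" "x \<in> standard_simplex d" "y \<in> standard_simplex d"
  shows "graph_point d G v x = graph_point d G w y \<longleftrightarrow> x = y \<and> (v, w) \<in> linked G {i. x i = 0}"
  unfolding graph_point_def using assms
  by (subst eq_equiv_class_iff[OF equiv_glue_rel]) (auto simp: topspace_simplex_sum glue_rel_iff)

lemma topspace_graph_space:
  "topspace (graph_space d G) = {graph_point d G v x | v x. v \<in> verts G \<and> x \<in> standard_simplex d}"
  by (auto simp: graph_space_def topspace_simplex_sum quotient_def graph_point_def)

definition graph_cell :: "nat \<Rightarrow> ('v, 'e) cgraph \<Rightarrow> 'v \<Rightarrow> nat set \<Rightarrow> ('v \<times> (nat \<Rightarrow> real)) set set" where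
  "graph_cell d G v S = graph_point d G v ` simplex_face d S"

lemma graph_cells_alt:
  "graph_cells d G = {graph_cell d G v S | v S. v \<in> verts G \<and> S \<subseteq> {..d} \<and> S \<noteq> {}}"
  by (simp add: graph_cells_def graph_cell_def graph_point_def simplex_face_def)

lemma simplex_face_subset: "simplex_face d S \<subseteq> standard_simplex d"
  by (auto simp: simplex_face_def)

lemma simplex_face_barycenter:
  assumes "S \<subseteq> {..d}" "S \<noteq> {}"
  obtains x where "x \<in> simplex_face d S" "{i. x i = 0} = - S"
proof -
  have f: "finite S" using assms finite_subset by blast
  then have c: "1 \<le> real (card S)" using assms(2) by (simp add: Suc_leI card_gt_0_iff)
  let ?x = "\<lambda>i. if i \<in> S then 1 / real (card S) else 0"
  have "sum ?x {..d} = sum ?x S" using assms(1) by (intro sum.mono_neutral_right) auto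
  then have "sum ?x {..d} = 1" using c by simp
  moreover have "0 \<le> ?x i \<and> ?x i \<le> 1 \<and> (i \<notin> S \<longrightarrow> ?x i = 0)" for i using c by simp
  moreover have "?x i = 0" if "d < i" for i using that assms(1) by auto
  ultimately have "?x \<in> simplex_face d S"
    unfolding simplex_face_def standard_simplex_def by blast
  moreover have "{i. ?x i = 0} = - S" using c by auto
  ultimately show thesis by (rule that)
qed

lemma simplex_support:
  assumes "x \<in> standard_simplex d"
  shows "{i. x i \<noteq> 0} \<subseteq> {..d}" "{i. x i \<noteq> 0} \<noteq> {}"
proof -
  show "{i. x i \<noteq> 0} \<subseteq> {..d}"
    using assms unfolding standard_simplex_def by (auto simp: not_less[symmetric])
  show "{i. x i \<noteq> 0} \<noteq> {}"
  proof
    assume "{i. x i \<noteq> 0} = {}"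
    then show False using assms by (simp add: standard_simplex_def)
  qed
qed

lemma graph_point_in_cell_iff:
  assumes "v \<in> verts G" "w \<in> verts G" "x \<in> standard_simplex d"
  shows "graph_point d G v x \<in> graph_cell d G w S \<longleftrightarrow> x \<in> simplex_face d S \<and> (v, w) \<in> linked G {i. x i = 0}"
proof
  assume "graph_point d G v x \<in> graph_cell d G w S"
  then obtain y where "y \<in> simplex_face d S" "graph_point d G v x = graph_point d G w y"
    by (auto simp: graph_cell_def)
  then show "x \<in> simplex_face d S \<and> (v, w) \<in> linked G {i. x i = 0}"
    using graph_point_eq_iff[OF assms(1,2,3), of y] simplex_face_subset by blast
next
  assume "x \<in> simplex_face d S \<and> (v, w) \<in> linked G {i. x i = 0}"
  then show "graph_point d G v x \<in> graph_cell d G w S"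
    using graph_point_eq_iff[OF assms(1,2,3,3)] by (auto simp: graph_cell_def)
qed

text \<open>Testing the inclusion on the barycenter of the smaller face is enough, because its zero set is the
smallest one that occurs on that face.\<close>

lemma graph_cell_subset_iff:
  assumes "v \<in> verts G" "w \<in> verts G" "S \<subseteq> {..d}" "S \<noteq> {}"
  shows "graph_cell d G v S \<subseteq> graph_cell d G w T \<longleftrightarrow> S \<subseteq> T \<and> (v, w) \<in> linked G (- S)"
proof
  assume sub: "graph_cell d G v S \<subseteq> graph_cell d G w T"
  obtain x where x: "x \<in> simplex_face d S" "{i. x i = 0} = - S"
    using simplex_face_barycenter[OF assms(3,4)] .
  then have "graph_point d G v x \<in> graph_cell d G w T" using sub by (auto simp: graph_cell_def)
  then have "x \<in> simplex_face d T \<and> (v, w) \<in> linked G (- S)"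
    using graph_point_in_cell_iff[OF assms(1,2) subsetD[OF simplex_face_subset x(1)]] x(2) by simp
  then show "S \<subseteq> T \<and> (v, w) \<in> linked G (- S)" using x(2) by (auto simp: simplex_face_def)
next
  assume R: "S \<subseteq> T \<and> (v, w) \<in> linked G (- S)"
  show "graph_cell d G v S \<subseteq> graph_cell d G w T"
  proof
    fix z assume "z \<in> graph_cell d G v S"
    then obtain x where x: "x \<in> simplex_face d S" "z = graph_point d G v x" by (auto simp: graph_cell_def)
    have xT: "x \<in> simplex_face d T" and xs: "x \<in> standard_simplex d" and "- S \<subseteq> {i. x i = 0}"
      using x(1) R unfolding simplex_face_def by blast+
    then have "(v, w) \<in> linked G {i. x i = 0}" using R linked_mono by blast
    then show "z \<in> graph_cell d G w T"
      using graph_point_in_cell_iff[OF assms(1,2) xs] x(2) xT by blast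
  qed
qed

lemma graph_cell_eq_iff:
  assumes "v \<in> verts G" "w \<in> verts G" "S \<subseteq> {..d}" "S \<noteq> {}" "T \<subseteq> {..d}" "T \<noteq> {}"
  shows "graph_cell d G v S = graph_cell d G w T \<longleftrightarrow> S = T \<and> (v, w) \<in> linked G (- S)"
  unfolding set_eq_subset[of "graph_cell d G v S"]
    graph_cell_subset_iff[OF assms(1-4)] graph_cell_subset_iff[OF assms(2,1,5,6)]
  by (auto intro: linked_sym)

lemma graph_cell_psubset_iff:
  assumes "v \<in> verts G" "w \<in> verts G" "S \<subseteq> {..d}" "S \<noteq> {}" "T \<subseteq> {..d}" "T \<noteq> {}"
  shows "graph_cell d G v S \<subset> graph_cell d G w T \<longleftrightarrow> S \<subset> T \<and> (v, w) \<in> linked G (- S)"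
  unfolding psubset_eq graph_cell_subset_iff[OF assms(1-4)] graph_cell_eq_iff[OF assms] by auto

lemma graph_cell_boundary:
  assumes v: "v \<in> verts G" and T: "T \<subseteq> {..d}" "T \<noteq> {}"
  shows "cell_boundary (graph_cells d G) (graph_cell d G v T) =
    graph_point d G v ` {x \<in> simplex_face d T. \<exists>i\<in>T. x i = 0}" (is "?L = ?R")
proof
  show "?L \<subseteq> ?R"
  proof
    fix z assume "z \<in> ?L"
    then obtain w S where S: "w \<in> verts G" "S \<subseteq> {..d}" "S \<noteq> {}"
      "graph_cell d G w S \<subset> graph_cell d G v T" "z \<in> graph_cell d G w S"
      unfolding cell_boundary_def graph_cells_alt by blast
    then have ST: "S \<subset> T" "(w, v) \<in> linked G (- S)"
      using graph_cell_psubset_iff[OF S(1) v S(2,3) T] by simp_all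
    then have "graph_cell d G w S = graph_cell d G v S"
      using graph_cell_eq_iff[OF S(1) v S(2,3,2,3)] by simp
    then obtain x where "x \<in> simplex_face d S" "z = graph_point d G v x"
      using S(5) by (auto simp: graph_cell_def)
    then show "z \<in> ?R" using ST(1) by (auto simp: simplex_face_def)
  qed
  show "?R \<subseteq> ?L"
  proof
    fix z assume "z \<in> ?R"
    then obtain x i where x: "x \<in> simplex_face d T" "i \<in> T" "x i = 0" "z = graph_point d G v x" by auto
    let ?S = "{i. x i \<noteq> 0}"
    have xs: "x \<in> standard_simplex d" using x(1) simplex_face_subset by blast
    note S = simplex_support[OF xs]
    have "?S \<subset> T" using x by (auto simp: simplex_face_def)
    then have "graph_cell d G v ?S \<subset> graph_cell d G v T"
      using graph_cell_psubset_iff[OF v v S T] by simp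
    moreover have "z \<in> graph_cell d G v ?S" using x xs by (auto simp: graph_cell_def simplex_face_def)
    ultimately show "z \<in> ?L" using v S unfolding cell_boundary_def graph_cells_alt by blast
  qed
qed

lemma graph_point_interior_iff:
  assumes "v \<in> verts G" "w \<in> verts G" "x \<in> standard_simplex d" "T \<subseteq> {..d}" "T \<noteq> {}"
  shows "graph_point d G v x \<in> graph_cell d G w T - cell_boundary (graph_cells d G) (graph_cell d G w T) \<longleftrightarrow>
     T = {i. x i \<noteq> 0} \<and> (v, w) \<in> linked G {i. x i = 0}"
proof -
  have "graph_point d G v x \<in> graph_point d G w ` {x \<in> simplex_face d T. \<exists>i\<in>T. x i = 0} \<longleftrightarrow>
      x \<in> simplex_face d T \<and> (\<exists>i\<in>T. x i = 0) \<and> (v, w) \<in> linked G {i. x i = 0}"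
  proof
    assume "graph_point d G v x \<in> graph_point d G w ` {x \<in> simplex_face d T. \<exists>i\<in>T. x i = 0}"
    then obtain y where y: "y \<in> simplex_face d T" "\<exists>i\<in>T. y i = 0" "graph_point d G v x = graph_point d G w y"
      by blast
    then have "x = y" "(v, w) \<in> linked G {i. x i = 0}"
      using graph_point_eq_iff[OF assms(1-3) subsetD[OF simplex_face_subset y(1)]] by blast+
    then show "x \<in> simplex_face d T \<and> (\<exists>i\<in>T. x i = 0) \<and> (v, w) \<in> linked G {i. x i = 0}"
      using y by blast
  next
    assume x: "x \<in> simplex_face d T \<and> (\<exists>i\<in>T. x i = 0) \<and> (v, w) \<in> linked G {i. x i = 0}"
    then have "graph_point d G v x = graph_point d G w x"
      using graph_point_eq_iff[OF assms(1-3,3)] by simp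
    then show "graph_point d G v x \<in> graph_point d G w ` {x \<in> simplex_face d T. \<exists>i\<in>T. x i = 0}"
      using x by blast
  qed
  then show ?thesis
    unfolding graph_cell_boundary[OF assms(2,4,5)] Diff_iff graph_point_in_cell_iff[OF assms(1-3)]
    using assms(3) by (auto simp: simplex_face_def)
qed

lemma continuous_map_graph_point:
  "v \<in> verts G \<Longrightarrow> continuous_map (top_of_set (standard_simplex d)) (graph_space d G) (graph_point d G v)"
proof -
  assume v: "v \<in> verts G"
  have "continuous_map (subtopology (powertop_real UNIV) (standard_simplex d)) (simplex_sum d G) (\<lambda>x. (v, x))"
    unfolding simplex_sum_def
    using continuous_map_component_injection[OF v, of "\<lambda>_. subtopology (powertop_real UNIV) (standard_simplex d)"]
    by simp
  then have "continuous_map (top_of_set (standard_simplex d)) (simplex_sum d G) (\<lambda>x. (v, x))"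
    by (simp add: euclidean_product_topology)
  moreover have "continuous_map (simplex_sum d G) (graph_space d G) (\<lambda>x. glue_rel d G `` {x})"
    unfolding graph_space_def by (intro quotient_imp_continuous_map quotient_map_quotient_topology)
  ultimately have "continuous_map (top_of_set (standard_simplex d)) (graph_space d G)
      ((\<lambda>x. glue_rel d G `` {x}) \<circ> (\<lambda>x. (v, x)))"
    by (rule continuous_map_compose)
  moreover have "(\<lambda>x. glue_rel d G `` {x}) \<circ> (\<lambda>x. (v, x)) = graph_point d G v"
    by (simp add: fun_eq_iff graph_point_def)
  ultimately show ?thesis by simp
qed

text \<open>No two points of one face are identified, since gluing preserves coordinates. A continuous injection
of a compact face into a Hausdorff space is an embedding.\<close>

lemma regular_graph_cell:
  assumes H: "Hausdorff_space (graph_space d G)" and v: "v \<in> verts G"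
    and T: "T \<subseteq> {..d}" "card T = Suc n"
  shows "regular_cell (graph_space d G) (graph_cells d G) n (graph_cell d G v T)"
proof -
  have Tne: "T \<noteq> {}" using T(2) by auto
  let ?F = "simplex_face d T" and ?p = "graph_point d G v"
  obtain \<psi> where \<psi>: "homeomorphic_map (top_of_set ?F) (closed_disc n) \<psi>"
    and bd: "\<And>x. x \<in> ?F \<Longrightarrow> (\<Sum>i<n. (\<psi> x i)\<^sup>2) = 1 \<longleftrightarrow> (\<exists>i\<in>T. x i = 0)"
    using simplex_face_homeomorphic_disc[OF T] by blast
  then obtain \<phi> where hm: "homeomorphic_maps (top_of_set ?F) (closed_disc n) \<psi> \<phi>"
    using homeomorphic_map_maps by blast
  then have \<phi>: "homeomorphic_map (closed_disc n) (top_of_set ?F) \<phi>"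
    and inv: "\<And>x. x \<in> ?F \<Longrightarrow> \<phi> (\<psi> x) = x" "\<And>y. y \<in> topspace (closed_disc n) \<Longrightarrow> \<psi> (\<phi> y) = y"
    by (auto simp: homeomorphic_maps_map)
  have \<phi>im: "\<phi> ` topspace (closed_disc n) = ?F"
    using homeomorphic_imp_surjective_map[OF \<phi>] by simp
  have cell: "graph_cell d G v T \<subseteq> topspace (graph_space d G)"
    unfolding graph_cell_def topspace_graph_space using v simplex_face_subset by blast
  have "homeomorphic_map (top_of_set ?F) (subtopology (graph_space d G) (graph_cell d G v T)) ?p"
  proof (rule continuous_imp_homeomorphic_map)
    have "continuous_map (top_of_set ?F) (graph_space d G) ?p"
      using continuous_map_from_subtopology_mono[OF continuous_map_graph_point[OF v] simplex_face_subset] .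
    then show "continuous_map (top_of_set ?F) (subtopology (graph_space d G) (graph_cell d G v T)) ?p"
      by (auto simp: continuous_map_in_subtopology graph_cell_def)
    show "compact_space (top_of_set ?F)"
      using compact_simplex_face by (simp add: compact_space_subtopology)
    show "Hausdorff_space (subtopology (graph_space d G) (graph_cell d G v T))"
      by (rule Hausdorff_space_subtopology[OF H])
    show "?p ` topspace (top_of_set ?F) = topspace (subtopology (graph_space d G) (graph_cell d G v T))"
      using cell by (auto simp: graph_cell_def)
    show "inj_on ?p (topspace (top_of_set ?F))"
    proof (rule inj_onI)
      fix x y assume "x \<in> topspace (top_of_set ?F)" "y \<in> topspace (top_of_set ?F)"
      then have "x \<in> standard_simplex d" "y \<in> standard_simplex d"
        using subsetD[OF simplex_face_subset] by simp_all
      then show "?p x = ?p y \<Longrightarrow> x = y" using graph_point_eq_iff[OF v v] by simp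
    qed
  qed
  then have "homeomorphic_map (closed_disc n) (subtopology (graph_space d G) (graph_cell d G v T)) (?p \<circ> \<phi>)"
    by (rule homeomorphic_map_compose[OF \<phi>])
  moreover have "\<phi> ` {y \<in> topspace (closed_disc n). (\<Sum>i<n. (y i)\<^sup>2) = 1} = {x \<in> ?F. \<exists>i\<in>T. x i = 0}"
  proof (intro equalityI subsetI)
    fix x assume "x \<in> \<phi> ` {y \<in> topspace (closed_disc n). (\<Sum>i<n. (y i)\<^sup>2) = 1}"
    then obtain y where y: "y \<in> topspace (closed_disc n)" "(\<Sum>i<n. (y i)\<^sup>2) = 1" "x = \<phi> y" by blast
    then show "x \<in> {x \<in> ?F. \<exists>i\<in>T. x i = 0}" using bd[of x] inv(2)[of y] \<phi>im by auto
  next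
    fix x assume x: "x \<in> {x \<in> ?F. \<exists>i\<in>T. x i = 0}"
    then have "(\<Sum>i<n. (\<psi> x i)\<^sup>2) = 1" "\<phi> (\<psi> x) = x" using bd inv by auto
    moreover have "\<psi> x \<in> topspace (closed_disc n)"
      using x homeomorphic_imp_surjective_map[OF \<psi>] by force
    ultimately show "x \<in> \<phi> ` {y \<in> topspace (closed_disc n). (\<Sum>i<n. (y i)\<^sup>2) = 1}" by force
  qed
  then have "(?p \<circ> \<phi>) ` {y \<in> topspace (closed_disc n). (\<Sum>i<n. (y i)\<^sup>2) = 1} =
      cell_boundary (graph_cells d G) (graph_cell d G v T)"
    by (simp only: graph_cell_boundary[OF v T(1) Tne] image_comp[symmetric])
  ultimately show ?thesis unfolding regular_cell_def by blast
qed

text \<open>A cell below the cell of \<open>v\<close> and \<open>T\<close> is the cell of \<open>v\<close> and a unique subset of \<open>T\<close>, which gives the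
order isomorphism to the subsets of the vertex set; the empty face corresponds to the empty subset.\<close>

lemma simplicial_boundary_graph_cell:
  assumes v: "v \<in> verts G" and T: "T \<subseteq> {..d}" "card T = Suc n"
  shows "simplicial_boundary (graph_cells d G) n (graph_cell d G v T)"
proof -
  let ?c = "graph_cell d G v"
  have Tne: "T \<noteq> {}" using T(2) by auto
  have fT: "finite T" using T finite_subset by blast
  have "finite {..n}" "card T = card {..n}" using T(2) by auto
  then obtain e where e: "bij_betw e T {..n}" using fT finite_same_card_bij by blast
  have empty: "?c {} = {}" using simplex_support[of _ d] by (auto simp: graph_cell_def simplex_face_def)
  have ne: "?c S \<noteq> {}" if "S \<subseteq> T" "S \<noteq> {}" for S
    using simplex_face_barycenter[of S d] that T(1) unfolding graph_cell_def by (metis image_is_empty empty_iff order_trans)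
  have sub: "?c S \<subseteq> ?c S' \<longleftrightarrow> S \<subseteq> S'" if "S \<subseteq> T" "S' \<subseteq> T" for S S'
  proof (cases "S = {}")
    case False
    then show ?thesis using graph_cell_subset_iff[OF v v, of S d S'] that T(1) by auto
  qed (use empty in simp)
  have inj: "inj_on ?c (Pow T)"
    by (rule inj_onI) (use sub in blast)
  let ?A = "{a \<in> insert {} (graph_cells d G). a \<subset> ?c T}"
  have A: "?A = ?c ` {S. S \<subset> T}"
  proof (intro equalityI subsetI)
    fix a assume a: "a \<in> ?A"
    show "a \<in> ?c ` {S. S \<subset> T}"
    proof (cases "a = {}")
      case True
      then show ?thesis using empty Tne by blast
    next
      case False
      then obtain w S where S: "w \<in> verts G" "S \<subseteq> {..d}" "S \<noteq> {}" "a = graph_cell d G w S"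
        using a unfolding graph_cells_alt by blast
      then have "S \<subset> T" "(w, v) \<in> linked G (- S)"
        using a graph_cell_psubset_iff[OF S(1) v S(2,3) T(1) Tne] by auto
      then show ?thesis using S(4) graph_cell_eq_iff[OF S(1) v S(2,3) S(2,3)] by simp
    qed
  next
    fix a assume "a \<in> ?c ` {S. S \<subset> T}"
    then obtain S where S: "S \<subset> T" "a = ?c S" by blast
    have "a \<in> insert {} (graph_cells d G)"
    proof (cases "S = {}")
      case False
      moreover have "S \<subseteq> {..d}" using S(1) T(1) by blast
      ultimately show ?thesis using S(2) v unfolding graph_cells_alt by blast
    qed (use S(2) empty in simp)
    moreover have "a \<subset> ?c T" using S sub[of S T] sub[of T S] by auto
    ultimately show "a \<in> ?A" by blast
  qed
  define f where "f = (\<lambda>a. e ` the_inv_into (Pow T) ?c a)"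
  have f: "f (?c S) = e ` S" if "S \<subseteq> T" for S
    using that inj by (simp add: f_def the_inv_into_f_f)
  have e_sub: "e ` S \<subseteq> e ` S' \<longleftrightarrow> S \<subseteq> S'" if "S \<subseteq> T" "S' \<subseteq> T" for S S'
    using e that by (auto simp: bij_betw_def inj_on_image_subset_iff)
  have order: "a \<subseteq> b \<longleftrightarrow> f a \<subseteq> f b" if "a \<in> ?A" "b \<in> ?A" for a b
  proof -
    have "a \<in> ?c ` {S. S \<subset> T}" "b \<in> ?c ` {S. S \<subset> T}" using that unfolding A .
    then obtain S S' where "S \<subset> T" "S' \<subset> T" "a = ?c S" "b = ?c S'" by (elim imageE) simp
    then show ?thesis using f sub e_sub by (simp add: psubset_imp_subset)
  qed
  have "inj_on f ?A"
  proof (rule inj_onI)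
    fix a b assume ab: "a \<in> ?A" "b \<in> ?A" "f a = f b"
    show "a = b" using order[OF ab(1,2)] order[OF ab(2,1)] ab(3) by simp
  qed
  moreover have "f ` ?A = {S. S \<subset> {..n}}"
  proof -
    have "f ` ?A = (\<lambda>S. e ` S) ` {S. S \<subset> T}"
      unfolding A image_image using f by (intro image_cong) auto
    also have "\<dots> = {S. S \<subset> {..n}}"
    proof (intro equalityI subsetI)
      fix S assume "S \<in> {S. S \<subset> {..n}}"
      then have S: "S \<subset> e ` T" using e by (auto simp: bij_betw_def)
      then have "S = e ` (T \<inter> e -` S)" by auto
      moreover have "T \<inter> e -` S \<subset> T" using S by auto
      ultimately show "S \<in> (\<lambda>S. e ` S) ` {S. S \<subset> T}" by blast
    next
      fix S assume "S \<in> (\<lambda>S. e ` S) ` {S. S \<subset> T}"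
      then obtain S' where S': "S' \<subset> T" "S = e ` S'" by blast
      then have "e ` S' \<subset> e ` T" using e_sub[of T S'] by blast
      then show "S \<in> {S. S \<subset> {..n}}" using S' e by (simp add: bij_betw_def)
    qed
    finally show ?thesis .
  qed
  ultimately have "bij_betw f ?A {S. S \<subset> {..n}}" by (simp add: bij_betw_def)
  then show ?thesis
    unfolding simplicial_boundary_def
  proof (intro exI[of _ f] conjI ballI impI)
    fix a b assume "a \<in> insert {} (graph_cells d G)" "b \<in> insert {} (graph_cells d G)"
      "a \<subset> ?c T" "b \<subset> ?c T"
    then show "a \<subseteq> b \<longleftrightarrow> f a \<subseteq> f b" by (intro order CollectI conjI)
  qed
qed

theorem simplicial_cell_complex_graph_space:
  assumes G: "finite (verts G)" "verts G \<noteq> {}" and H: "Hausdorff_space (graph_space d G)"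
  shows "simplicial_cell_complex d (graph_space d G) (graph_cells d G)"
proof -
  let ?W = "graph_space d G" and ?C = "graph_cells d G"
  have cell: "\<exists>n\<le>d. regular_cell ?W ?C n c \<and> simplicial_boundary ?C n c" if c: "c \<in> ?C" for c
  proof -
    obtain v S where S: "v \<in> verts G" "S \<subseteq> {..d}" "S \<noteq> {}" "c = graph_cell d G v S"
      using c unfolding graph_cells_alt by blast
    have "0 < card S" using S finite_subset[of S "{..d}"] by (simp add: card_gt_0_iff)
    moreover have "card S \<le> Suc d" using S(2) card_mono[of "{..d}" S] by simp
    ultimately obtain n where "card S = Suc n" "n \<le> d" by (metis Suc_le_mono gr0_implies_Suc)
    then show ?thesis using regular_graph_cell[OF H S(1,2)] simplicial_boundary_graph_cell[OF S(1,2)] S(4) by blast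
  qed
  have fin: "finite ?C"
  proof -
    have "?C \<subseteq> (\<lambda>(v, S). graph_cell d G v S) ` (verts G \<times> Pow {..d})" by (auto simp: graph_cells_alt)
    then show ?thesis using G(1) by (meson finite_Pow_iff finite_SigmaI finite_atMost finite_imageI finite_subset)
  qed
  have U: "\<Union>?C = topspace ?W"
  proof
    show "\<Union>?C \<subseteq> topspace ?W"
      using simplex_face_subset by (fastforce simp: graph_cells_alt graph_cell_def topspace_graph_space)
    have "simplex_face d {..d} = standard_simplex d"
      by (auto simp: simplex_face_def standard_simplex_def)
    then show "topspace ?W \<subseteq> \<Union>?C"
      unfolding graph_cells_alt topspace_graph_space graph_cell_def by blast
  qed
  have ex1: "\<exists>!c. c \<in> ?C \<and> z \<in> c - cell_boundary ?C c" if z: "z \<in> topspace ?W" for z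
  proof -
    obtain v x where x: "v \<in> verts G" "x \<in> standard_simplex d" "z = graph_point d G v x"
      using z by (auto simp: topspace_graph_space)
    let ?S = "{i. x i \<noteq> 0}"
    note S = simplex_support[OF x(2)]
    show ?thesis
    proof (rule ex1I[of _ "graph_cell d G v ?S"])
      show "graph_cell d G v ?S \<in> ?C \<and> z \<in> graph_cell d G v ?S - cell_boundary ?C (graph_cell d G v ?S)"
      proof
        show "graph_cell d G v ?S \<in> ?C" using x(1) S unfolding graph_cells_alt by blast
        show "z \<in> graph_cell d G v ?S - cell_boundary ?C (graph_cell d G v ?S)"
          unfolding x(3) graph_point_interior_iff[OF x(1,1,2) S] by simp
      qed
      fix c assume c: "c \<in> ?C \<and> z \<in> c - cell_boundary ?C c"
      then have "c \<in> ?C" by blast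
      then obtain w T where T: "w \<in> verts G" "T \<subseteq> {..d}" "T \<noteq> {}" "c = graph_cell d G w T"
        unfolding graph_cells_alt by blast
      then have wT: "T = ?S" "(v, w) \<in> linked G {i. x i = 0}"
        using c graph_point_interior_iff[OF x(1) T(1) x(2) T(2,3)] x(3) by auto
      moreover have "{i. x i = 0} = - ?S" by auto
      ultimately have "(w, v) \<in> linked G (- T)" using linked_sym by metis
      then show "c = graph_cell d G v ?S"
        using graph_cell_eq_iff[OF T(1) x(1) T(2,3) S] T(4) wT(1) by simp
    qed
  qed
  have weak: "closedin ?W A" if A: "A \<subseteq> topspace ?W" "\<forall>c\<in>?C. closedin ?W (A \<inter> c)" for A
  proof -
    have "A = (\<Union>c\<in>?C. A \<inter> c)" using A(1) U by blast
    then show ?thesis using fin A(2) closedin_Union[of "(\<lambda>c. A \<inter> c) ` ?C" ?W] by auto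
  qed
  obtain v where v: "v \<in> verts G" using G(2) by blast
  have "regular_cell ?W ?C d (graph_cell d G v {..d})" by (rule regular_graph_cell[OF H v]) auto
  moreover have "graph_cell d G v {..d} \<in> ?C" using v unfolding graph_cells_alt by blast
  ultimately have top: "\<exists>c\<in>?C. regular_cell ?W ?C d c" by blast
  have sub: "\<forall>c\<in>?C. finite {c' \<in> ?C. c' \<subseteq> c}" using fin by simp
  have reg: "\<forall>c\<in>?C. \<exists>n. regular_cell ?W ?C n c" using cell by blast
  have "regular_CW_complex ?W ?C"
    unfolding regular_CW_complex_def
  proof (intro conjI H U reg sub)
    show "\<forall>z\<in>topspace ?W. \<exists>!c. c \<in> ?C \<and> z \<in> c - cell_boundary ?C c" by (rule ballI, rule ex1)
    show "\<forall>A\<subseteq>topspace ?W. (\<forall>c\<in>?C. closedin ?W (A \<inter> c)) \<longrightarrow> closedin ?W A"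
      by (intro allI impI, rule weak)
  qed
  then show ?thesis unfolding simplicial_cell_complex_def using cell top by blast
qed


section \<open>Simplicial fans in convex position\<close>

text \<open>Facets are given by their vertices, listed by label; adjacent facets differ exactly in the vertex with label \<open>i\<close>.\<close>

definition adjacent_facets :: "nat \<Rightarrow> nat \<Rightarrow> (nat \<Rightarrow> 'a) \<Rightarrow> (nat \<Rightarrow> 'a) \<Rightarrow> bool" where
  "adjacent_facets d i f g \<longleftrightarrow> g i \<noteq> f i \<and> (\<forall>k\<le>d. k \<noteq> i \<longrightarrow> g k = f k)"

text \<open>A finite family of labelled simplices that are facets of a convex polytope around 0, as witnessed by
supporting functionals, such that no facet has a free face. That the facets make up the whole
boundary of the polytope is a consequence.\<close>

locale simplicial_fan =
  fixes d :: nat and R :: "(nat \<Rightarrow> 'a::euclidean_space) set"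
  assumes dim: "DIM('a) = Suc d"
    and finite_facets: "finite R" and facets_nonempty: "R \<noteq> {}"
    and support: "f \<in> R \<Longrightarrow> \<exists>n. (\<forall>i\<le>d. n \<bullet> f i = 1) \<and>
          (\<forall>g\<in>R. \<forall>i\<le>d. n \<bullet> g i \<le> 1 \<and> (n \<bullet> g i = 1 \<longrightarrow> g i = f i))"
    and indep: "f \<in> R \<Longrightarrow> (\<Sum>i\<le>d. c i *\<^sub>R f i) = 0 \<Longrightarrow> i \<le> d \<Longrightarrow> c i = 0"
    and neighbour: "f \<in> R \<Longrightarrow> i \<le> d \<Longrightarrow> \<exists>g\<in>R. adjacent_facets d i f g"
begin

abbreviation "adjacent \<equiv> adjacent_facets d"

text \<open>Applying the supporting functional of one facet to a common point of two cones compares the coordinate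
sums; doing so in both directions forces equality, which leaves only common vertices.\<close>

lemma cone_inj_aux:
  assumes "f \<in> R" "g \<in> R" "\<And>i. i \<le> d \<Longrightarrow> 0 \<le> y i"
    and eq: "(\<Sum>i\<le>d. x i *\<^sub>R f i) = (\<Sum>i\<le>d. y i *\<^sub>R g i)"
  obtains n where "\<And>i. i \<le> d \<Longrightarrow> n \<bullet> g i = 1 \<Longrightarrow> g i = f i"
    "\<And>i. i \<le> d \<Longrightarrow> n \<bullet> g i \<le> 1"
    "sum x {..d} = (\<Sum>i\<le>d. y i * (n \<bullet> g i))" "sum x {..d} \<le> sum y {..d}"
proof -
  obtain n where n: "\<forall>i\<le>d. n \<bullet> f i = 1" "\<forall>g\<in>R. \<forall>i\<le>d. n \<bullet> g i \<le> 1 \<and> (n \<bullet> g i = 1 \<longrightarrow> g i = f i)"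
    using support[OF \<open>f \<in> R\<close>] by blast
  have "sum x {..d} = (\<Sum>i\<le>d. x i * (n \<bullet> f i))" using n(1) by simp
  also have "\<dots> = n \<bullet> (\<Sum>i\<le>d. x i *\<^sub>R f i)" by (simp add: inner_sum_right)
  also have "\<dots> = (\<Sum>i\<le>d. y i * (n \<bullet> g i))" by (simp add: eq inner_sum_right)
  finally have s: "sum x {..d} = (\<Sum>i\<le>d. y i * (n \<bullet> g i))" .
  have "(\<Sum>i\<le>d. y i * (n \<bullet> g i)) \<le> (\<Sum>i\<le>d. y i * 1)"
    using n(2) assms by (intro sum_mono mult_left_mono) auto
  then have "sum x {..d} \<le> sum y {..d}" using s by simp
  then show thesis using that[of n] n(2) assms s by blast
qed

lemma cone_inj:
  assumes fg: "f \<in> R" "g \<in> R" and x: "\<And>i. i \<le> d \<Longrightarrow> 0 \<le> x i" and y: "\<And>i. i \<le> d \<Longrightarrow> 0 \<le> y i"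
    and eq: "(\<Sum>i\<le>d. x i *\<^sub>R f i) = (\<Sum>i\<le>d. y i *\<^sub>R g i)" and i: "i \<le> d"
  shows "x i = y i" and "y i > 0 \<Longrightarrow> f i = g i"
proof -
  obtain n where n: "\<And>i. i \<le> d \<Longrightarrow> n \<bullet> g i = 1 \<Longrightarrow> g i = f i" "\<And>i. i \<le> d \<Longrightarrow> n \<bullet> g i \<le> 1"
    "sum x {..d} = (\<Sum>i\<le>d. y i * (n \<bullet> g i))" "sum x {..d} \<le> sum y {..d}"
    using cone_inj_aux[OF fg y eq] by blast
  have "sum y {..d} \<le> sum x {..d}"
    using cone_inj_aux[OF fg(2,1) x eq[symmetric]] by metis
  then have "(\<Sum>i\<le>d. y i * (1 - n \<bullet> g i)) = 0"
    using n(3,4) by (simp add: right_diff_distrib sum_subtractf)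
  moreover have "\<forall>i\<in>{..d}. 0 \<le> y i * (1 - n \<bullet> g i)" using y n(2) by simp
  ultimately have "\<forall>i\<in>{..d}. y i * (1 - n \<bullet> g i) = 0"
    by (subst (asm) sum_nonneg_eq_0_iff) auto
  then have pos: "f i = g i" if "i \<le> d" "y i > 0" for i
    using that n(1)[of i] by force
  then show "y i > 0 \<Longrightarrow> f i = g i" using i by blast
  have "(\<Sum>i\<le>d. y i *\<^sub>R g i) = (\<Sum>i\<le>d. y i *\<^sub>R f i)"
  proof (rule sum.cong)
    fix i assume "i \<in> {..d}"
    then show "y i *\<^sub>R g i = y i *\<^sub>R f i" using pos[of i] y[of i] by (cases "y i = 0") auto
  qed simp
  then have "(\<Sum>i\<le>d. (x i - y i) *\<^sub>R f i) = 0"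
    using eq by (simp add: scaleR_left_diff_distrib sum_subtractf)
  from indep[OF fg(1) this i] show "x i = y i" by simp
qed

lemma coordinates_exist:
  assumes "f \<in> R"
  shows "\<exists>\<phi>. \<forall>i\<le>d. linear (\<phi> i) \<and> (\<forall>k\<le>d. \<phi> i (f k) = (of_bool (k = i) :: real))"
    and "z \<in> range (\<lambda>c. \<Sum>i\<le>d. c i *\<^sub>R f i)"
proof -
  have inj: "inj_on f {..d}"
  proof (rule inj_onI, rule ccontr)
    fix i j assume ij: "i \<in> {..d}" "j \<in> {..d}" "f i = f j" "i \<noteq> j"
    have "(\<Sum>k\<le>d. (of_bool (k = i) - of_bool (k = j)) *\<^sub>R f k) =
          (\<Sum>k\<le>d. if k = i then f k else 0) - (\<Sum>k\<le>d. if k = j then f k else 0)"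
      unfolding sum_subtractf[symmetric] by (rule sum.cong) auto
    also have "\<dots> = 0" using ij by simp
    finally show False using indep[OF assms, of _ i] ij by fastforce
  qed
  have ind: "independent (f ` {..d})"
  proof (rule ccontr)
    assume "\<not> independent (f ` {..d})"
    then obtain u v where u: "v \<in> f ` {..d}" "u v \<noteq> 0" "(\<Sum>v\<in>f ` {..d}. u v *\<^sub>R v) = 0"
      using dependent_finite[of "f ` {..d}"] by auto
    then have "(\<Sum>i\<le>d. u (f i) *\<^sub>R f i) = 0" using sum.reindex[OF inj, of "\<lambda>v. u v *\<^sub>R v"] by simp
    then show False using indep[OF assms, of "\<lambda>i. u (f i)"] u by blast
  qed
  have "\<exists>g. linear g \<and> (\<forall>k\<le>d. g (f k) = (of_bool (k = i) :: real))" if "i \<le> d" for i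
  proof -
    obtain g where "linear g" "\<forall>v\<in>f ` {..d}. g v = (of_bool (v = f i) :: real)"
      using linear_independent_extend[OF ind, of "\<lambda>v. of_bool (v = f i)"] by blast
    moreover have "f k = f i \<longleftrightarrow> k = i" if "k \<le> d" for k
      using inj \<open>i \<le> d\<close> that by (auto dest: inj_onD)
    ultimately have "\<forall>k\<le>d. g (f k) = of_bool (k = i)" by simp
    then show ?thesis using \<open>linear g\<close> by blast
  qed
  then show "\<exists>\<phi>. \<forall>i\<le>d. linear (\<phi> i) \<and> (\<forall>k\<le>d. \<phi> i (f k) = (of_bool (k = i) :: real))"
    by metis
  have "card (f ` {..d}) = DIM('a)" using dim card_image[OF inj] by simp
  then have "span (f ` {..d}) = UNIV"
    using card_ge_dim_independent[of "f ` {..d}" UNIV] ind by (auto simp: dim_UNIV)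
  then obtain u where "z = (\<Sum>v\<in>f ` {..d}. u v *\<^sub>R v)"
    using span_finite[of "f ` {..d}"] by blast
  then have "z = (\<Sum>i\<le>d. u (f i) *\<^sub>R f i)"
    using sum.reindex[OF inj, of "\<lambda>v. u v *\<^sub>R v"] by simp
  then show "z \<in> range (\<lambda>c. \<Sum>i\<le>d. c i *\<^sub>R f i)" by (intro range_eqI)
qed

definition coord :: "(nat \<Rightarrow> 'a) \<Rightarrow> nat \<Rightarrow> 'a \<Rightarrow> real" where
  "coord f = (SOME \<phi>. \<forall>i\<le>d. linear (\<phi> i) \<and> (\<forall>k\<le>d. \<phi> i (f k) = (of_bool (k = i) :: real)))"

lemma linear_coord: "f \<in> R \<Longrightarrow> i \<le> d \<Longrightarrow> linear (coord f i)"
  and coord_vertex: "f \<in> R \<Longrightarrow> i \<le> d \<Longrightarrow> k \<le> d \<Longrightarrow> coord f i (f k) = of_bool (k = i)"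
  using someI_ex[OF coordinates_exist(1)] unfolding coord_def by blast+

lemma coord_sum:
  assumes "f \<in> R" "k \<le> d"
  shows "coord f k (\<Sum>i\<le>d. c i *\<^sub>R f i) = c k"
proof -
  have "coord f k (\<Sum>i\<le>d. c i *\<^sub>R f i) = (\<Sum>i\<le>d. c i * coord f k (f i))"
    using linear_coord[OF assms] by (simp add: linear_sum linear_scale)
  also have "\<dots> = (\<Sum>i\<le>d. if i = k then c i else 0)"
    using assms by (intro sum.cong) (auto simp: coord_vertex)
  also have "\<dots> = c k" using assms by simp
  finally show ?thesis .
qed

lemma sum_coord:
  assumes "f \<in> R"
  shows "(\<Sum>i\<le>d. coord f i z *\<^sub>R f i) = z"
proof -
  obtain c where "z = (\<Sum>i\<le>d. c i *\<^sub>R f i)" using coordinates_exist(2)[OF assms, of z] by blast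
  then show ?thesis using coord_sum[OF assms] by auto
qed

lemma continuous_coord: "f \<in> R \<Longrightarrow> i \<le> d \<Longrightarrow> continuous_on A (coord f i)"
  using linear_coord linear_continuous_on linear_conv_bounded_linear by blast

definition cone :: "(nat \<Rightarrow> 'a) \<Rightarrow> 'a set" where
  "cone f = {z. \<forall>i\<le>d. 0 \<le> coord f i z}"

definition open_cone :: "(nat \<Rightarrow> 'a) \<Rightarrow> 'a set" where
  "open_cone f = {z. \<forall>i\<le>d. 0 < coord f i z}"

lemma closed_cone: "f \<in> R \<Longrightarrow> closed (cone f)"
proof -
  assume f: "f \<in> R"
  have "cone f = (\<Inter>i\<in>{..d}. {z. 0 \<le> coord f i z})" by (auto simp: cone_def)
  moreover have "closed {z. 0 \<le> coord f i z}" if "i \<le> d" for i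
    using continuous_coord[OF f that] by (intro closed_Collect_le) auto
  ultimately show ?thesis by (auto intro: closed_INT)
qed

lemma open_open_cone: "f \<in> R \<Longrightarrow> open (open_cone f)"
proof -
  assume f: "f \<in> R"
  have "open_cone f = (\<Inter>i\<in>{..d}. {z. 0 < coord f i z})" by (auto simp: open_cone_def)
  moreover have "open {z. 0 < coord f i z}" if "i \<le> d" for i
    using continuous_coord[OF f that] by (intro open_Collect_less) auto
  ultimately show ?thesis by (auto intro: open_INT)
qed

lemma sum_in_cone: "f \<in> R \<Longrightarrow> (\<And>i. i \<le> d \<Longrightarrow> 0 \<le> c i) \<Longrightarrow> (\<Sum>i\<le>d. c i *\<^sub>R f i) \<in> cone f"
  by (simp add: cone_def coord_sum)

lemma sum_in_open_cone: "f \<in> R \<Longrightarrow> (\<And>i. i \<le> d \<Longrightarrow> 0 < c i) \<Longrightarrow> (\<Sum>i\<le>d. c i *\<^sub>R f i) \<in> open_cone f"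
  by (simp add: open_cone_def coord_sum)

lemma open_cone_subset: "open_cone f \<subseteq> cone f"
  by (auto simp: cone_def open_cone_def less_imp_le)

lemma common_face:
  assumes "f \<in> R" "g \<in> R" "z \<in> cone f" "z \<in> cone g" "i \<le> d"
  shows "coord f i z = coord g i z" and "coord f i z \<noteq> 0 \<Longrightarrow> f i = g i"
proof -
  have eq: "(\<Sum>i\<le>d. coord f i z *\<^sub>R f i) = (\<Sum>i\<le>d. coord g i z *\<^sub>R g i)"
    using assms sum_coord by simp
  show 1: "coord f i z = coord g i z"
    by (rule cone_inj(1)[OF assms(1,2) _ _ eq]) (use assms in \<open>auto simp: cone_def\<close>)
  show "coord f i z \<noteq> 0 \<Longrightarrow> f i = g i"
    by (rule cone_inj(2)[OF assms(1,2) _ _ eq]) (use assms 1 in \<open>auto simp: cone_def less_le\<close>)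
qed

lemma open_cone_unique:
  assumes "f \<in> R" "g \<in> R" "z \<in> open_cone f" "z \<in> cone g" "i \<le> d"
  shows "f i = g i"
  using common_face(2)[of f g z i] assms open_cone_subset[of f] by (force simp: open_cone_def)

text \<open>The coordinates of label \<open>i\<close> in two facets adjacent across \<open>i\<close> vanish on the same hyperplane, hence are proportional.\<close>

lemma coord_neighbour:
  assumes "f \<in> R" "g \<in> R" "i \<le> d" "adjacent i f g"
  shows "coord f i z = coord f i (g i) * coord g i z"
proof -
  have "coord f i z = coord f i (\<Sum>k\<le>d. coord g k z *\<^sub>R g k)" using sum_coord[OF assms(2)] by simp
  also have "\<dots> = (\<Sum>k\<le>d. coord g k z * coord f i (g k))"
    using linear_coord[OF assms(1,3)] by (simp add: linear_sum linear_scale)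
  also have "\<dots> = (\<Sum>k\<le>d. if k = i then coord g k z * coord f i (g k) else 0)"
    using assms by (intro sum.cong) (auto simp: adjacent_facets_def coord_vertex)
  also have "\<dots> = coord f i (g i) * coord g i z" using assms by simp
  finally show ?thesis .
qed

text \<open>Expand the new vertex \<open>g i\<close> in the basis \<open>f\<close>. The supporting functionals of \<open>f\<close> and \<open>g\<close> agree on the common
vertices, so their difference at \<open>g i\<close>, which is negative, comes from the coordinate at \<open>f i\<close> alone.\<close>

lemma neighbour_opposite:
  assumes "f \<in> R" "g \<in> R" "i \<le> d" "adjacent i f g"
  shows "coord f i (g i) < 0"
proof -
  obtain n where n: "\<forall>i\<le>d. n \<bullet> f i = 1" "n \<bullet> g i \<le> 1" "n \<bullet> g i = 1 \<longrightarrow> g i = f i"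
    using support[OF assms(1)] assms(2,3) by blast
  obtain m where m: "\<forall>i\<le>d. m \<bullet> g i = 1" "m \<bullet> f i \<le> 1" "m \<bullet> f i = 1 \<longrightarrow> f i = g i"
    using support[OF assms(2)] assms(1,3) by blast
  have lt: "n \<bullet> g i < 1" "m \<bullet> f i < 1" using n m assms(4) by (auto simp: adjacent_facets_def less_le)
  let ?c = "\<lambda>k. coord f k (g i)"
  have expand: "v \<bullet> g i = (\<Sum>k\<le>d. ?c k * (v \<bullet> f k))" for v
    using arg_cong[OF sum_coord[OF assms(1), of "g i"], of "inner v"] by (simp add: inner_sum_right)
  have "n \<bullet> g i - m \<bullet> g i = (\<Sum>k\<le>d. ?c k * (1 - m \<bullet> f k))"
    unfolding expand using n(1) by (simp add: right_diff_distrib sum_subtractf)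
  also have "\<dots> = (\<Sum>k\<le>d. if k = i then ?c i * (1 - m \<bullet> f i) else 0)"
    using m(1) assms(4) by (intro sum.cong) (auto simp: adjacent_facets_def)
  also have "\<dots> = ?c i * (1 - m \<bullet> f i)" using assms(3) by simp
  finally have "?c i * (1 - m \<bullet> f i) < 0" using lt(1) m(1) assms(3) by simp
  then show ?thesis using lt(2) by (simp add: mult_less_0_iff)
qed

text \<open>Because adjacent facets lie on opposite sides of the common face, one of the two proportional
coordinates is nonnegative at every nearby point, while the other coordinates stay positive.\<close>

lemma eventually_in_neighbours:
  assumes fg: "f \<in> R" "g \<in> R" "i \<le> d" "adjacent i f g"
    and z: "z \<in> cone f" "\<And>k. k \<le> d \<Longrightarrow> k \<noteq> i \<Longrightarrow> coord f k z \<noteq> 0" "coord f i z = 0"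
  shows "z \<in> cone g" "eventually (\<lambda>y. y \<in> cone f \<union> cone g) (nhds z)"
proof -
  have zf: "z = (\<Sum>k\<le>d. coord f k z *\<^sub>R g k)"
  proof -
    have "(\<Sum>k\<le>d. coord f k z *\<^sub>R f k) = (\<Sum>k\<le>d. coord f k z *\<^sub>R g k)"
      using assms by (intro sum.cong) (auto simp: adjacent_facets_def)
    then show ?thesis using sum_coord[OF fg(1)] by simp
  qed
  have cg: "coord g k z = coord f k z" if "k \<le> d" for k
    using coord_sum[OF fg(2) that, of "\<lambda>k. coord f k z"] zf by simp
  then show "z \<in> cone g" using z(1) by (simp add: cone_def)
  have pos: "coord f k z > 0" if "k \<le> d" "k \<noteq> i" for k
    using z that by (force simp: cone_def less_le)
  have ev: "eventually (\<lambda>y. \<forall>k\<in>{..d}-{i}. 0 < coord h k y) (nhds z)" if h: "h = f \<or> h = g" for h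
  proof (subst eventually_ball_finite_distrib, simp, intro ballI)
    fix k assume k: "k \<in> {..d} - {i}"
    have "h \<in> R" using h fg by blast
    then have "open {y. 0 < coord h k y}"
      using continuous_coord[of h k] k by (intro open_Collect_less) auto
    moreover have "0 < coord h k z" using pos cg h k by auto
    ultimately show "eventually (\<lambda>y. 0 < coord h k y) (nhds z)" using eventually_nhds by blast
  qed
  have "eventually (\<lambda>y. (\<forall>k\<in>{..d}-{i}. 0 < coord f k y) \<and> (\<forall>k\<in>{..d}-{i}. 0 < coord g k y)) (nhds z)"
    using ev by (intro eventually_conj) auto
  then show "eventually (\<lambda>y. y \<in> cone f \<union> cone g) (nhds z)"
  proof (rule eventually_mono)
    fix y assume y: "(\<forall>k\<in>{..d}-{i}. 0 < coord f k y) \<and> (\<forall>k\<in>{..d}-{i}. 0 < coord g k y)"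
    have "0 \<le> coord f i y \<or> 0 \<le> coord g i y"
      using coord_neighbour[OF fg, of y] neighbour_opposite[OF fg]
      by (metis mult_nonpos_nonpos less_imp_le linear)
    then show "y \<in> cone f \<union> cone g"
    proof
      assume "0 \<le> coord f i y"
      then have "0 \<le> coord f k y" if "k \<le> d" for k using y that by (cases "k = i") (auto simp: less_imp_le)
      then show ?thesis by (simp add: cone_def)
    next
      assume "0 \<le> coord g i y"
      then have "0 \<le> coord g k y" if "k \<le> d" for k using y that by (cases "k = i") (auto simp: less_imp_le)
      then show ?thesis by (simp add: cone_def)
    qed
  qed
qed

text \<open>Two different neighbours of \<open>f\<close> across \<open>i\<close> would themselves be adjacent across \<open>i\<close>. Then each of the three
facets would lie opposite to the other two, but a hyperplane has only two sides.\<close>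

lemma adjacent_unique:
  assumes f: "f \<in> R" "g \<in> R" "h \<in> R" "i \<le> d" "adjacent i f g" "adjacent i f h" and k: "k \<le> d"
  shows "g k = h k"
proof (cases "k = i")
  case False
  then show ?thesis using assms by (simp add: adjacent_facets_def)
next
  case True
  have "adjacent i g h \<or> g i = h i" using f(5,6) by (auto simp: adjacent_facets_def)
  moreover have "False" if gh: "adjacent i g h"
  proof -
    have "coord f i (h i) = coord f i (g i) * coord g i (h i)" by (rule coord_neighbour[OF f(1,2,4,5)])
    moreover have "coord f i (g i) < 0" "coord f i (h i) < 0" "coord g i (h i) < 0"
      using neighbour_opposite f gh by blast+
    ultimately show False by (metis mult_neg_neg less_asym)
  qed
  ultimately show ?thesis using True by blast
qed

end

lemma open_avoids_hyperplanes:
  fixes U :: "'a::real_normed_vector set"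
  assumes "finite H" "open U" "U \<noteq> {}" and H: "\<And>h. h \<in> H \<Longrightarrow> bounded_linear h \<and> (\<exists>w. h w \<noteq> (0::real))"
  shows "\<exists>z\<in>U. \<forall>h\<in>H. h z \<noteq> 0"
proof -
  have "\<exists>U'\<subseteq>U. open U' \<and> U' \<noteq> {} \<and> (\<forall>z\<in>U'. \<forall>h\<in>H. h z \<noteq> 0)"
    using assms(1) H
  proof (induction H rule: finite_induct)
    case empty
    show ?case using assms by auto
  next
    case (insert h H)
    then obtain U' where U': "U' \<subseteq> U" "open U'" "U' \<noteq> {}" "\<forall>z\<in>U'. \<forall>h\<in>H. h z \<noteq> 0" by auto
    obtain w where w: "h w \<noteq> 0" and h: "bounded_linear h" using insert.prems by blast
    obtain z where "z \<in> U'" using U'(3) by blast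
    have "\<exists>y\<in>U'. h y \<noteq> 0"
    proof (cases "h z = 0")
      case True
      have "((\<lambda>e. z + e *\<^sub>R w) \<longlongrightarrow> z + 0 *\<^sub>R w) (at_right 0)" by (intro tendsto_intros)
      then have "eventually (\<lambda>e. z + e *\<^sub>R w \<in> U') (at_right 0)"
        using U'(2) \<open>z \<in> U'\<close> by (intro topological_tendstoD) auto
      then have "eventually (\<lambda>e. 0 < e \<and> z + e *\<^sub>R w \<in> U') (at_right (0::real))"
        by (intro eventually_conj eventually_at_right_less)
      then obtain e :: real where e: "e > 0" "z + e *\<^sub>R w \<in> U'"
        using eventually_happens'[OF trivial_limit_at_right_real] by blast
      moreover have "h (z + e *\<^sub>R w) \<noteq> 0"
        using True w e(1) by (simp add: linear_simps[OF h])
      ultimately show ?thesis by blast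
    qed (use \<open>z \<in> U'\<close> in blast)
    moreover have "open {y. h y \<noteq> 0}"
      by (intro open_Collect_neq continuous_intros linear_continuous_on h)
    ultimately show ?case using U'
      by (intro exI[of _ "U' \<inter> {y. h y \<noteq> 0}"]) auto
  qed
  then show ?thesis by blast
qed

context simplicial_fan begin

text \<open>The segment avoids all faces of codimension at least two. Points on at most one of the hyperplanes
bounding a cone are the ones that \<open>eventually_in_neighbours\<close> can handle.\<close>

definition generic :: "'a \<Rightarrow> 'a \<Rightarrow> bool" where
  "generic a b \<longleftrightarrow> (\<forall>g\<in>R. \<forall>z\<in>closed_segment a b. \<forall>i\<le>d. \<forall>k\<le>d. i \<noteq> k \<longrightarrow>
     \<not> (coord g i z = 0 \<and> coord g k z = 0))"

text \<open>Choose \<open>b\<close> off all coordinate hyperplanes. A codimension-two plane and \<open>b\<close> span a hyperplane, the kernel of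
the functional \<open>K\<close> below, and a segment from \<open>b\<close> to a point off this hyperplane misses the plane.\<close>

lemma generic_segment:
  assumes "open U" "U \<noteq> {}" "open W" "W \<noteq> {}"
  obtains a b where "a \<in> U" "b \<in> W" "generic a b"
proof -
  have bl: "bounded_linear (coord g i)" if "g \<in> R" "i \<le> d" for g i
    using linear_coord[OF that] linear_conv_bounded_linear by blast
  let ?H = "\<Union>g\<in>R. coord g ` {..d}"
  have fin: "finite ?H" using finite_facets by simp
  have H: "bounded_linear h \<and> (\<exists>w. h w \<noteq> 0)" if hH: "h \<in> ?H" for h
  proof -
    obtain g where g: "g \<in> R" "h \<in> coord g ` {..d}" using hH by blast
    then obtain i where h: "h = coord g i" "g \<in> R" "i \<le> d" by (elim imageE) simp
    then have "h (g i) \<noteq> 0" by (simp add: coord_vertex)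
    then show ?thesis using bl h by blast
  qed
  obtain b where b: "b \<in> W" "\<And>g i. g \<in> R \<Longrightarrow> i \<le> d \<Longrightarrow> coord g i b \<noteq> 0"
    using open_avoids_hyperplanes[OF fin assms(3,4) H] by fastforce
  define K where "K = (\<lambda>g i k z. coord g i z * coord g k b - coord g k z * coord g i b)"
  let ?H' = "\<Union>g\<in>R. \<Union>i\<le>d. K g i ` ({..d} - {i})"
  have fin': "finite ?H'" using finite_facets by simp
  have blK: "bounded_linear (K g i k)" if "g \<in> R" "i \<le> d" "k \<le> d" for g i k
    unfolding K_def using bl that
    by (intro bounded_linear_sub bounded_linear_mult_const) auto
  have H': "bounded_linear h \<and> (\<exists>w. h w \<noteq> 0)" if hH: "h \<in> ?H'" for h
  proof -
    obtain g i k where h: "h = K g i k" "g \<in> R" "i \<le> d" "k \<le> d" "i \<noteq> k" using hH by auto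
    then have "h (g i) \<noteq> 0" using b(2) by (simp add: coord_vertex K_def)
    then show ?thesis using blK h by blast
  qed
  obtain a where "a \<in> U" and "\<forall>h\<in>?H'. h a \<noteq> 0"
    using open_avoids_hyperplanes[OF fin' assms(1,2) H'] by blast
  then have a: "a \<in> U" "\<And>g i k. g \<in> R \<Longrightarrow> i \<le> d \<Longrightarrow> k \<le> d \<Longrightarrow> i \<noteq> k \<Longrightarrow> K g i k a \<noteq> 0" by auto
  show thesis
  proof (rule that[OF a(1) b(1)], unfold generic_def, intro ballI allI impI notI)
    fix g z i k
    assume g: "g \<in> R" "i \<le> d" "k \<le> d" "i \<noteq> k" and z: "z \<in> closed_segment a b"
      and zero: "coord g i z = 0 \<and> coord g k z = 0"
    obtain u where u: "z = (1 - u) *\<^sub>R a + u *\<^sub>R b" using z by (auto simp: in_segment)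
    have "K g i k z = (1 - u) * K g i k a + u * K g i k b"
      unfolding u using blK[OF g(1-3)] by (simp add: linear_simps)
    then have "(1 - u) * K g i k a = 0" using zero by (simp add: K_def)
    then have "z = b" using a(2)[OF g] u by simp
    then show False using b(2) g zero by blast
  qed
qed

text \<open>Follow the segment and collect the facets reached through neighbours. Their closed cones contain a
last point of the segment, and at a generic point the cone containing it, together with at most one
neighbour, already is a neighbourhood; so the last point is the end point.\<close>

lemma segment_chain:
  fixes a b
  defines "M \<equiv> {g \<in> R. cone g \<inter> closed_segment a b \<noteq> {}}"
  assumes f0: "f0 \<in> R" "a \<in> open_cone f0"
    and gen: "generic a b"
  shows "\<exists>g\<in>R. b \<in> cone g \<and> (f0, g) \<in> {(f, g). f \<in> M \<and> g \<in> M \<and> (\<exists>i\<le>d. adjacent i f g)}\<^sup>*"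
proof -
  define E where "E = {(f, g). f \<in> M \<and> g \<in> M \<and> (\<exists>i\<le>d. adjacent i f g)}"
  define A where "A = {g. (f0, g) \<in> E\<^sup>*}"
  have "f0 \<in> M" using f0 open_cone_subset by (auto simp: M_def)
  then have AM: "A \<subseteq> M" by (auto simp: A_def E_def elim: rtranclE)
  then have AR: "A \<subseteq> R" by (auto simp: M_def)
  have "finite A" using AR finite_facets finite_subset by blast
  define \<phi> where "\<phi> = (\<lambda>t::real. (1 - t) *\<^sub>R a + t *\<^sub>R b)"
  have cont: "continuous_on B \<phi>" for B unfolding \<phi>_def by (intro continuous_intros)
  have seg: "\<phi> t \<in> closed_segment a b" if "t \<in> {0..1}" for t
    using that by (auto simp: \<phi>_def in_segment)
  define K where "K = {0..1} \<inter> \<phi> -` (\<Union>g\<in>A. cone g)"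
  have "closed (\<Union>g\<in>A. cone g)" using \<open>finite A\<close> AR closed_cone by (intro closed_UN) auto
  then have "compact K"
    unfolding K_def by (intro compact_Int_closed compact_Icc closed_vimage cont)
  moreover have "f0 \<in> A" by (simp add: A_def)
  then have "0 \<in> K" using f0 open_cone_subset by (auto simp: K_def \<phi>_def)
  ultimately obtain s where s: "s \<in> K" "\<forall>t\<in>K. t \<le> s"
    using compact_attains_sup by blast
  then obtain g where g: "g \<in> A" "\<phi> s \<in> cone g" and s01: "s \<in> {0..1}" by (auto simp: K_def)
  have gR: "g \<in> R" using g AR by blast
  have "s = 1"
  proof (rule ccontr)
    assume "s \<noteq> 1"
    have "eventually (\<lambda>y. y \<in> (\<Union>g\<in>A. cone g)) (nhds (\<phi> s))"
    proof (cases "\<phi> s \<in> open_cone g")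
      case True
      then have "eventually (\<lambda>y. y \<in> open_cone g) (nhds (\<phi> s))"
        using open_open_cone[OF gR] eventually_nhds_in_open by blast
      then show ?thesis using g open_cone_subset by (auto elim!: eventually_mono)
    next
      case False
      then obtain i where i: "i \<le> d" "coord g i (\<phi> s) = 0"
        using g(2) by (force simp: open_cone_def cone_def)
      obtain h where h: "h \<in> R" "adjacent i g h"
        using neighbour[OF gR i(1)] by (auto simp: adjacent_facets_def)
      have other: "coord g k (\<phi> s) \<noteq> 0" if "k \<le> d" "k \<noteq> i" for k
        using gen gR seg[OF s01] i that unfolding generic_def by blast
      note n = eventually_in_neighbours[OF gR h(1) i(1) h(2) g(2) other i(2)]
      have "h \<in> M" using n(1) h(1) seg[OF s01] by (auto simp: M_def)
      then have "h \<in> A" using g(1) AM i(1) h(2) unfolding A_def E_def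
        by (smt (verit, ccfv_threshold) case_prod_conv mem_Collect_eq rtrancl.rtrancl_into_rtrancl subsetD)
      then show ?thesis using n(2) g(1) by (auto elim!: eventually_mono)
    qed
    moreover have "(\<phi> \<longlongrightarrow> \<phi> s) (at_right s)"
      unfolding \<phi>_def by (intro tendsto_intros)
    ultimately have "eventually (\<lambda>t. \<phi> t \<in> (\<Union>g\<in>A. cone g)) (at_right s)"
      by (rule eventually_compose_filterlim)
    moreover have "eventually (\<lambda>t. t \<in> {s<..<1}) (at_right s)"
      using s01 \<open>s \<noteq> 1\<close> by (intro eventually_at_rightI[of s 1]) auto
    ultimately have "eventually (\<lambda>t. \<phi> t \<in> (\<Union>g\<in>A. cone g) \<and> t \<in> {s<..<1}) (at_right s)"
      by (rule eventually_conj)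
    then obtain t where "\<phi> t \<in> (\<Union>g\<in>A. cone g)" "t \<in> {s<..<1}"
      using eventually_happens'[OF trivial_limit_at_right_real] by blast
    then have "t \<in> K" "s < t" using s01 by (auto simp: K_def)
    then show False using s(2) by force
  qed
  then have "b \<in> cone g" using g(2) by (simp add: \<phi>_def)
  then show ?thesis using gR g(1) by (auto simp: A_def E_def)
qed

lemma open_cone_nonempty: "f \<in> R \<Longrightarrow> open_cone f \<noteq> {}"
  using sum_in_open_cone[of f "\<lambda>_. 1"] by auto

theorem cones_cover: "\<exists>f\<in>R. z \<in> cone f"
proof (rule ccontr)
  assume no: "\<not> (\<exists>f\<in>R. z \<in> cone f)"
  define W where "W = - (\<Union>f\<in>R. cone f)"
  have "closed (\<Union>f\<in>R. cone f)" using finite_facets closed_cone by (intro closed_UN) auto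
  then have "open W" unfolding W_def by (rule open_Compl)
  moreover have "W \<noteq> {}" using no by (auto simp: W_def)
  ultimately have W: "open W" "W \<noteq> {}" by blast+
  obtain f0 where f0: "f0 \<in> R" using facets_nonempty by blast
  obtain a b where ab: "a \<in> open_cone f0" "b \<in> W"
    and gen: "generic a b"
    using generic_segment[OF open_open_cone[OF f0] open_cone_nonempty[OF f0] W] by blast
  show False using segment_chain[OF f0 ab(1) gen] ab(2) by (auto simp: W_def)
qed

definition face_relation :: "nat set \<Rightarrow> ((nat \<Rightarrow> 'a) \<times> (nat \<Rightarrow> 'a)) set" where
  "face_relation S = {(f, g). f \<in> R \<and> g \<in> R \<and> (\<exists>i\<le>d. i \<notin> S \<and> adjacent i f g)}"

text \<open>Join generic interior points of the two cones, both close to a point \<open>y\<close> in the relative interior of the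
cone over the common face. The segment stays close to \<open>y\<close>, so it meets only cones that contain \<open>y\<close>, and those contain
the whole face.\<close>

theorem star_connected:
  assumes f: "f \<in> R" "g \<in> R" and S: "S \<subseteq> {..d}" "S \<noteq> {}" "\<And>i. i \<in> S \<Longrightarrow> f i = g i"
  shows "\<exists>h\<in>R. (\<forall>i\<le>d. h i = g i) \<and> (f, h) \<in> (face_relation S)\<^sup>*"
proof -
  define y where "y = (\<Sum>i\<le>d. of_bool (i \<in> S) *\<^sub>R f i)"
  have yg: "y = (\<Sum>i\<le>d. of_bool (i \<in> S) *\<^sub>R g i)"
    unfolding y_def using S(3) by (intro sum.cong) auto
  have yc: "y \<in> cone f" "y \<in> cone g"
    using sum_in_cone[OF f(1), of "\<lambda>i. of_bool (i \<in> S)"] sum_in_cone[OF f(2), of "\<lambda>i. of_bool (i \<in> S)"]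
    by (simp_all add: y_def yg[unfolded y_def])
  define C where "C = (\<Union>h\<in>{h \<in> R. y \<notin> cone h}. cone h)"
  have "closed C" unfolding C_def using finite_facets closed_cone by (intro closed_UN) auto
  then have "open (- C)" by (rule open_Compl)
  moreover have "y \<in> - C" by (auto simp: C_def)
  ultimately obtain e where e: "e > 0" "ball y e \<subseteq> - C" using openE by blast
  have near: "open (ball y e \<inter> open_cone h)" "ball y e \<inter> open_cone h \<noteq> {}" if h: "h \<in> R" "y \<in> cone h" for h
  proof -
    show "open (ball y e \<inter> open_cone h)" using open_open_cone[OF h(1)] by auto
    obtain w where w: "w \<in> open_cone h" using open_cone_nonempty[OF h(1)] by blast
    have "((\<lambda>t. y + t *\<^sub>R w) \<longlongrightarrow> y + 0 *\<^sub>R w) (at_right 0)" by (intro tendsto_intros)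
    then have "eventually (\<lambda>t. y + t *\<^sub>R w \<in> ball y e) (at_right 0)"
      using e by (intro topological_tendstoD) auto
    then have "eventually (\<lambda>t. 0 < t \<and> y + t *\<^sub>R w \<in> ball y e) (at_right (0::real))"
      by (intro eventually_conj eventually_at_right_less)
    then obtain t :: real where t: "t > 0" "y + t *\<^sub>R w \<in> ball y e"
      using eventually_happens'[OF trivial_limit_at_right_real] by blast
    have "y + t *\<^sub>R w \<in> open_cone h"
      using w h t(1) linear_coord[OF h(1)]
      by (auto simp: open_cone_def cone_def linear_add linear_scale intro!: add_nonneg_pos)
    then show "ball y e \<inter> open_cone h \<noteq> {}" using t(2) by blast
  qed
  obtain a b where ab: "a \<in> ball y e \<inter> open_cone f" "b \<in> ball y e \<inter> open_cone g"
    and gen: "generic a b"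
    using generic_segment[OF near[OF f(1) yc(1)] near[OF f(2) yc(2)]] by blast
  define M where "M = {g \<in> R. cone g \<inter> closed_segment a b \<noteq> {}}"
  obtain h where h: "h \<in> R" "b \<in> cone h"
    and chain: "(f, h) \<in> {(f, g). f \<in> M \<and> g \<in> M \<and> (\<exists>i\<le>d. adjacent i f g)}\<^sup>*"
    using segment_chain[OF f(1) _ gen] ab(1) unfolding M_def by blast
  have "closed_segment a b \<subseteq> ball y e" using ab convex_ball closed_segment_subset by blast
  then have Mstar: "y \<in> cone h'" if "h' \<in> M" for h'
    using that e(2) by (auto simp: M_def C_def)
  have MS: "h' i = f i" if "h' \<in> M" "i \<in> S" for h' i
  proof -
    have "h' \<in> R" using that by (simp add: M_def)
    moreover have "coord f i y = 1" using f(1) that(2) S(1) unfolding y_def by (subst coord_sum) auto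
    ultimately show ?thesis
      using common_face(2)[OF f(1) _ yc(1) Mstar[OF that(1)], of i] that S(1) by fastforce
  qed
  have "{(f, g). f \<in> M \<and> g \<in> M \<and> (\<exists>i\<le>d. adjacent i f g)} \<subseteq> face_relation S"
  proof clarify
    fix f' g' i assume A: "f' \<in> M" "g' \<in> M" "i \<le> d" "adjacent i f' g'"
    then have "i \<notin> S" using MS[of f' i] MS[of g' i] by (auto simp: adjacent_facets_def)
    then show "(f', g') \<in> face_relation S" using A by (auto simp: face_relation_def M_def)
  qed
  then have "(f, h) \<in> (face_relation S)\<^sup>*" using chain rtrancl_mono by blast
  moreover have "h i = g i" if "i \<le> d" for i
    using open_cone_unique[OF f(2) h(1) _ h(2) that] ab(2) by simp
  ultimately show ?thesis using h(1) by blast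
qed

end


section \<open>Crystallizations of spherical quotients\<close>

text \<open>A finite group of isometries acts on a complete fan compatibly with the labels. The assumption that
vertices of equal label form one orbit is what makes the dual graph of the quotient contracted.\<close>

locale spherical_tiling = simplicial_fan d R
  for d and R :: "(nat \<Rightarrow> 'a::euclidean_space) set" +
  fixes \<Gamma> :: "('a \<Rightarrow> 'a) set"
  assumes finite_group: "finite \<Gamma>" and id_group: "id \<in> \<Gamma>"
    and comp_group: "\<gamma> \<in> \<Gamma> \<Longrightarrow> \<delta> \<in> \<Gamma> \<Longrightarrow> \<gamma> \<circ> \<delta> \<in> \<Gamma>"
    and inv_group: "\<gamma> \<in> \<Gamma> \<Longrightarrow> \<exists>\<delta>\<in>\<Gamma>. \<delta> \<circ> \<gamma> = id \<and> \<gamma> \<circ> \<delta> = id"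
    and linear_group: "\<gamma> \<in> \<Gamma> \<Longrightarrow> linear \<gamma>"
    and norm_group: "\<gamma> \<in> \<Gamma> \<Longrightarrow> norm (\<gamma> x) = norm x"
    and invariant: "\<gamma> \<in> \<Gamma> \<Longrightarrow> f \<in> R \<Longrightarrow> \<gamma> \<circ> f \<in> R"
    and one_orbit: "f \<in> R \<Longrightarrow> g \<in> R \<Longrightarrow> i \<le> d \<Longrightarrow> \<exists>\<gamma>\<in>\<Gamma>. \<gamma> (f i) = g i"
    and extensional: "f \<in> R \<Longrightarrow> d < i \<Longrightarrow> f i = 0"
begin

definition orbit_rel :: "('a \<times> 'a) set" where
  "orbit_rel = {(z, w). z \<in> sphere 0 1 \<and> (\<exists>\<gamma>\<in>\<Gamma>. w = \<gamma> z)}"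

definition orbit_space :: "'a set topology" where
  "orbit_space = quotient_topology (top_of_set (sphere 0 1)) orbit_rel"

lemma equiv_orbit_rel: "equiv (sphere 0 1) orbit_rel"
proof (rule equivI)
  show "orbit_rel \<subseteq> sphere 0 1 \<times> sphere 0 1"
    using norm_group by (auto simp: orbit_rel_def)
  show "refl_on (sphere 0 1) orbit_rel"
    using id_group by (auto simp: orbit_rel_def refl_on_def intro!: bexI[of _ id])
  show "sym orbit_rel"
  proof (rule symI)
    fix z w assume "(z, w) \<in> orbit_rel"
    then obtain \<gamma> where g: "z \<in> sphere 0 1" "\<gamma> \<in> \<Gamma>" "w = \<gamma> z" by (auto simp: orbit_rel_def)
    obtain \<delta> where "\<delta> \<in> \<Gamma>" "\<delta> \<circ> \<gamma> = id" using inv_group[OF g(2)] by blast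
    then have "z = \<delta> w" using g(3) by (metis comp_apply id_apply)
    then show "(w, z) \<in> orbit_rel" using g norm_group \<open>\<delta> \<in> \<Gamma>\<close> by (auto simp: orbit_rel_def)
  qed
  show "trans orbit_rel"
  proof (rule transI)
    fix x y z assume "(x, y) \<in> orbit_rel" "(y, z) \<in> orbit_rel"
    then obtain \<gamma> \<delta> where "x \<in> sphere 0 1" "\<gamma> \<in> \<Gamma>" "y = \<gamma> x" "\<delta> \<in> \<Gamma>" "z = \<delta> y"
      by (auto simp: orbit_rel_def)
    then show "(x, z) \<in> orbit_rel" using comp_group[of \<delta> \<gamma>] unfolding orbit_rel_def
      by (auto intro!: bexI[of _ "\<delta> \<circ> \<gamma>"])
  qed
qed

lemma orbit_class_eq_iff:
  assumes "z \<in> sphere 0 1" "w \<in> sphere 0 1"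
  shows "orbit_rel `` {z} = orbit_rel `` {w} \<longleftrightarrow> (\<exists>\<gamma>\<in>\<Gamma>. w = \<gamma> z)"
  using eq_equiv_class_iff[OF equiv_orbit_rel assms] assms by (auto simp: orbit_rel_def)

text \<open>The quotient map is closed, because saturating a closed set is a finite union of images under the
group, and closed maps preserve normality together with the Hausdorff property.\<close>

lemma Hausdorff_orbit_space: "Hausdorff_space orbit_space"
proof -
  let ?X = "top_of_set (sphere 0 1 :: 'a set)" and ?q = "\<lambda>z. orbit_rel `` {z}"
  have q: "quotient_map ?X orbit_space ?q"
    unfolding orbit_space_def by (rule quotient_map_quotient_topology)
  have "closed_map ?X orbit_space ?q"
    unfolding closed_map_def
  proof (intro allI impI)
    fix C assume C: "closedin ?X C"
    then have C1: "compact C" "C \<subseteq> sphere 0 1"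
      using closedin_compact[OF compact_sphere C] closedin_imp_subset[OF C] by simp_all
    have "{x \<in> topspace ?X. ?q x \<in> ?q ` C} = (\<Union>\<gamma>\<in>\<Gamma>. \<gamma> ` C)"
    proof (intro equalityI subsetI)
      fix x assume "x \<in> {x \<in> topspace ?X. ?q x \<in> ?q ` C}"
      then obtain c where c: "x \<in> sphere 0 1" "c \<in> C" "?q c = ?q x" by auto
      then have "\<exists>\<gamma>\<in>\<Gamma>. x = \<gamma> c" using orbit_class_eq_iff[of c x] C1(2) by blast
      then show "x \<in> (\<Union>\<gamma>\<in>\<Gamma>. \<gamma> ` C)" using c(2) by blast
    next
      fix x assume "x \<in> (\<Union>\<gamma>\<in>\<Gamma>. \<gamma> ` C)"
      then obtain \<gamma> c where g: "\<gamma> \<in> \<Gamma>" "c \<in> C" "x = \<gamma> c" by blast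
      then have c: "c \<in> sphere 0 1" "x \<in> sphere 0 1" using C1(2) norm_group by auto
      then have "?q c = ?q x" using orbit_class_eq_iff[OF c] g by blast
      then show "x \<in> {x \<in> topspace ?X. ?q x \<in> ?q ` C}" using c g(2) by auto
    qed
    moreover have "compact (\<gamma> ` C)" if "\<gamma> \<in> \<Gamma>" for \<gamma>
      using C1(1) linear_group[OF that] by (intro compact_continuous_image linear_continuous_on)
        (auto simp: linear_conv_bounded_linear)
    then have "closed (\<Union>\<gamma>\<in>\<Gamma>. \<gamma> ` C)"
      using finite_group by (intro closed_UN) (auto intro: compact_imp_closed)
    moreover have "(\<Union>\<gamma>\<in>\<Gamma>. \<gamma> ` C) \<subseteq> sphere 0 1" using C1(2) norm_group by auto
    ultimately have "closedin ?X {x \<in> topspace ?X. ?q x \<in> ?q ` C}"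
      by (simp add: closed_subset)
    moreover have "?q ` C \<subseteq> topspace orbit_space"
      using C1(2) quotient_imp_surjective_map[OF q] by auto
    ultimately show "closedin orbit_space (?q ` C)"
      using q unfolding quotient_map_closedin by blast
  qed
  moreover have "normal_space ?X" "Hausdorff_space ?X"
    by (auto intro!: compact_Hausdorff_or_regular_imp_normal_space Hausdorff_space_subtopology
        simp: compact_space_subtopology)
  ultimately show ?thesis
    using normal_Hausdorff_space_closed_continuous_map_image[OF _ _ _ quotient_imp_continuous_map[OF q]]
      quotient_imp_surjective_map[OF q] by blast
qed

lemma facet_eqI: "f \<in> R \<Longrightarrow> g \<in> R \<Longrightarrow> (\<And>i. i \<le> d \<Longrightarrow> f i = g i) \<Longrightarrow> f = g"
  using extensional by (metis ext not_le)

lemma adjacent_sym: "adjacent i f g \<Longrightarrow> adjacent i g f"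
  by (auto simp: adjacent_facets_def)

lemma adjacent_group:
  assumes "\<gamma> \<in> \<Gamma>" "adjacent i f g"
  shows "adjacent i (\<gamma> \<circ> f) (\<gamma> \<circ> g)"
proof -
  obtain \<delta> where "\<delta> \<circ> \<gamma> = id" using inv_group[OF assms(1)] by blast
  then have "inj \<gamma>" by (metis inj_on_id inj_on_imageI2)
  then show ?thesis using assms(2) by (auto simp: adjacent_facets_def inj_eq)
qed

definition facet_orbit :: "(nat \<Rightarrow> 'a) \<Rightarrow> (nat \<Rightarrow> 'a) set" where
  "facet_orbit f = (\<lambda>\<gamma>. \<gamma> \<circ> f) ` \<Gamma>"

lemma facet_orbit_self: "f \<in> facet_orbit f"
  using imageI[OF id_group, of "\<lambda>\<gamma>. \<gamma> \<circ> f"] by (simp add: facet_orbit_def)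

lemma facet_orbit_eq: "g \<in> facet_orbit f \<Longrightarrow> facet_orbit g = facet_orbit f"
proof -
  have sub: "facet_orbit g \<subseteq> facet_orbit f" if "g \<in> facet_orbit f" for f g
    using that comp_group by (auto simp: facet_orbit_def comp_assoc[symmetric] intro!: imageI)
  assume g: "g \<in> facet_orbit f"
  then obtain \<gamma> where \<gamma>: "\<gamma> \<in> \<Gamma>" "g = \<gamma> \<circ> f" by (auto simp: facet_orbit_def)
  obtain \<delta> where \<delta>: "\<delta> \<in> \<Gamma>" "\<delta> \<circ> \<gamma> = id" using inv_group[OF \<gamma>(1)] by blast
  have "f = \<delta> \<circ> g" using \<gamma>(2) \<delta>(2) by (metis comp_assoc comp_id id_comp)
  then have "f \<in> facet_orbit g" using \<delta>(1) by (auto simp: facet_orbit_def)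
  then show ?thesis using sub g by blast
qed

lemma orbit_representatives:
  obtains \<rho> :: "nat \<Rightarrow> nat \<Rightarrow> 'a" and m where "m = card (facet_orbit ` R)" "\<And>v. v < m \<Longrightarrow> \<rho> v \<in> R"
    "\<And>f. f \<in> R \<Longrightarrow> \<exists>v<m. \<exists>\<gamma>\<in>\<Gamma>. f = \<gamma> \<circ> \<rho> v"
    "\<And>v w \<gamma> \<delta>. v < m \<Longrightarrow> w < m \<Longrightarrow> \<gamma> \<in> \<Gamma> \<Longrightarrow> \<delta> \<in> \<Gamma> \<Longrightarrow> \<gamma> \<circ> \<rho> v = \<delta> \<circ> \<rho> w \<Longrightarrow> v = w"
proof -
  define m where "m = card (facet_orbit ` R)"
  obtain h where h: "bij_betw h {..<m} (facet_orbit ` R)"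
    using ex_bij_betw_nat_finite[of "facet_orbit ` R"] finite_facets unfolding m_def
    by (metis atLeast0LessThan finite_imageI)
  define \<rho> where "\<rho> = (\<lambda>v. SOME f. f \<in> R \<and> facet_orbit f = h v)"
  have \<rho>: "\<rho> v \<in> R \<and> facet_orbit (\<rho> v) = h v" if "v < m" for v
  proof -
    have "h v \<in> facet_orbit ` R" using h that by (auto simp: bij_betw_def)
    then have "\<exists>f. f \<in> R \<and> facet_orbit f = h v" by auto
    then show ?thesis unfolding \<rho>_def by (rule someI_ex)
  qed
  show thesis
  proof (rule that[of m \<rho>])
    show "m = card (facet_orbit ` R)" by (rule m_def)
    show "\<rho> v \<in> R" if "v < m" for v using \<rho>[OF that] by blast
    show "\<exists>v<m. \<exists>\<gamma>\<in>\<Gamma>. f = \<gamma> \<circ> \<rho> v" if "f \<in> R" for f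
    proof -
      have "facet_orbit f \<in> h ` {..<m}" using h that by (auto simp: bij_betw_def)
      then obtain v where v: "v < m" "facet_orbit f = h v" by auto
      then have "f \<in> facet_orbit (\<rho> v)" using \<rho>[OF v(1)] facet_orbit_self by metis
      then show ?thesis using v(1) by (auto simp: facet_orbit_def)
    qed
    show "v = w" if *: "v < m" "w < m" "\<gamma> \<in> \<Gamma>" "\<delta> \<in> \<Gamma>" "\<gamma> \<circ> \<rho> v = \<delta> \<circ> \<rho> w" for v w \<gamma> \<delta>
    proof -
      have "\<gamma> \<circ> \<rho> v \<in> facet_orbit (\<rho> v)" "\<gamma> \<circ> \<rho> v \<in> facet_orbit (\<rho> w)"
        using imageI[OF *(3), of "\<lambda>\<gamma>. \<gamma> \<circ> \<rho> v"] imageI[OF *(4), of "\<lambda>\<gamma>. \<gamma> \<circ> \<rho> w"] *(5)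
        by (simp_all add: facet_orbit_def)
      then have "facet_orbit (\<rho> v) = facet_orbit (\<rho> w)" using facet_orbit_eq by metis
      then have "h v = h w" using \<rho> * by simp
      then show "v = w" using h * by (auto simp: bij_betw_def dest: inj_onD)
    qed
  qed
qed

end

lemma continuous_map_from_sum_topology:
  assumes "\<And>i. i \<in> I \<Longrightarrow> continuous_map (X i) Y (\<lambda>x. f (i, x))"
  shows "continuous_map (sum_topology X I) Y f"
  unfolding continuous_map
proof (intro conjI allI impI)
  show "f ` topspace (sum_topology X I) \<subseteq> topspace Y"
    using assms by (force simp: continuous_map)
  fix U assume U: "openin Y U"
  have "openin (X i) {x. (i, x) \<in> {p \<in> topspace (sum_topology X I). f p \<in> U}}" if "i \<in> I" for i
  proof -
    have "{x. (i, x) \<in> {p \<in> topspace (sum_topology X I). f p \<in> U}} = {x \<in> topspace (X i). f (i, x) \<in> U}"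
      using that by auto
    then show ?thesis using assms[OF that] U by (simp add: continuous_map)
  qed
  then show "openin (sum_topology X I) {p \<in> topspace (sum_topology X I). f p \<in> U}"
    unfolding openin_sum_topology by auto
qed

lemma compact_simplex_sum:
  assumes "finite (verts G)"
  shows "compact_space (simplex_sum d G)"
proof -
  have "compactin (simplex_sum d G) ((\<lambda>x. (v, x)) ` standard_simplex d)" if v: "v \<in> verts G" for v
  proof (rule image_compactin)
    show "continuous_map (subtopology (powertop_real UNIV) (standard_simplex d)) (simplex_sum d G) (\<lambda>x. (v, x))"
      unfolding simplex_sum_def
      using continuous_map_component_injection[OF v, of "\<lambda>_. subtopology (powertop_real UNIV) (standard_simplex d)"]
      by simp
    show "compactin (subtopology (powertop_real UNIV) (standard_simplex d)) (standard_simplex d)"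
      using compactin_standard_simplex by (simp add: compactin_subtopology)
  qed
  then have "compactin (simplex_sum d G) (\<Union>v\<in>verts G. (\<lambda>x. (v, x)) ` standard_simplex d)"
    using assms by (intro compactin_Union) auto
  moreover have "(\<Union>v\<in>verts G. (\<lambda>x. (v, x)) ` standard_simplex d) = topspace (simplex_sum d G)"
    by (auto simp: topspace_simplex_sum)
  ultimately show ?thesis by (simp add: compact_space_def)
qed

lemma connected_if_linked:
  assumes "verts H \<noteq> {}" "\<And>u v. u \<in> verts H \<Longrightarrow> v \<in> verts H \<Longrightarrow> (u, v) \<in> linked G B"
    and "\<And>e. e \<in> edges G \<Longrightarrow> color G e \<in> B \<Longrightarrow> e \<in> edges H" "ends H = ends G"
  shows "connected_graph H"
proof -
  have "linked G B \<subseteq> {(a, b). \<exists>e\<in>edges H. ends H e = {a, b}}\<^sup>*"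
    unfolding linked_def using assms(3,4) by (intro rtrancl_mono) auto
  then show ?thesis using assms(1,2) unfolding connected_graph_def by blast
qed

text \<open>The dual graph of the quotient has one vertex for each orbit of facets, represented by \<open>\<rho>\<close>.\<close>

locale tiling_graph = spherical_tiling d R \<Gamma>
  for d and R :: "(nat \<Rightarrow> 'a::euclidean_space) set" and \<Gamma> +
  fixes \<rho> :: "nat \<Rightarrow> nat \<Rightarrow> 'a" and m :: nat
  assumes rep_facet: "v < m \<Longrightarrow> \<rho> v \<in> R"
    and rep_exists: "f \<in> R \<Longrightarrow> \<exists>v<m. \<exists>\<gamma>\<in>\<Gamma>. f = \<gamma> \<circ> \<rho> v"
    and rep_unique: "v < m \<Longrightarrow> w < m \<Longrightarrow> \<gamma> \<in> \<Gamma> \<Longrightarrow> \<delta> \<in> \<Gamma> \<Longrightarrow> \<gamma> \<circ> \<rho> v = \<delta> \<circ> \<rho> w \<Longrightarrow> v = w"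
begin

definition near :: "nat \<Rightarrow> nat \<Rightarrow> nat \<Rightarrow> bool" where
  "near i u w \<longleftrightarrow> (\<exists>\<gamma>\<in>\<Gamma>. adjacent i (\<rho> u) (\<gamma> \<circ> \<rho> w))"

lemma near_iff:
  assumes "\<gamma> \<in> \<Gamma>" "\<delta> \<in> \<Gamma>" "adjacent i (\<gamma> \<circ> \<rho> u) (\<delta> \<circ> \<rho> w)"
  shows "near i u w"
proof -
  obtain \<gamma>' where g: "\<gamma>' \<in> \<Gamma>" "\<gamma>' \<circ> \<gamma> = id" using inv_group[OF assms(1)] by blast
  have "adjacent i (\<gamma>' \<circ> (\<gamma> \<circ> \<rho> u)) (\<gamma>' \<circ> (\<delta> \<circ> \<rho> w))" by (rule adjacent_group[OF g(1) assms(3)])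
  moreover have "\<gamma>' \<circ> (\<gamma> \<circ> \<rho> u) = \<rho> u" using g(2) by (simp add: comp_assoc[symmetric])
  moreover have "\<gamma>' \<circ> (\<delta> \<circ> \<rho> w) = (\<gamma>' \<circ> \<delta>) \<circ> \<rho> w" by (simp add: comp_assoc)
  ultimately show ?thesis using comp_group[OF g(1) assms(2)] by (auto simp: near_def)
qed

lemma near_sym: "near i u w \<Longrightarrow> near i w u"
proof -
  assume "near i u w"
  then obtain \<gamma> where "\<gamma> \<in> \<Gamma>" "adjacent i (\<gamma> \<circ> \<rho> w) (id \<circ> \<rho> u)"
    using adjacent_sym by (auto simp: near_def)
  then show "near i w u" using near_iff id_group by blast
qed

lemma near_unique:
  assumes "u < m" "v < m" "w < m" "i \<le> d" "near i u v" "near i u w"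
  shows "v = w"
proof -
  obtain \<gamma> \<delta> where g: "\<gamma> \<in> \<Gamma>" "adjacent i (\<rho> u) (\<gamma> \<circ> \<rho> v)" "\<delta> \<in> \<Gamma>" "adjacent i (\<rho> u) (\<delta> \<circ> \<rho> w)"
    using assms(5,6) by (auto simp: near_def)
  have R: "\<rho> u \<in> R" "\<gamma> \<circ> \<rho> v \<in> R" "\<delta> \<circ> \<rho> w \<in> R"
    using rep_facet invariant assms g by blast+
  have "\<gamma> \<circ> \<rho> v = \<delta> \<circ> \<rho> w"
    by (rule facet_eqI[OF R(2,3)]) (rule adjacent_unique[OF R assms(4) g(2,4)])
  then show ?thesis using rep_unique assms(2,3) g(1,3) by blast
qed

definition code :: "nat \<Rightarrow> nat \<Rightarrow> nat \<Rightarrow> nat" where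
  "code u w i = prod_encode (u, prod_encode (w, i))"

text \<open>An edge is encoded by its end vertices in increasing order and its color. A facet adjacent to one of
its own translates contributes no edge, as required for a graph without loops; this loses
nothing, since such an adjacency does not lead to a new orbit.\<close>

definition quotient_graph :: "(nat, nat) cgraph" where
  "quotient_graph = \<lparr>verts = {..<m},
     edges = {code u w i | u w i. u < w \<and> w < m \<and> i \<le> d \<and> near i u w},
     ends = (\<lambda>e. {fst (prod_decode e), fst (prod_decode (snd (prod_decode e)))}),
     color = (\<lambda>e. snd (prod_decode (snd (prod_decode e))))\<rparr>"

abbreviation "QG \<equiv> quotient_graph"

lemma verts_QG [simp]: "verts QG = {..<m}"
  and ends_code [simp]: "ends QG (code u w i) = {u, w}"
  and color_code [simp]: "color QG (code u w i) = i"
  by (simp_all add: quotient_graph_def code_def)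

lemma edges_QG: "e \<in> edges QG \<longleftrightarrow> (\<exists>u w i. e = code u w i \<and> u < w \<and> w < m \<and> i \<le> d \<and> near i u w)"
  by (auto simp: quotient_graph_def)

lemma edge_near:
  assumes "e \<in> edges QG" "ends QG e = {x, y}"
  shows "x < m" "y < m" "x \<noteq> y" "color QG e \<le> d" "near (color QG e) x y"
  using assms near_sym by (auto simp: edges_QG doubleton_eq_iff)

lemma near_edge:
  assumes "u < m" "w < m" "u \<noteq> w" "i \<le> d" "near i u w"
  shows "\<exists>e\<in>edges QG. ends QG e = {u, w} \<and> color QG e = i"
proof (cases "u < w")
  case True
  then have "code u w i \<in> edges QG" using assms by (auto simp: edges_QG)
  then show ?thesis by force
next
  case False
  then have "w < u" using assms(3) by simp
  then have "code w u i \<in> edges QG" using assms near_sym unfolding edges_QG by blast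
  then show ?thesis by (force simp: insert_commute)
qed

lemma colored_QG: "colored_graph (d + 1) QG"
  unfolding colored_graph_def
proof (intro conjI ballI impI)
  show "finite (verts QG)" by simp
  have "edges QG \<subseteq> (\<lambda>(u, w, i). code u w i) ` ({..<m} \<times> {..<m} \<times> {..d})"
  proof
    fix e assume "e \<in> edges QG"
    then obtain u w i where "e = code u w i" "u < w" "w < m" "i \<le> d" unfolding edges_QG by blast
    then show "e \<in> (\<lambda>(u, w, i). code u w i) ` ({..<m} \<times> {..<m} \<times> {..d})"
      by (intro image_eqI[of _ _ "(u, w, i)"]) auto
  qed
  then show "finite (edges QG)" by (rule finite_subset) simp
  fix e assume e: "e \<in> edges QG"
  then obtain u w i where u: "e = code u w i" "u < w" "w < m" "i \<le> d" "near i u w" by (auto simp: edges_QG)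
  show "ends QG e \<subseteq> verts QG" "card (ends QG e) = 2" "color QG e < d + 1" using u by auto
  fix f assume f: "f \<in> edges QG" and ne: "e \<noteq> f \<and> ends QG e \<inter> ends QG f \<noteq> {}"
  obtain u' w' i' where u': "f = code u' w' i'" "u' < w'" "w' < m" "i' \<le> d" "near i' u' w'"
    using f by (auto simp: edges_QG)
  show "color QG e \<noteq> color QG f"
  proof
    assume eq: "color QG e = color QG f"
    then have ii: "i' = i" using u u' by simp
    obtain x where x: "x \<in> {u, w}" "x \<in> {u', w'}" using ne u(1) u'(1) by auto
    obtain y where y: "{u, w} = {x, y}" using x(1) by auto
    obtain y' where y': "{u', w'} = {x, y'}" using x(2) by auto
    have "x < m" "y < m" "near i x y" using edge_near[OF e, of x y] y u(1) by auto
    moreover have "y' < m" "near i x y'" using edge_near[OF f, of x y'] y' u'(1) ii by auto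
    ultimately have "y = y'" using near_unique u(4) by blast
    then have "u = u'" "w = w'" using y y' u(2) u'(2) by (auto simp: doubleton_eq_iff)
    then show False using ne u(1) u'(1) ii by simp
  qed
qed

lemma face_relation_linked:
  assumes "(f, g) \<in> (face_relation S)\<^sup>*" "f = \<gamma> \<circ> \<rho> u" "u < m" "\<gamma> \<in> \<Gamma>"
  shows "\<exists>w<m. \<exists>\<delta>\<in>\<Gamma>. g = \<delta> \<circ> \<rho> w \<and> (u, w) \<in> linked QG (- S)"
  using assms(1)
proof (induction rule: rtrancl_induct)
  case base
  then show ?case using assms(2-4) by auto
next
  case (step g h)
  then obtain w \<delta> where w: "w < m" "\<delta> \<in> \<Gamma>" "g = \<delta> \<circ> \<rho> w" "(u, w) \<in> linked QG (- S)" by blast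
  obtain i where i: "h \<in> R" "i \<le> d" "i \<notin> S" "adjacent i g h"
    using step.hyps(2) by (auto simp: face_relation_def)
  obtain x \<epsilon> where x: "x < m" "\<epsilon> \<in> \<Gamma>" "h = \<epsilon> \<circ> \<rho> x" using rep_exists[OF i(1)] by blast
  have n: "near i w x" using near_iff[OF w(2) x(2)] i(4) w(3) x(3) by blast
  have "(w, x) \<in> linked QG (- S)"
  proof (cases "w = x")
    case False
    then obtain e where "e \<in> edges QG" "ends QG e = {w, x}" "color QG e = i"
      using near_edge[OF w(1) x(1) False i(2) n] by blast
    then show ?thesis using i(3) by (auto simp: linked_def intro!: r_into_rtrancl)
  qed simp
  then show ?case using x linked_trans[OF w(4)] by blast
qed

text \<open>The chain of facets in the star of the common face, found by \<open>star_connected\<close>, projects to a path in the graph.\<close>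

lemma common_face_linked:
  assumes "u < m" "w < m" "\<gamma> \<in> \<Gamma>" and S: "S \<subseteq> {..d}" "S \<noteq> {}"
    and eq: "\<And>i. i \<in> S \<Longrightarrow> \<gamma> (\<rho> u i) = \<rho> w i"
  shows "(u, w) \<in> linked QG (- S)"
proof -
  have R: "\<gamma> \<circ> \<rho> u \<in> R" "\<rho> w \<in> R" using rep_facet invariant assms by blast+
  obtain h where h: "h \<in> R" "\<forall>i\<le>d. h i = \<rho> w i" "(\<gamma> \<circ> \<rho> u, h) \<in> (face_relation S)\<^sup>*"
    using star_connected[OF R S] eq by auto
  have "h = \<rho> w" using facet_eqI h R by blast
  moreover obtain x \<delta> where "x < m" "\<delta> \<in> \<Gamma>" "h = \<delta> \<circ> \<rho> x" "(u, x) \<in> linked QG (- S)"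
    using face_relation_linked[OF h(3) refl assms(1,3)] by blast
  ultimately show ?thesis using rep_unique[of w x id \<delta>] assms(2) id_group by auto
qed

lemma verts_nonempty: "0 < m"
proof -
  obtain f where "f \<in> R" using facets_nonempty by blast
  then obtain v where "v < m" using rep_exists by blast
  then show ?thesis by simp
qed

text \<open>Facets of any two orbits can be moved so that they share their vertex of label \<open>c\<close>, and then
\<open>common_face_linked\<close> joins them without using the color \<open>c\<close>.\<close>

lemma contracted_QG: "contracted_graph (d + 1) QG"
proof -
  have link: "(u, v) \<in> linked QG (- {c})" if "c \<le> d" "u < m" "v < m" for u v c
  proof -
    have "\<exists>\<gamma>\<in>\<Gamma>. \<gamma> (\<rho> u c) = \<rho> v c" by (rule one_orbit[OF rep_facet[OF that(2)] rep_facet[OF that(3)] that(1)])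
    then obtain \<gamma> where g: "\<gamma> \<in> \<Gamma>" "\<gamma> (\<rho> u c) = \<rho> v c" ..
    show ?thesis by (rule common_face_linked[OF that(2,3) g(1)]) (use that g in auto)
  qed
  have sub: "connected_graph (color_subgraph QG ({..<d + 1} - {c}))" if "c < d + 1" for c
  proof (rule connected_if_linked[where G = QG and B = "- {c}"])
    show "e \<in> edges (color_subgraph QG ({..<d + 1} - {c}))" if "e \<in> edges QG" "color QG e \<in> - {c}" for e
      using that by (auto simp: color_subgraph_def edges_QG)
  qed (use that link[of c] verts_nonempty in \<open>auto simp: color_subgraph_def\<close>)
  have "connected_graph QG"
    by (rule connected_if_linked[where G = QG and B = "- {0}"]) (use link[of 0] verts_nonempty in auto)
  then show ?thesis using sub colored_QG unfolding contracted_graph_def by blast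
qed

definition flat_point :: "nat \<Rightarrow> (nat \<Rightarrow> real) \<Rightarrow> 'a" where
  "flat_point v x = (\<Sum>i\<le>d. x i *\<^sub>R \<rho> v i)"

definition sphere_point :: "nat \<Rightarrow> (nat \<Rightarrow> real) \<Rightarrow> 'a" where
  "sphere_point v x = flat_point v x /\<^sub>R norm (flat_point v x)"

lemma flat_point_nonzero:
  assumes "v < m" "x \<in> standard_simplex d"
  shows "flat_point v x \<noteq> 0"
proof
  assume "flat_point v x = 0"
  then have "x i = 0" if "i \<le> d" for i
    using indep[OF rep_facet[OF assms(1)], of x] that by (simp add: flat_point_def)
  then show False using assms(2) by (simp add: standard_simplex_def)
qed

lemma sphere_point_in: "v < m \<Longrightarrow> x \<in> standard_simplex d \<Longrightarrow> sphere_point v x \<in> sphere 0 1"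
  using flat_point_nonzero by (simp add: sphere_point_def)

lemma continuous_sphere_point:
  assumes "v < m"
  shows "continuous_on (standard_simplex d) (sphere_point v)"
proof -
  have "continuous_on (standard_simplex d) (flat_point v)"
    unfolding flat_point_def
    by (intro continuous_intros continuous_on_subset[OF continuous_on_product_coordinates]) auto
  then show ?thesis unfolding sphere_point_def
    using flat_point_nonzero[OF assms] by (intro continuous_intros) auto
qed

lemma group_flat_point:
  "\<gamma> \<in> \<Gamma> \<Longrightarrow> \<gamma> (flat_point v x) = (\<Sum>i\<le>d. x i *\<^sub>R (\<gamma> \<circ> \<rho> v) i)"
  using linear_group by (simp add: flat_point_def linear_sum linear_scale)

lemma group_sphere_point:
  "\<gamma> \<in> \<Gamma> \<Longrightarrow> \<gamma> (sphere_point v x) = \<gamma> (flat_point v x) /\<^sub>R norm (flat_point v x)"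
  using linear_group by (simp add: sphere_point_def linear_scale)

definition orbit_point :: "nat \<Rightarrow> (nat \<Rightarrow> real) \<Rightarrow> 'a set" where
  "orbit_point v x = orbit_rel `` {sphere_point v x}"

text \<open>Coincidence in the quotient is the same as gluing. Points of the sphere that agree up to the group have
equal coordinates by \<open>cone_inj\<close>, and they lie on a common face, so \<open>common_face_linked\<close> applies;
conversely every edge identifies points of faces that coincide up to the group.\<close>

lemma orbit_point_eq_iff:
  assumes "v < m" "w < m" "x \<in> standard_simplex d" "y \<in> standard_simplex d"
  shows "orbit_point v x = orbit_point w y \<longleftrightarrow> x = y \<and> (v, w) \<in> linked QG {i. x i = 0}"
proof
  assume "orbit_point v x = orbit_point w y"
  then obtain \<gamma> where g: "\<gamma> \<in> \<Gamma>" "sphere_point w y = \<gamma> (sphere_point v x)"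
    using orbit_class_eq_iff[OF sphere_point_in[OF assms(1,3)] sphere_point_in[OF assms(2,4)]]
    unfolding orbit_point_def by blast
  define s where "s = norm (flat_point w y) / norm (flat_point v x)"
  have s: "s > 0" using flat_point_nonzero assms by (simp add: s_def)
  have pos: "0 \<le> x i" "0 \<le> y i" for i using assms by (auto simp: standard_simplex_def)
  have R: "\<gamma> \<circ> \<rho> v \<in> R" "\<rho> w \<in> R" using invariant rep_facet assms g by blast+
  have "flat_point w y = norm (flat_point w y) *\<^sub>R sphere_point w y"
    using flat_point_nonzero assms by (simp add: sphere_point_def)
  also have "\<dots> = s *\<^sub>R \<gamma> (flat_point v x)"
    unfolding g(2) group_sphere_point[OF g(1)] by (simp add: s_def divide_inverse)
  finally have eq: "(\<Sum>i\<le>d. (s * x i) *\<^sub>R (\<gamma> \<circ> \<rho> v) i) = (\<Sum>i\<le>d. y i *\<^sub>R \<rho> w i)"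
    unfolding group_flat_point[OF g(1)] by (simp add: flat_point_def scaleR_sum_right)
  have sx: "s * x i = y i" if "i \<le> d" for i
    by (rule cone_inj(1)[OF R _ _ eq that]) (use pos s in auto)
  have face: "\<gamma> (\<rho> v i) = \<rho> w i" if "i \<le> d" "x i \<noteq> 0" for i
  proof -
    have "0 < x i" using that(2) pos(1)[of i] by simp
    then have "0 < y i" using sx[OF that(1)] s mult_pos_pos by metis
    then show ?thesis using cone_inj(2)[OF R _ _ eq that(1)] pos s by simp
  qed
  have "s * sum x {..d} = sum y {..d}" using sx by (simp add: sum_distrib_left)
  then have "s = 1" using assms by (simp add: standard_simplex_def)
  then have "x i = y i" for i
    using sx[of i] assms(3,4) by (cases "i \<le> d") (auto simp: standard_simplex_def)
  then have xy: "x = y" by auto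
  have "(v, w) \<in> linked QG (- {i. x i \<noteq> 0})"
    by (rule common_face_linked[OF assms(1,2) g(1) simplex_support[OF assms(3)]])
      (use face simplex_support(1)[OF assms(3)] in auto)
  moreover have "- {i. x i \<noteq> 0} = {i. x i = 0}" by auto
  ultimately show "x = y \<and> (v, w) \<in> linked QG {i. x i = 0}" using xy by simp
next
  assume R: "x = y \<and> (v, w) \<in> linked QG {i. x i = 0}"
  have "(v, w) \<in> linked QG {i. x i = 0} \<Longrightarrow> v < m \<Longrightarrow> w < m \<and> orbit_point v x = orbit_point w x"
    unfolding linked_def
  proof (induction rule: rtrancl_induct)
    case (step u w)
    then obtain e where e: "e \<in> edges QG" "ends QG e = {u, w}" "x (color QG e) = 0" by blast
    note uw = edge_near[OF e(1,2)]
    obtain \<gamma> where g: "\<gamma> \<in> \<Gamma>" "adjacent (color QG e) (\<rho> u) (\<gamma> \<circ> \<rho> w)"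
      using uw(5) by (auto simp: near_def)
    have "\<gamma> (flat_point w x) = (\<Sum>i\<le>d. x i *\<^sub>R \<rho> u i)"
      unfolding group_flat_point[OF g(1)]
    proof (rule sum.cong)
      fix i assume "i \<in> {..d}"
      then show "x i *\<^sub>R (\<gamma> \<circ> \<rho> w) i = x i *\<^sub>R \<rho> u i"
        using g(2) e(3) by (cases "i = color QG e") (auto simp: adjacent_facets_def)
    qed simp
    then have "\<gamma> (flat_point w x) = flat_point u x" by (simp add: flat_point_def)
    then have "sphere_point u x = \<gamma> (sphere_point w x)"
      using group_sphere_point[OF g(1), of w x] norm_group[OF g(1), of "flat_point w x"]
      by (simp add: sphere_point_def)
    then have "orbit_point w x = orbit_point u x"
      using orbit_class_eq_iff[OF sphere_point_in[OF uw(2) assms(3)] sphere_point_in[OF uw(1) assms(3)]] g(1)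
      unfolding orbit_point_def by blast
    then show ?case using step.IH step.prems uw(2) by simp
  qed simp
  then show "orbit_point v x = orbit_point w y" using R assms(1) by blast
qed

text \<open>This is where the covering of the space by the cones enters.\<close>

lemma orbit_point_surj:
  assumes "C \<in> topspace orbit_space"
  shows "\<exists>v<m. \<exists>x\<in>standard_simplex d. C = orbit_point v x"
proof -
  obtain z where z: "z \<in> sphere 0 1" "C = orbit_rel `` {z}"
    using assms unfolding orbit_space_def quotient_def topspace_quotient_topology by fastforce
  obtain f where f: "f \<in> R" "z \<in> cone f" using cones_cover by blast
  obtain v \<gamma> where v: "v < m" "\<gamma> \<in> \<Gamma>" "f = \<gamma> \<circ> \<rho> v" using rep_exists[OF f(1)] by blast
  define s where "s = (\<Sum>i\<le>d. coord f i z)"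
  have c: "0 \<le> coord f i z" if "i \<le> d" for i using f(2) that by (simp add: cone_def)
  have "s \<noteq> 0"
  proof
    assume "s = 0"
    then have "\<forall>i\<in>{..d}. coord f i z = 0"
      using c unfolding s_def by (subst (asm) sum_nonneg_eq_0_iff) auto
    then have "z = 0" using sum_coord[OF f(1), of z] by simp
    then show False using z(1) by simp
  qed
  moreover have "s \<ge> 0" unfolding s_def using c by (intro sum_nonneg) simp
  ultimately have s: "s > 0" by simp
  define x where "x = (\<lambda>i. if i \<le> d then coord f i z / s else 0)"
  have xs: "sum x {..d} = 1" using s by (simp add: x_def s_def flip: sum_divide_distrib)
  have x0: "0 \<le> x i" for i using c s by (simp add: x_def)
  have "x i \<le> 1" for i
  proof (cases "i \<le> d")
    case True
    then have "x i \<le> sum x {..d}" using x0 by (intro member_le_sum) auto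
    then show ?thesis using xs by simp
  qed (simp add: x_def)
  then have x: "x \<in> standard_simplex d" using xs x0 by (simp add: standard_simplex_def x_def)
  have "\<gamma> (flat_point v x) = (\<Sum>i\<le>d. x i *\<^sub>R f i)" using group_flat_point[OF v(2)] v(3) by simp
  also have "\<dots> = (\<Sum>i\<le>d. (1 / s) *\<^sub>R (coord f i z *\<^sub>R f i))"
    by (intro sum.cong) (auto simp: x_def)
  also have "\<dots> = (1 / s) *\<^sub>R z" unfolding scaleR_sum_right[symmetric] sum_coord[OF f(1)] ..
  finally have fl: "\<gamma> (flat_point v x) = (1 / s) *\<^sub>R z" .
  then have "norm (flat_point v x) = 1 / s"
    using norm_group[OF v(2), of "flat_point v x"] z(1) s by simp
  then have "\<gamma> (sphere_point v x) = z"
    using group_sphere_point[OF v(2), of v x] fl s by simp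
  then have "orbit_rel `` {sphere_point v x} = C"
    using orbit_class_eq_iff[OF sphere_point_in[OF v(1) x] z(1)] v(2) z(2) by blast
  then show ?thesis using v(1) x by (auto simp: orbit_point_def)
qed

text \<open>By \<open>orbit_point_eq_iff\<close> the map to the quotient of the sphere descends to a bijection; it is a homeomorphism because it maps a compact
space to a Hausdorff space.\<close>

lemma graph_space_homeomorphic: "graph_space d QG homeomorphic_space orbit_space"
proof -
  let ?\<Theta> = "\<lambda>p. orbit_point (fst p) (snd p)" and ?\<pi> = "\<lambda>p. glue_rel d QG `` {p}"
  have into: "orbit_point v x \<in> topspace orbit_space" if "v < m" "x \<in> standard_simplex d" for v x
    using sphere_point_in[OF that] by (auto simp: orbit_space_def orbit_point_def quotient_def)
  have "continuous_map (top_of_set (standard_simplex d)) orbit_space (orbit_point v)" if v: "v < m" for v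
  proof -
    have "continuous_map (top_of_set (standard_simplex d)) (top_of_set (sphere 0 1)) (sphere_point v)"
      using continuous_sphere_point[OF v] sphere_point_in[OF v] by (auto simp: continuous_map_in_subtopology)
    moreover have "continuous_map (top_of_set (sphere 0 1)) orbit_space (\<lambda>z. orbit_rel `` {z})"
      unfolding orbit_space_def by (intro quotient_imp_continuous_map quotient_map_quotient_topology)
    ultimately have "continuous_map (top_of_set (standard_simplex d)) orbit_space
        ((\<lambda>z. orbit_rel `` {z}) \<circ> sphere_point v)"
      by (rule continuous_map_compose)
    then show ?thesis by (simp add: comp_def orbit_point_def[abs_def])
  qed
  then have cont: "continuous_map (simplex_sum d QG) orbit_space ?\<Theta>"
    unfolding simplex_sum_def
    by (intro continuous_map_from_sum_topology) (simp add: euclidean_product_topology)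
  have \<pi>: "quotient_map (simplex_sum d QG) (graph_space d QG) ?\<pi>"
    unfolding graph_space_def by (rule quotient_map_quotient_topology)
  define h where "h = (\<lambda>C. ?\<Theta> (SOME p. p \<in> topspace (simplex_sum d QG) \<and> ?\<pi> p = C))"
  have h: "h (graph_point d QG v x) = orbit_point v x" if v: "v < m" "x \<in> standard_simplex d" for v x
  proof -
    have "\<exists>p. p \<in> topspace (simplex_sum d QG) \<and> ?\<pi> p = graph_point d QG v x"
      using v by (intro exI[of _ "(v, x)"]) (simp add: topspace_simplex_sum graph_point_def)
    from someI_ex[OF this] obtain w y where wy: "w < m" "y \<in> standard_simplex d"
      "graph_point d QG w y = graph_point d QG v x"
      and "(SOME p. p \<in> topspace (simplex_sum d QG) \<and> ?\<pi> p = graph_point d QG v x) = (w, y)"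
      by (cases "SOME p. p \<in> topspace (simplex_sum d QG) \<and> ?\<pi> p = graph_point d QG v x")
        (auto simp: topspace_simplex_sum graph_point_def)
    then have "h (graph_point d QG v x) = orbit_point w y" by (simp add: h_def)
    moreover have "y = x \<and> (w, v) \<in> linked QG {i. y i = 0}"
      using wy graph_point_eq_iff[of w QG v y d x] v by auto
    ultimately show ?thesis using orbit_point_eq_iff[OF wy(1) v(1) wy(2) v(2)] by metis
  qed
  have "homeomorphic_map (graph_space d QG) orbit_space h"
  proof (rule continuous_imp_homeomorphic_map)
    have "continuous_map (simplex_sum d QG) orbit_space (h \<circ> ?\<pi>)"
      by (rule continuous_map_eq[OF cont]) (auto simp: topspace_simplex_sum h[unfolded graph_point_def])
    then show "continuous_map (graph_space d QG) orbit_space h"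
      using continuous_compose_quotient_map_eq[OF \<pi>] by blast
    have "compactin (graph_space d QG) (?\<pi> ` topspace (simplex_sum d QG))"
      using compact_simplex_sum[of QG d] quotient_imp_continuous_map[OF \<pi>]
      by (intro image_compactin) (auto simp: compact_space_def)
    then show "compact_space (graph_space d QG)"
      using quotient_imp_surjective_map[OF \<pi>] by (simp add: compact_space_def)
    show "Hausdorff_space orbit_space" by (rule Hausdorff_orbit_space)
    show "h ` topspace (graph_space d QG) = topspace orbit_space"
    proof
      show "h ` topspace (graph_space d QG) \<subseteq> topspace orbit_space"
        using h into by (auto simp: topspace_graph_space)
      show "topspace orbit_space \<subseteq> h ` topspace (graph_space d QG)"
      proof
        fix C assume "C \<in> topspace orbit_space"
        then obtain v x where v: "v < m" "x \<in> standard_simplex d" "C = orbit_point v x"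
          using orbit_point_surj by blast
        then have "C = h (graph_point d QG v x)" "graph_point d QG v x \<in> topspace (graph_space d QG)"
          using h by (auto simp: topspace_graph_space)
        then show "C \<in> h ` topspace (graph_space d QG)" by blast
      qed
    qed
    show "inj_on h (topspace (graph_space d QG))"
    proof (rule inj_onI)
      fix C D assume "C \<in> topspace (graph_space d QG)" "D \<in> topspace (graph_space d QG)" and hh: "h C = h D"
      then obtain v x w y where vw: "v < m" "w < m" "x \<in> standard_simplex d" "y \<in> standard_simplex d"
        "C = graph_point d QG v x" "D = graph_point d QG w y"
        by (auto simp: topspace_graph_space)
      have "orbit_point v x = orbit_point w y"
        using hh h[OF vw(1,3)] h[OF vw(2,4)] vw(5,6) by simp
      then have "x = y \<and> (v, w) \<in> linked QG {i. x i = 0}"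
        using orbit_point_eq_iff[OF vw(1-4)] by blast
      then show "C = D"
        using graph_point_eq_iff[of v QG w x d y] vw by auto
    qed
  qed
  then show ?thesis using homeomorphic_map_imp_homeomorphic_space by blast
qed

theorem crystallization_QG: "crystallization d QG orbit_space"
proof -
  have "Hausdorff_space (graph_space d QG)"
    using Hausdorff_orbit_space homeomorphic_Hausdorff_space[OF graph_space_homeomorphic] by blast
  then have "simplicial_cell_complex d (graph_space d QG) (graph_cells d QG)"
    using verts_nonempty by (intro simplicial_cell_complex_graph_space) auto
  then show ?thesis
    using graph_space_homeomorphic homeomorphic_space_sym contracted_QG
    unfolding crystallization_def pseudotriangulation_def by blast
qed

end

theorem (in spherical_tiling) crystallization_orbit_space:
  "\<exists>G :: (nat, nat) cgraph. card (verts G) = card (facet_orbit ` R) \<and> crystallization d G orbit_space"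
proof -
  show ?thesis
  proof (rule orbit_representatives)
    fix \<rho> m
    assume \<rho>: "m = card (facet_orbit ` R)" "\<And>v. v < m \<Longrightarrow> \<rho> v \<in> R"
      "\<And>f. f \<in> R \<Longrightarrow> \<exists>v<m. \<exists>\<gamma>\<in>\<Gamma>. f = \<gamma> \<circ> \<rho> v"
      "\<And>v w \<gamma> \<delta>. v < m \<Longrightarrow> w < m \<Longrightarrow> \<gamma> \<in> \<Gamma> \<Longrightarrow> \<delta> \<in> \<Gamma> \<Longrightarrow> \<gamma> \<circ> \<rho> v = \<delta> \<circ> \<rho> w \<Longrightarrow> v = w"
    interpret tiling_graph d R \<Gamma> \<rho> m
    proof
      show "\<rho> v \<in> R" if "v < m" for v using that by (rule \<rho>(2))
      show "\<exists>v<m. \<exists>\<gamma>\<in>\<Gamma>. f = \<gamma> \<circ> \<rho> v" if "f \<in> R" for f using that by (rule \<rho>(3))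
      show "v = w" if "v < m" "w < m" "\<gamma> \<in> \<Gamma>" "\<delta> \<in> \<Gamma>" "\<gamma> \<circ> \<rho> v = \<delta> \<circ> \<rho> w" for v w \<gamma> \<delta>
        using that by (rule \<rho>(4))
    qed
    have "card (verts QG) = card (facet_orbit ` R)" unfolding \<rho>(1)[symmetric] by simp
    then show ?thesis using crystallization_QG by blast
  qed
qed


section \<open>Supporting functionals on the Clifford torus\<close>

lemma cos_below_tangent:
  fixes u v :: real
  assumes "\<bar>u\<bar> \<le> pi / 2" "\<bar>v\<bar> \<le> pi / 2" "u \<noteq> v"
  shows "cos u < cos v - sin v * (u - v)"
proof (cases "v < u")
  case True
  obtain \<xi> where x: "v < \<xi>" "\<xi> < u" "cos u - cos v = (u - v) * (- sin \<xi>)"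
    using MVT2[OF True, of cos "\<lambda>x. - sin x"] by (auto intro!: derivative_eq_intros)
  have "sin v < sin \<xi>" using sin_monotone_2pi[of v \<xi>] x assms by auto
  then have "(u - v) * (- sin \<xi>) < (u - v) * (- sin v)" using True by (intro mult_strict_left_mono) auto
  then show ?thesis using x(3) by (simp add: algebra_simps)
next
  case False
  then have lt: "u < v" using assms by simp
  obtain \<xi> where x: "u < \<xi>" "\<xi> < v" "cos v - cos u = (v - u) * (- sin \<xi>)"
    using MVT2[OF lt, of cos "\<lambda>x. - sin x"] by (auto intro!: derivative_eq_intros)
  have "sin \<xi> < sin v" using sin_monotone_2pi[of \<xi> v] x assms by auto
  then have "(v - u) * sin \<xi> < (v - u) * sin v" using lt by (intro mult_strict_left_mono) auto
  then show ?thesis using x(3) by (simp add: algebra_simps)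
qed

corollary cos_below_tangent_le:
  fixes u v :: real
  assumes "\<bar>u\<bar> \<le> pi / 2" "\<bar>v\<bar> \<le> pi / 2"
  shows "cos u \<le> cos v - sin v * (u - v)"
  using cos_below_tangent[OF assms] by (cases "u = v") auto

text \<open>Here \<open>(x, y)\<close> are coordinates in which the parallelogram has the vertices \<open>(\<plusminus>1, \<plusminus>1)\<close>, and \<open>F\<close> is concave where
both angles are at most \<open>\<pi> / 2\<close>. At the vertex in the quadrant of \<open>(x, y)\<close>, the tangent plane of \<open>F\<close> cannot
increase in the outward directions, because \<open>F\<close> takes the same value at the two neighbouring vertices. So \<open>F\<close> cannot
exceed this value further out.\<close>

lemma two_cosines_le_1:
  fixes A1 B1 A2 B2 l1 l2 :: real
  defines "F \<equiv> \<lambda>x y. l1 * cos (x * A1 + y * B1) + l2 * cos (y * B2 - x * A2)"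
  assumes pos: "l1 > 0" "l2 > 0" "A1 > 0" "B1 > 0" "A2 > 0" "B2 > 0"
    and small: "A1 + B1 \<le> pi / 2" "A2 + B2 \<le> pi / 2"
    and F1: "F 1 1 = 1" "F 1 (- 1) = 1"
    and x: "1 \<le> \<bar>x\<bar>" "1 \<le> \<bar>y\<bar>" "\<bar>x * A1 + y * B1\<bar> \<le> pi / 2" "\<bar>y * B2 - x * A2\<bar> \<le> pi / 2"
  shows "F x y \<le> 1" and "F x y = 1 \<Longrightarrow> \<bar>x\<bar> = 1 \<and> \<bar>y\<bar> = 1"
proof -
  have neg: "F (- x) (- y) = F x y" for x y
  proof -
    have "(- x) * A1 + (- y) * B1 = - (x * A1 + y * B1)" "(- y) * B2 - (- x) * A2 = - (y * B2 - x * A2)"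
      by (simp_all add: algebra_simps)
    then show ?thesis unfolding F_def by (simp only: cos_minus)
  qed
  have F1': "F (- 1) (- 1) = 1" "F (- 1) 1 = 1" using F1 neg[of 1 1] neg[of 1 "- 1"] by simp_all
  define \<sigma> where "\<sigma> = sgn x"
  define \<tau> where "\<tau> = sgn y"
  have st: "\<sigma> = 1 \<or> \<sigma> = - 1" "\<tau> = 1 \<or> \<tau> = - 1" "\<bar>x\<bar> = \<sigma> * x" "\<bar>y\<bar> = \<tau> * y"
    using x by (auto simp: \<sigma>_def \<tau>_def sgn_if)
  have vert: "F \<sigma> \<tau> = 1" "F (- \<sigma>) \<tau> = 1" "F \<sigma> (- \<tau>) = 1"
    using st F1 F1' by auto
  define u1 where "u1 = \<sigma> * A1 + \<tau> * B1"
  define u2 where "u2 = \<tau> * B2 - \<sigma> * A2"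
  have sq: "\<bar>s * A1 + t * B1\<bar> \<le> pi / 2" "\<bar>t * B2 - s * A2\<bar> \<le> pi / 2"
    if "s = 1 \<or> s = - 1" "t = 1 \<or> t = - 1" for s t
  proof -
    have st: "\<bar>s\<bar> = 1" "\<bar>t\<bar> = 1" using that by auto
    show "\<bar>s * A1 + t * B1\<bar> \<le> pi / 2"
      using abs_triangle_ineq[of "s * A1" "t * B1"] pos small st by (simp add: abs_mult)
    show "\<bar>t * B2 - s * A2\<bar> \<le> pi / 2"
      using abs_triangle_ineq4[of "t * B2" "s * A2"] pos small st by (simp add: abs_mult)
  qed
  have u: "\<bar>u1\<bar> \<le> pi / 2" "\<bar>u2\<bar> \<le> pi / 2" using sq st by (simp_all add: u1_def u2_def)
  define Gx where "Gx = - l1 * sin u1 * A1 + l2 * sin u2 * A2"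
  define Gy where "Gy = - l1 * sin u1 * B1 - l2 * sin u2 * B2"
  have lin: "l1 * (cos u1 - sin u1 * (a * A1 + b * B1 - u1)) + l2 * (cos u2 - sin u2 * (b * B2 - a * A2 - u2))
      = F \<sigma> \<tau> + (a - \<sigma>) * Gx + (b - \<tau>) * Gy" for a b
    unfolding F_def u1_def[symmetric] u2_def[symmetric] Gx_def Gy_def
    by (simp add: u1_def u2_def algebra_simps)
  have tangent: "F a b \<le> 1 + (a - \<sigma>) * Gx + (b - \<tau>) * Gy"
    if ab: "\<bar>a * A1 + b * B1\<bar> \<le> pi / 2" "\<bar>b * B2 - a * A2\<bar> \<le> pi / 2" for a b
  proof -
    have "F a b \<le> l1 * (cos u1 - sin u1 * (a * A1 + b * B1 - u1)) + l2 * (cos u2 - sin u2 * (b * B2 - a * A2 - u2))"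
      unfolding F_def using cos_below_tangent_le[OF ab(1) u(1)] cos_below_tangent_le[OF ab(2) u(2)] pos
      by (intro add_mono mult_left_mono) auto
    then show ?thesis using lin vert by simp
  qed
  \<comment> \<open>At the two neighbouring vertices \<open>F\<close> is 1 as well, so the tangent plane is at least 1 there.\<close>
  have Gx: "\<sigma> * Gx \<le> 0" using tangent[of "- \<sigma>" \<tau>] sq[of "- \<sigma>" \<tau>] st vert by (auto simp: mult.commute)
  have Gy: "\<tau> * Gy \<le> 0" using tangent[of \<sigma> "- \<tau>"] sq[of \<sigma> "- \<tau>"] st vert by (auto simp: mult.commute)
  have eq: "(x - \<sigma>) * Gx = (\<bar>x\<bar> - 1) * (\<sigma> * Gx)" "(y - \<tau>) * Gy = (\<bar>y\<bar> - 1) * (\<tau> * Gy)"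
    using st by (auto simp: algebra_simps)
  have le: "(x - \<sigma>) * Gx \<le> 0" "(y - \<tau>) * Gy \<le> 0"
    unfolding eq using mult_nonneg_nonpos[OF _ Gx, of "\<bar>x\<bar> - 1"] mult_nonneg_nonpos[OF _ Gy, of "\<bar>y\<bar> - 1"] x(1,2)
    by simp_all
  show "F x y \<le> 1" using tangent[OF x(3,4)] le by simp
  show "\<bar>x\<bar> = 1 \<and> \<bar>y\<bar> = 1" if F: "F x y = 1"
  proof -
    have eq: "x * A1 + y * B1 = u1 \<and> y * B2 - x * A2 = u2"
    proof (rule ccontr)
      assume ne: "\<not> (x * A1 + y * B1 = u1 \<and> y * B2 - x * A2 = u2)"
      have c1: "cos (x * A1 + y * B1) \<le> cos u1 - sin u1 * (x * A1 + y * B1 - u1)"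
        and c2: "cos (y * B2 - x * A2) \<le> cos u2 - sin u2 * (y * B2 - x * A2 - u2)"
        by (rule cos_below_tangent_le[OF x(3) u(1)], rule cos_below_tangent_le[OF x(4) u(2)])
      have "F x y < l1 * (cos u1 - sin u1 * (x * A1 + y * B1 - u1)) + l2 * (cos u2 - sin u2 * (y * B2 - x * A2 - u2))"
      proof (cases "x * A1 + y * B1 = u1")
        case True
        then have "cos (y * B2 - x * A2) < cos u2 - sin u2 * (y * B2 - x * A2 - u2)"
          using ne cos_below_tangent[OF x(4) u(2)] by blast
        then show ?thesis unfolding F_def using pos c1
          by (intro add_le_less_mono mult_left_mono mult_strict_left_mono) auto
      next
        case False
        then have "cos (x * A1 + y * B1) < cos u1 - sin u1 * (x * A1 + y * B1 - u1)"
          using cos_below_tangent[OF x(3) u(1)] by blast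
        then show ?thesis unfolding F_def using pos c2
          by (intro add_less_le_mono mult_left_mono mult_strict_left_mono) auto
      qed
      then show False using lin[of x y] vert le F by simp
    qed
    then have e: "(x - \<sigma>) * A1 + (y - \<tau>) * B1 = 0" "(y - \<tau>) * B2 - (x - \<sigma>) * A2 = 0"
      by (simp_all add: u1_def u2_def algebra_simps)
    have "(x - \<sigma>) * (A1 * B2 + A2 * B1) = ((x - \<sigma>) * A1 + (y - \<tau>) * B1) * B2 - ((y - \<tau>) * B2 - (x - \<sigma>) * A2) * B1"
      by (simp add: algebra_simps)
    moreover have "(y - \<tau>) * (A1 * B2 + A2 * B1) = ((x - \<sigma>) * A1 + (y - \<tau>) * B1) * A2 + ((y - \<tau>) * B2 - (x - \<sigma>) * A2) * A1"
      by (simp add: algebra_simps)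
    moreover have "A1 * B2 + A2 * B1 > 0" using pos by (simp add: add_pos_pos)
    ultimately have "x = \<sigma>" "y = \<tau>" unfolding e by auto
    then show ?thesis using st by auto
  qed
qed

text \<open>All angles that occur are multiples of \<open>\<pi> / (2 p)\<close>, since centred coordinates are half-integral.\<close>

definition half_angle :: "int \<Rightarrow> int \<Rightarrow> real" where
  "half_angle p m = pi * of_int m / (2 * of_int p)"

lemma half_angle_add: "half_angle p (m + n) = half_angle p m + half_angle p n"
  and half_angle_diff: "half_angle p (m - n) = half_angle p m - half_angle p n"
  and half_angle_mult: "half_angle p (k * m) = of_int k * half_angle p m"
  and half_angle_0: "half_angle p 0 = 0"
  by (simp_all add: half_angle_def add_divide_distrib diff_divide_distrib distrib_left right_diff_distrib)

lemma half_angle_period: "p \<noteq> 0 \<Longrightarrow> half_angle p (4 * p * k) = 2 * pi * of_int k"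
  and half_angle_self: "p \<noteq> 0 \<Longrightarrow> half_angle p p = pi / 2"
  by (simp_all add: half_angle_def field_simps)

lemma cos_half_angle_period: "p \<noteq> 0 \<Longrightarrow> cos (half_angle p (m - 4 * p * k)) = cos (half_angle p m)"
proof -
  assume p: "p \<noteq> 0"
  have "half_angle p m = half_angle p (m - 4 * p * k) + 2 * pi * of_int k"
    by (simp add: half_angle_diff half_angle_period[OF p])
  then show ?thesis by (simp add: cos_add cos_int_2pin sin_int_2pin)
qed

lemma half_angle_le: "p > 0 \<Longrightarrow> half_angle p m \<le> half_angle p n \<longleftrightarrow> m \<le> n"
  by (simp add: half_angle_def divide_le_cancel)

lemma half_angle_less: "p > 0 \<Longrightarrow> half_angle p m < half_angle p n \<longleftrightarrow> m < n"
  by (simp add: half_angle_def divide_less_cancel)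

lemma half_angle_pos: "p > 0 \<Longrightarrow> 0 < m \<Longrightarrow> 0 < half_angle p m"
  by (simp add: half_angle_def)

lemma half_angle_abs: "p > 0 \<Longrightarrow> \<bar>half_angle p m\<bar> = half_angle p \<bar>m\<bar>"
  by (simp add: half_angle_def abs_mult)

lemma half_angle_cos_sin_pos:
  assumes "0 < m" "m < p"
  shows "0 < cos (half_angle p m)" "0 < sin (half_angle p m)"
proof -
  have p: "p > 0" using assms by simp
  have "0 < half_angle p m" "half_angle p m < pi / 2"
    using half_angle_pos[OF p assms(1)] half_angle_less[OF p, of m p] half_angle_self[of p] assms(2) p by auto
  then show "0 < cos (half_angle p m)" "0 < sin (half_angle p m)"
    by (auto intro: cos_gt_zero sin_gt_zero)
qed

lemma residue_near_zero:
  fixes p m :: int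
  assumes "p > 0"
  obtains k where "\<bar>m - 4 * p * k\<bar> \<le> 2 * p"
proof
  have "0 \<le> (m + 2 * p) mod (4 * p)" "(m + 2 * p) mod (4 * p) < 4 * p" using assms by simp_all
  moreover have "(m + 2 * p) mod (4 * p) = m + 2 * p - 4 * p * ((m + 2 * p) div (4 * p))"
    by (simp add: minus_mult_div_eq_mod)
  ultimately show "\<bar>m - 4 * p * ((m + 2 * p) div (4 * p))\<bar> \<le> 2 * p" by linarith
qed

lemma cos_half_angle_odd:
  assumes "p \<ge> 2" "odd m"
  shows "cos (half_angle p m) \<le> cos (half_angle p 1)"
    and "cos (half_angle p m) = cos (half_angle p 1) \<Longrightarrow> 4 * p dvd m - 1 \<or> 4 * p dvd m + 1"
proof -
  have p: "p > 0" "p \<noteq> 0" using assms by auto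
  obtain k where k: "\<bar>m - 4 * p * k\<bar> \<le> 2 * p" using residue_near_zero[OF p(1)] .
  define n where "n = m - 4 * p * k"
  have odd: "odd n" using assms(2) by (simp add: n_def)
  then have n1: "1 \<le> \<bar>n\<bar>" by (cases "n = 0") auto
  have c: "cos (half_angle p m) = cos (half_angle p \<bar>n\<bar>)"
    using cos_half_angle_period[OF p(2), of m k] half_angle_abs[OF p(1), of n] cos_abs_real[of "half_angle p n"]
    by (simp add: n_def)
  have pi: "half_angle p \<bar>n\<bar> \<le> pi"
    using half_angle_le[OF p(1), of "\<bar>n\<bar>" "2 * p"] k half_angle_mult[of p 2 p] half_angle_self[OF p(2)]
    by (simp add: n_def)
  have pos: "0 < half_angle p 1" using half_angle_pos[OF p(1)] by simp
  show "cos (half_angle p m) \<le> cos (half_angle p 1)"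
    unfolding c using half_angle_le[OF p(1), of 1 "\<bar>n\<bar>"] n1 pi pos by (intro cos_monotone_0_pi_le) auto
  assume "cos (half_angle p m) = cos (half_angle p 1)"
  then have "\<not> 1 < \<bar>n\<bar>"
    unfolding c using half_angle_less[OF p(1), of 1 "\<bar>n\<bar>"] pi pos
      cos_monotone_0_pi[of "half_angle p 1" "half_angle p \<bar>n\<bar>"] by auto
  then have "n = 1 \<or> n = - 1" using n1 by auto
  then have "m - 1 = 4 * p * k \<or> m + 1 = 4 * p * k" by (auto simp: n_def)
  then show "4 * p dvd m - 1 \<or> 4 * p dvd m + 1" by (metis dvd_triv_left)
qed

text \<open>In terms of the sides \<open>a\<close>, \<open>b\<close> of the parallelogram the two meridians are \<open>x0 a - y0 b\<close> and \<open>x1 a + y1 b\<close>, whose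
intersection number is \<open>p\<close>. Both combinations have only nonzero coefficients in an interior layer; the other three cases
are the two ends of a Farey path, where a side of the parallelogram is a meridian.\<close>

locale lattice_square =
  fixes p x0 y0 x1 y1 :: int
  assumes p2: "2 \<le> p" and p_eq: "p = x0 * y1 + y0 * x1"
    and nonneg: "0 \<le> x0" "0 \<le> y0" "0 \<le> x1" "0 \<le> y1"
    and cases: "(1 \<le> x0 \<and> 1 \<le> y0 \<and> 1 \<le> x1 \<and> 1 \<le> y1) \<or> (y0 = 0 \<and> x0 = 1 \<and> 1 \<le> x1 \<and> x1 < p) \<or>
        (y1 = 0 \<and> x1 = 1 \<and> 1 \<le> x0 \<and> x0 < p) \<or> (x1 = 0 \<and> y1 = 1 \<and> 1 \<le> y0 \<and> y0 < p)"
begin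

definition angle1 :: "int \<Rightarrow> int \<Rightarrow> real" where
  "angle1 x y = half_angle p (y0 * x + x0 * y)"

definition angle2 :: "int \<Rightarrow> int \<Rightarrow> real" where
  "angle2 x y = half_angle p (x1 * y - y1 * x)"

abbreviation "cA1 \<equiv> cos (half_angle p y0)"
abbreviation "sA1 \<equiv> sin (half_angle p y0)"
abbreviation "cB1 \<equiv> cos (half_angle p x0)"
abbreviation "sB1 \<equiv> sin (half_angle p x0)"
abbreviation "cA2 \<equiv> cos (half_angle p y1)"
abbreviation "sA2 \<equiv> sin (half_angle p y1)"
abbreviation "cB2 \<equiv> cos (half_angle p x1)"
abbreviation "sB2 \<equiv> sin (half_angle p x1)"

text \<open>The centred configuration of the four vertices is symmetric under \<open>(x, y) \<mapsto> (-x, -y)\<close>. So the determinant of the four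
points in \<open>\<real>\<^sup>4\<close> is, up to a constant, the product of a determinant of cosines and a determinant of
sines.\<close>

definition even_det :: real where
  "even_det = cA1 * cB1 * (sA2 * sB2) + sA1 * sB1 * (cA2 * cB2)"

definition odd_det :: real where
  "odd_det = sA1 * cB1 * (cA2 * sB2) + cA1 * sB1 * (sA2 * cB2)"

lemma lt_p:
  assumes "1 \<le> x0 \<and> 1 \<le> y0 \<and> 1 \<le> x1 \<and> 1 \<le> y1"
  shows "x0 < p" "y0 < p" "x1 < p" "y1 < p" "x0 + y0 \<le> p" "x1 + y1 \<le> p"
proof -
  have "x0 \<le> x0 * y1" "y0 \<le> y0 * x1" "y1 \<le> x0 * y1" "x1 \<le> y0 * x1"
    using assms by (simp_all add: mult_le_cancel_left1 mult_le_cancel_right1)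
  then show "x0 < p" "y0 < p" "x1 < p" "y1 < p" "x0 + y0 \<le> p" "x1 + y1 \<le> p"
    using assms p_eq by linarith+
qed

lemma shape:
  obtains (mid) "1 \<le> x0 \<and> 1 \<le> y0 \<and> 1 \<le> x1 \<and> 1 \<le> y1" | (A) "y0 = 0" "x0 = 1" "1 \<le> x1" "x1 < p" "y1 = p"
    | (B) "y1 = 0" "x1 = 1" "1 \<le> x0" "x0 < p" "y0 = p" | (C) "x1 = 0" "y1 = 1" "1 \<le> y0" "y0 < p" "x0 = p"
proof -
  show thesis
    using cases
  proof (elim disjE)
    assume h: "y0 = 0 \<and> x0 = 1 \<and> 1 \<le> x1 \<and> x1 < p"
    then have "y1 = p" using p_eq by simp
    with h show thesis by (intro that(2)) auto
  next
    assume h: "y1 = 0 \<and> x1 = 1 \<and> 1 \<le> x0 \<and> x0 < p"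
    then have "y0 = p" using p_eq by simp
    with h show thesis by (intro that(3)) auto
  next
    assume h: "x1 = 0 \<and> y1 = 1 \<and> 1 \<le> y0 \<and> y0 < p"
    then have "x0 = p" using p_eq by simp
    with h show thesis by (intro that(4)) auto
  qed (rule that(1))
qed

lemma dets_pos: "0 < even_det" "0 < odd_det"
proof -
  have p0: "p \<noteq> 0" "0 < p" "1 < p" using p2 by auto
  note pos = half_angle_cos_sin_pos[of _ p]
  have hp: "cos (half_angle p p) = 0" "sin (half_angle p p) = 1"
    unfolding half_angle_self[OF p0(1)] by simp_all
  have "0 < even_det \<and> 0 < odd_det"
  proof (cases rule: shape)
    case mid
    then have "0 < cA1" "0 < sA1" "0 < cB1" "0 < sB1" "0 < cA2" "0 < sA2" "0 < cB2" "0 < sB2"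
      using lt_p pos by auto
    then show ?thesis unfolding even_det_def odd_det_def by (simp add: add_pos_pos)
  next
    case A
    then show ?thesis using pos[of 1] pos[of x1] p0 hp
      unfolding even_det_def odd_det_def by (simp add: half_angle_0)
  next
    case B
    then show ?thesis using pos[of 1] pos[of x0] p0 hp
      unfolding even_det_def odd_det_def by (simp add: half_angle_0)
  next
    case C
    then show ?thesis using pos[of 1] pos[of y0] p0 hp
      unfolding even_det_def odd_det_def by (simp add: half_angle_0)
  qed
  then show "0 < even_det" "0 < odd_det" by auto
qed

text \<open>The weights are determined by the condition that the functional takes the value 1 at all four vertices.\<close>

definition "weight1 = sA2 * sB2 / even_det"
definition "weight2 = sA1 * sB1 / even_det"

definition height :: "int \<Rightarrow> int \<Rightarrow> real" where
  "height x y = weight1 * cos (angle1 x y) + weight2 * cos (angle2 x y)"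

lemma angle1_expand: "angle1 x y = of_int x * half_angle p y0 + of_int y * half_angle p x0"
  and angle2_expand: "angle2 x y = of_int y * half_angle p x1 - of_int x * half_angle p y1"
  by (simp_all add: angle1_def angle2_def half_angle_def algebra_simps add_divide_distrib diff_divide_distrib)

lemma height_vertex:
  assumes "x = 1 \<or> x = - 1" "y = 1 \<or> y = - 1"
  shows "height x y = 1"
proof -
  have d: "even_det \<noteq> 0" using dets_pos by simp
  have w: "weight1 * (sA1 * sB1) = weight2 * (sA2 * sB2)" by (simp add: weight1_def weight2_def)
  have one: "weight1 * (cA1 * cB1) + weight2 * (cA2 * cB2) = 1"
  proof -
    have "weight1 * (cA1 * cB1) + weight2 * (cA2 * cB2) = even_det / even_det"
      unfolding weight1_def weight2_def times_divide_eq_left add_divide_distrib[symmetric]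
      by (rule arg_cong[of _ _ "\<lambda>t. t / even_det"]) (simp add: even_det_def)
    then show ?thesis using d by simp
  qed
  have cs: "cos (angle1 x y) = cA1 * cB1 - of_int (x * y) * (sA1 * sB1)"
    "cos (angle2 x y) = cA2 * cB2 + of_int (x * y) * (sA2 * sB2)"
    using assms unfolding angle1_expand angle2_expand by (auto simp: cos_add cos_diff)
  have "height x y = weight1 * (cA1 * cB1) + weight2 * (cA2 * cB2)
      - of_int (x * y) * (weight1 * (sA1 * sB1) - weight2 * (sA2 * sB2))"
    unfolding height_def cs by (simp add: algebra_simps)
  then show ?thesis using w one by simp
qed

text \<open>Both angles agree modulo \<open>2 \<pi>\<close>.\<close>

definition congruent :: "int \<Rightarrow> int \<Rightarrow> int \<Rightarrow> int \<Rightarrow> bool" where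
  "congruent x y x' y' \<longleftrightarrow> 4 * p dvd y0 * (x - x') + x0 * (y - y') \<and> 4 * p dvd x1 * (y - y') - y1 * (x - x')"

text \<open>When a side is a meridian, one weight vanishes and the functional depends on a single coordinate \<open>m\<close>,
whose class modulo \<open>4 p\<close> it determines. The other coordinate \<open>n\<close> matters only modulo 4, after the correction
by \<open>4 c t\<close> that undoes the effect of changing \<open>m\<close>.\<close>

lemma odd_cosine_ratio:
  assumes "odd m" "odd n"
  shows "cos (half_angle p m) / cos (half_angle p 1) \<le> 1"
    and "cos (half_angle p m) / cos (half_angle p 1) = 1 \<Longrightarrow>
      \<exists>m'\<in>{1, - 1}. \<exists>n'\<in>{1, - 1}. \<exists>s t. m - m' = 4 * p * t \<and> n - n' = 4 * s + 4 * c * t"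
proof -
  have c1: "0 < cos (half_angle p 1)" using half_angle_cos_sin_pos[of 1 p] p2 by simp
  show "cos (half_angle p m) / cos (half_angle p 1) \<le> 1"
    using cos_half_angle_odd(1)[OF p2 assms(1)] c1 by (simp add: divide_le_eq_1)
  assume "cos (half_angle p m) / cos (half_angle p 1) = 1"
  then have "4 * p dvd m - 1 \<or> 4 * p dvd m - (- 1)"
    using cos_half_angle_odd(2)[OF p2 assms(1)] c1 by simp
  then obtain m' where m': "m' \<in> {1, - 1}" "4 * p dvd m - m'" by blast
  from m'(2) obtain t where t: "m - m' = 4 * p * t" by (rule dvdE)
  have "4 dvd a - 1 \<or> 4 dvd a - (- 1)" if "odd a" for a :: int using that by presburger
  moreover have "odd (n - 4 * c * t)" using assms(2) by simp
  ultimately obtain n' where n': "n' \<in> {1, - 1}" "4 dvd n - 4 * c * t - n'" by blast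
  from n'(2) obtain s where "n - 4 * c * t - n' = 4 * s" by (rule dvdE)
  then have "n - n' = 4 * s + 4 * c * t" by simp
  then show "\<exists>m'\<in>{1, - 1}. \<exists>n'\<in>{1, - 1}. \<exists>s t. m - m' = 4 * p * t \<and> n - n' = 4 * s + 4 * c * t"
    using m'(1) n'(1) t by blast
qed

lemma height_cap:
  assumes xy: "odd x" "odd y" and cap: "\<not> (1 \<le> x0 \<and> 1 \<le> y0 \<and> 1 \<le> x1 \<and> 1 \<le> y1)"
  shows "height x y \<le> 1 \<and>
    (height x y = 1 \<longrightarrow> (\<exists>x'\<in>{1, - 1}. \<exists>y'\<in>{1, - 1}. congruent x y x' y'))"
proof -
  have p0: "p \<noteq> 0" "0 < p" "1 < p" using p2 by auto
  note pos = half_angle_cos_sin_pos[of _ p]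
  have hp: "cos (half_angle p p) = 0" "sin (half_angle p p) = 1"
    unfolding half_angle_self[OF p0(1)] by simp_all
  have dvd: "4 * p dvd a" if "a = 4 * p * k" for a k using that by simp
  show ?thesis
  proof (cases rule: shape)
    case mid
    then show ?thesis using cap by blast
  next
    case A
    have "weight2 = 0" "weight1 = 1 / cos (half_angle p 1)"
      using A pos[of x1] p0 hp unfolding weight1_def weight2_def even_det_def
      by (simp_all add: half_angle_0)
    then have h: "height x y = cos (half_angle p y) / cos (half_angle p 1)"
      using A unfolding height_def angle1_def by simp
    have "congruent x y x' y'" if "y - y' = 4 * p * t" "x - x' = 4 * s + 4 * x1 * t" for x' y' s t
      unfolding congruent_def that using A by (intro conjI dvd[of _ t] dvd[of _ "- s"]) (simp_all add: algebra_simps)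
    then show ?thesis using odd_cosine_ratio(1)[OF xy(2,1)] odd_cosine_ratio(2)[OF xy(2,1), of x1] unfolding h by blast
  next
    case B
    have "weight1 = 0" "weight2 = 1 / cos (half_angle p 1)"
      using B pos[of x0] p0 hp unfolding weight1_def weight2_def even_det_def
      by (simp_all add: half_angle_0)
    then have h: "height x y = cos (half_angle p y) / cos (half_angle p 1)"
      using B unfolding height_def angle2_def by simp
    have "congruent x y x' y'" if "y - y' = 4 * p * t" "x - x' = 4 * s + 4 * x0 * t" for x' y' s t
      unfolding congruent_def that using B
      by (intro conjI dvd[of _ "s + 2 * x0 * t"] dvd[of _ t]) (simp_all add: algebra_simps)
    then show ?thesis using odd_cosine_ratio(1)[OF xy(2,1)] odd_cosine_ratio(2)[OF xy(2,1), of x0] unfolding h by blast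
  next
    case C
    have "weight1 = 0" "weight2 = 1 / cos (half_angle p 1)"
      using C pos[of y0] p0 hp unfolding weight1_def weight2_def even_det_def
      by (simp_all add: half_angle_0)
    moreover have "half_angle p (- x) = - half_angle p x" by (simp add: half_angle_def)
    ultimately have h: "height x y = cos (half_angle p x) / cos (half_angle p 1)"
      using C unfolding height_def angle2_def by simp
    have "congruent x y x' y'" if "x - x' = 4 * p * t" "y - y' = 4 * s + 4 * y0 * t" for x' y' s t
      unfolding congruent_def that using C
      by (intro conjI dvd[of _ "s + 2 * y0 * t"] dvd[of _ "- t"]) (simp_all add: algebra_simps)
    then show ?thesis using odd_cosine_ratio(1)[OF xy] odd_cosine_ratio(2)[OF xy, of y0] unfolding h by blast
  qed
qed

text \<open>Both weights are at most 1: halves of the two meridians are points where one angle is 0 and the other one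
is \<open>\<plusminus>\<pi> / 2\<close>, and they have centred coordinates of absolute value at least 1, so that
\<open>two_cosines_le_1\<close> applies to them. Consequently points outside the square \<open>[-\<pi>/2, \<pi>/2]\<^sup>2\<close>, where a cosine is negative, stay
below 1.\<close>

lemma height_middle:
  assumes xy: "odd x" "odd y" and mid: "1 \<le> x0 \<and> 1 \<le> y0 \<and> 1 \<le> x1 \<and> 1 \<le> y1"
  shows "height x y \<le> 1 \<and>
    (height x y = 1 \<longrightarrow> (\<exists>x'\<in>{1, - 1}. \<exists>y'\<in>{1, - 1}. congruent x y x' y'))"
proof -
  have p0: "p \<noteq> 0" "0 < p" using p2 by auto
  note lt = lt_p[OF mid]
  have hp: "half_angle p p = pi / 2" by (rule half_angle_self[OF p0(1)])
  let ?A1 = "half_angle p y0" and ?B1 = "half_angle p x0" and ?A2 = "half_angle p y1" and ?B2 = "half_angle p x1"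
  have ang: "0 < ?A1" "0 < ?B1" "0 < ?A2" "0 < ?B2" using half_angle_pos[OF p0(2)] mid by auto
  have "0 < sA1" "0 < sB1" "0 < sA2" "0 < sB2" using half_angle_cos_sin_pos[of _ p] mid lt by auto
  then have w: "0 < weight1" "0 < weight2" using dets_pos by (simp_all add: weight1_def weight2_def)
  have small: "?A1 + ?B1 \<le> pi / 2" "?A2 + ?B2 \<le> pi / 2"
    using half_angle_le[OF p0(2), of "y0 + x0" p] half_angle_le[OF p0(2), of "y1 + x1" p] lt hp
    by (simp_all add: half_angle_add add.commute)
  have F1: "weight1 * cos (1 * ?A1 + 1 * ?B1) + weight2 * cos (1 * ?B2 - 1 * ?A2) = 1"
    "weight1 * cos (1 * ?A1 + (- 1) * ?B1) + weight2 * cos ((- 1) * ?B2 - 1 * ?A2) = 1"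
    using height_vertex[of 1 1] height_vertex[of 1 "- 1"]
    by (simp_all add: height_def angle1_expand angle2_expand)
  have bound: "height x y \<le> 1 \<and> (height x y = 1 \<longrightarrow> \<bar>x\<bar> = 1 \<and> \<bar>y\<bar> = 1)"
    if "1 \<le> \<bar>x\<bar>" "1 \<le> \<bar>y\<bar>" "\<bar>angle1 x y\<bar> \<le> pi / 2" "\<bar>angle2 x y\<bar> \<le> pi / 2" for x y
  proof -
    have r: "1 \<le> \<bar>real_of_int x\<bar>" "1 \<le> \<bar>real_of_int y\<bar>" using that by linarith+
    note t = two_cosines_le_1[OF w ang(1,2,3,4) small F1 r that(3,4)[unfolded angle1_expand angle2_expand]]
    have "\<bar>real_of_int x\<bar> = 1 \<longleftrightarrow> \<bar>x\<bar> = 1" "\<bar>real_of_int y\<bar> = 1 \<longleftrightarrow> \<bar>y\<bar> = 1" by linarith+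
    then show ?thesis using t unfolding height_def angle1_expand angle2_expand by blast
  qed
  have w1: "weight1 \<le> 1"
  proof -
    have "angle1 x0 (- y0) = 0" by (simp add: angle1_def half_angle_0)
    moreover have "cos (angle2 x0 (- y0)) = 0"
    proof -
      have "x1 * (- y0) - y1 * x0 = - p" using p_eq by (simp add: algebra_simps)
      moreover have "half_angle p (- p) = - (pi / 2)" using hp by (simp add: half_angle_def)
      ultimately show ?thesis unfolding angle2_def by (simp only: cos_minus cos_pi_half)
    qed
    moreover have "\<bar>angle2 x0 (- y0)\<bar> \<le> pi / 2"
    proof -
      have "\<bar>x1 * (- y0) - y1 * x0\<bar> = p" using p_eq p0 by (simp add: algebra_simps)
      then show ?thesis unfolding angle2_def half_angle_abs[OF p0(2)] using hp by simp
    qed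
    ultimately show ?thesis using bound[of x0 "- y0"] mid by (simp add: height_def)
  qed
  have w2: "weight2 \<le> 1"
  proof -
    have "angle2 x1 y1 = 0" by (simp add: angle2_def half_angle_0)
    moreover have "cos (angle1 x1 y1) = 0"
    proof -
      have "y0 * x1 + x0 * y1 = p" using p_eq by (simp add: algebra_simps)
      then show ?thesis unfolding angle1_def by (simp only: hp cos_pi_half)
    qed
    moreover have "\<bar>angle1 x1 y1\<bar> \<le> pi / 2"
    proof -
      have "\<bar>y0 * x1 + x0 * y1\<bar> = p" using p_eq p0 by (simp add: algebra_simps)
      then show ?thesis unfolding angle1_def half_angle_abs[OF p0(2)] using hp by simp
    qed
    ultimately show ?thesis using bound[of x1 y1] mid by (simp add: height_def)
  qed
  \<comment> \<open>Translating by twice a meridian changes one angle by \<open>2 \<pi>\<close> and fixes the other one.\<close>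
  obtain i where i: "\<bar>(y0 * x + x0 * y) - 4 * p * i\<bar> \<le> 2 * p" using residue_near_zero[OF p0(2)] .
  obtain j where j: "\<bar>(x1 * y - y1 * x) - 4 * p * j\<bar> \<le> 2 * p" using residue_near_zero[OF p0(2)] .
  define x' where "x' = x - 4 * x1 * i + 4 * x0 * j"
  define y' where "y' = y - 4 * y1 * i - 4 * y0 * j"
  have n1: "y0 * x' + x0 * y' = (y0 * x + x0 * y) - 4 * p * i"
    unfolding x'_def y'_def p_eq by (simp add: algebra_simps)
  have n2: "x1 * y' - y1 * x' = (x1 * y - y1 * x) - 4 * p * j"
    unfolding x'_def y'_def p_eq by (simp add: algebra_simps)
  have "y0 * (x - x') + x0 * (y - y') = 4 * p * i" "x1 * (y - y') - y1 * (x - x') = 4 * p * j"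
    using n1 n2 by (simp_all add: algebra_simps)
  then have cong: "congruent x y x' y'" by (simp add: congruent_def)
  have cosn: "cos (angle1 x' y') = cos (angle1 x y)" "cos (angle2 x' y') = cos (angle2 x y)"
    unfolding angle1_def angle2_def n1 n2 by (rule cos_half_angle_period[OF p0(1)])+
  then have hh: "height x' y' = height x y" by (simp add: height_def)
  have odd: "odd x'" "odd y'" using xy by (simp_all add: x'_def y'_def)
  then have ge1: "1 \<le> \<bar>x'\<bar>" "1 \<le> \<bar>y'\<bar>" by (cases "x' = 0"; cases "y' = 0"; simp)+
  have pi: "\<bar>half_angle p m\<bar> \<le> pi" if "\<bar>m\<bar> \<le> 2 * p" for m
    using half_angle_le[OF p0(2), of "\<bar>m\<bar>" "2 * p"] that half_angle_mult[of p 2 p] hp half_angle_abs[OF p0(2), of m]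
    by simp
  have le_pi: "\<bar>angle1 x' y'\<bar> \<le> pi" "\<bar>angle2 x' y'\<bar> \<le> pi"
    unfolding angle1_def angle2_def n1 n2 using pi i j by auto
  have cos_neg: "cos u < 0" if "\<bar>u\<bar> \<le> pi" "\<not> \<bar>u\<bar> \<le> pi / 2" for u :: real
  proof -
    have "cos \<bar>u\<bar> < cos (pi / 2)" using that by (intro cos_monotone_0_pi) auto
    then show ?thesis by simp
  qed
  have *: "a * cos u < 0" if "0 < a" "\<bar>u\<bar> \<le> pi" "\<not> \<bar>u\<bar> \<le> pi / 2" for a u :: real
    using cos_neg[OF that(2,3)] that(1) by (simp add: mult_pos_neg)
  have **: "a * cos u \<le> 1" if "a \<le> 1" "0 < a" for a u :: real
  proof -
    have "a * cos u \<le> a * 1" using that by (intro mult_left_mono) auto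
    then show ?thesis using that by linarith
  qed
  show ?thesis
  proof (cases "\<bar>angle1 x' y'\<bar> \<le> pi / 2 \<and> \<bar>angle2 x' y'\<bar> \<le> pi / 2")
    case True
    then have b: "height x' y' \<le> 1" "height x' y' = 1 \<longrightarrow> \<bar>x'\<bar> = 1 \<and> \<bar>y'\<bar> = 1" using bound[OF ge1] by auto
    show ?thesis
    proof (intro conjI impI)
      assume "height x y = 1"
      then have "x' \<in> {1, - 1}" "y' \<in> {1, - 1}" using b hh by auto
      then show "\<exists>x'\<in>{1, - 1}. \<exists>y'\<in>{1, - 1}. congruent x y x' y'" using cong by blast
    qed (use b hh in simp)
  next
    case False
    then have "height x' y' < 1"
      using *[OF w(1) le_pi(1)] *[OF w(2) le_pi(2)] **[OF w1 w(1), of "angle1 x' y'"] **[OF w2 w(2), of "angle2 x' y'"]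
      unfolding height_def by linarith
    then show ?thesis using hh by simp
  qed
qed

theorem height_le_1:
  assumes "odd x" "odd y"
  shows "height x y \<le> 1"
    and "height x y = 1 \<Longrightarrow> \<exists>x'\<in>{1, - 1}. \<exists>y'\<in>{1, - 1}. congruent x y x' y'"
  using height_cap[OF assms] height_middle[OF assms] by blast+

lemma independent_vertices:
  fixes c :: "int \<Rightarrow> int \<Rightarrow> real"
  assumes z: "(\<Sum>x\<in>{1, - 1}. \<Sum>y\<in>{1, - 1}. c x y *\<^sub>R cis (angle1 x y)) = 0"
    "(\<Sum>x\<in>{1, - 1}. \<Sum>y\<in>{1, - 1}. c x y *\<^sub>R cis (angle2 x y)) = 0"
    and x: "x \<in> {1, - 1}" "y \<in> {1, - 1}"
  shows "c x y = 0"
proof -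
  define a where "a = c 1 1 + c (- 1) (- 1)"
  define b where "b = c 1 (- 1) + c (- 1) 1"
  define a' where "a' = c 1 1 - c (- 1) (- 1)"
  define b' where "b' = c 1 (- 1) - c (- 1) 1"
  \<comment> \<open>Real parts involve only the even combinations of the coefficients, imaginary parts only the odd ones.\<close>
  have e1: "a * (cA1 * cB1 - sA1 * sB1) + b * (cA1 * cB1 + sA1 * sB1) = 0"
    using arg_cong[OF z(1), of Re] by (simp add: angle1_expand cos_add cos_diff a_def b_def algebra_simps)
  have e2: "a * (cA2 * cB2 + sA2 * sB2) + b * (cA2 * cB2 - sA2 * sB2) = 0"
    using arg_cong[OF z(2), of Re] by (simp add: angle2_expand cos_add cos_diff a_def b_def algebra_simps)
  have o1: "a' * (sA1 * cB1 + cA1 * sB1) + b' * (sA1 * cB1 - cA1 * sB1) = 0"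
    using arg_cong[OF z(1), of Im] by (simp add: angle1_expand sin_add sin_diff a'_def b'_def algebra_simps)
  have o2: "a' * (sB2 * cA2 - cB2 * sA2) - b' * (sB2 * cA2 + cB2 * sA2) = 0"
    using arg_cong[OF z(2), of Im] by (simp add: angle2_expand sin_add sin_diff a'_def b'_def algebra_simps)
  have "2 * even_det * a = - (a * (cA1 * cB1 - sA1 * sB1) + b * (cA1 * cB1 + sA1 * sB1)) * (cA2 * cB2 - sA2 * sB2)
      + (a * (cA2 * cB2 + sA2 * sB2) + b * (cA2 * cB2 - sA2 * sB2)) * (cA1 * cB1 + sA1 * sB1)"
    by (simp add: even_det_def algebra_simps)
  then have a0: "a = 0" unfolding e1 e2 using dets_pos by simp
  have "2 * even_det * b = (a * (cA1 * cB1 - sA1 * sB1) + b * (cA1 * cB1 + sA1 * sB1)) * (cA2 * cB2 + sA2 * sB2)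
      - (a * (cA2 * cB2 + sA2 * sB2) + b * (cA2 * cB2 - sA2 * sB2)) * (cA1 * cB1 - sA1 * sB1)"
    by (simp add: even_det_def algebra_simps)
  then have b0: "b = 0" unfolding e1 e2 using dets_pos by simp
  have "2 * odd_det * a' = (a' * (sA1 * cB1 + cA1 * sB1) + b' * (sA1 * cB1 - cA1 * sB1)) * (sB2 * cA2 + cB2 * sA2)
      + (a' * (sB2 * cA2 - cB2 * sA2) - b' * (sB2 * cA2 + cB2 * sA2)) * (sA1 * cB1 - cA1 * sB1)"
    by (simp add: odd_det_def algebra_simps)
  then have a'0: "a' = 0" unfolding o1 o2 using dets_pos by simp
  have "2 * odd_det * b' = (a' * (sA1 * cB1 + cA1 * sB1) + b' * (sA1 * cB1 - cA1 * sB1)) * (sB2 * cA2 - cB2 * sA2)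
      - (a' * (sB2 * cA2 - cB2 * sA2) - b' * (sB2 * cA2 + cB2 * sA2)) * (sA1 * cB1 + cA1 * sB1)"
    by (simp add: odd_det_def algebra_simps)
  then have b'0: "b' = 0" unfolding o1 o2 using dets_pos by simp
  have "c 1 1 = 0" "c (- 1) (- 1) = 0" "c 1 (- 1) = 0" "c (- 1) 1 = 0"
    using a0 a'0 b0 b'0 unfolding a_def a'_def b_def b'_def by linarith+
  then show ?thesis using x by auto
qed

end


section \<open>Lattice parallelograms as tetrahedra in the sphere\<close>

text \<open>The powers of a primitive root of unity of order \<open>2 p\<close>.\<close>

definition root_of :: "int \<Rightarrow> int \<Rightarrow> complex" where
  "root_of p m = cis (pi * of_int m / of_int p)"

lemma root_of_add: "root_of p (m + n) = root_of p m * root_of p n"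
  by (simp add: root_of_def cis_mult add_divide_distrib distrib_left)

lemma root_of_eq_iff:
  assumes "p \<noteq> 0"
  shows "root_of p m = root_of p n \<longleftrightarrow> 2 * p dvd m - n"
proof -
  have one: "root_of p k = 1 \<longleftrightarrow> 2 * p dvd k" for k
  proof
    assume "root_of p k = 1"
    then have "cos (pi * of_int k / of_int p) = 1"
      by (simp add: root_of_def complex_eq_iff)
    then obtain j :: int where "pi * of_int k / of_int p = of_int j * 2 * pi"
      using cos_one_2pi_int by blast
    then have "of_int k = (of_int (2 * p * j) :: real)" using assms by (simp add: field_simps)
    then show "2 * p dvd k" unfolding of_int_eq_iff by simp
  next
    assume "2 * p dvd k"
    then obtain j where "k = 2 * p * j" ..
    then have "root_of p k = cis (2 * pi * of_int j)" using assms by (simp add: root_of_def field_simps)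
    then show "root_of p k = 1" by simp
  qed
  have "root_of p m = root_of p (m - n) * root_of p n" by (simp flip: root_of_add)
  moreover have "root_of p n \<noteq> 0" by (simp add: root_of_def)
  ultimately show ?thesis using one[of "m - n"] by auto
qed

type_synonym point = "int \<times> int"

definition cross :: "point \<Rightarrow> point \<Rightarrow> int" where
  "cross u v = fst u * snd v - snd u * fst v"

definition label :: "point \<Rightarrow> nat" where
  "label u = nat (fst u mod 2 + 2 * (snd u mod 2))"

lemma label_le: "label u \<le> 3"
  by (simp add: label_def)

lemma label_eq_iff: "label u = label v \<longleftrightarrow> even (fst u - fst v) \<and> even (snd u - snd v)"
proof -
  have "nat (fst u mod 2 + 2 * (snd u mod 2)) = nat (fst v mod 2 + 2 * (snd v mod 2)) \<longleftrightarrow>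
      fst u mod 2 + 2 * (snd u mod 2) = fst v mod 2 + 2 * (snd v mod 2)"
    by (intro eq_nat_nat_iff) simp_all
  moreover have "x mod 2 + 2 * (y mod 2) = x' mod 2 + 2 * (y' mod 2) \<longleftrightarrow> even (x - x') \<and> even (y - y')"
    for x y x' y' :: int
    by (cases "even x"; cases "even y"; cases "even x'"; cases "even y'"; simp add: mod_2_eq_odd)
  ultimately show ?thesis by (simp only: label_def)
qed

definition quad :: "point \<Rightarrow> point \<Rightarrow> point \<Rightarrow> point set" where
  "quad P a b = {P, P + a, P + b, P + a + b}"

lemma quad_swap: "quad P b a = quad P a b"
  by (auto simp: quad_def ac_simps)

lemma odd_cross_parity:
  assumes "odd (cross a b)"
  shows "odd (fst a) \<or> odd (snd a)" "odd (fst b) \<or> odd (snd b)"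
    "odd (fst a + fst b) \<or> odd (snd a + snd b)" "odd (fst a - fst b) \<or> odd (snd a - snd b)"
  using assms by (auto simp: cross_def)

text \<open>Differences of vertices are \<open>\<plusminus>a\<close>, \<open>\<plusminus>b\<close>, \<open>\<plusminus>(a + b)\<close>, \<open>\<plusminus>(a - b)\<close>, none of which is divisible by 2 when the determinant is odd.\<close>

lemma label_quad:
  assumes "odd (cross a b)"
  shows "inj_on label (quad P a b)" and "label ` quad P a b = {..3}"
proof -
  have d: "label P \<noteq> label (P + a)" "label P \<noteq> label (P + b)" "label P \<noteq> label (P + a + b)"
    "label (P + a) \<noteq> label (P + b)" "label (P + a) \<noteq> label (P + a + b)" "label (P + b) \<noteq> label (P + a + b)"
    unfolding label_eq_iff using odd_cross_parity[OF assms] by auto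
  show "inj_on label (quad P a b)" unfolding quad_def inj_on_def by (simp add: d d[THEN not_sym])
  have "label ` quad P a b \<subseteq> {..3}" using label_le by auto
  moreover have "card (label ` quad P a b) = 4" unfolding quad_def using d by simp
  ultimately show "label ` quad P a b = {..3}" by (intro card_subset_eq) auto
qed

locale torus_lattice =
  fixes p r :: int
  assumes p_ge_2: "2 \<le> p"
begin

definition embed :: "point \<Rightarrow> complex \<times> complex" where
  "embed u = (root_of p (snd u), root_of p (r * snd u - p * fst u))"

lemma embed_add: "embed (u + v) = (fst (embed u) * fst (embed v), snd (embed u) * snd (embed v))"
proof -
  have "r * snd (u + v) - p * fst (u + v) = (r * snd u - p * fst u) + (r * snd v - p * fst v)"
    by (simp add: algebra_simps)
  then show ?thesis by (simp add: embed_def root_of_add[symmetric])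
qed

lemma embed_eq_iff:
  "embed u = embed v \<longleftrightarrow> 2 * p dvd snd u - snd v \<and>
     2 * p dvd r * (snd u - snd v) - p * (fst u - fst v)"
  using p_ge_2 by (simp add: embed_def root_of_eq_iff algebra_simps)

text \<open>The lattice of trivial translations is spanned by \<open>(2, 0)\<close> and \<open>(2 r, 2 p)\<close>, which are even.\<close>

lemma embed_eq_parity:
  assumes "embed u = embed v"
  shows "label u = label v"
proof -
  obtain k where k: "snd u - snd v = 2 * p * k" using assms embed_eq_iff by (auto elim!: dvdE)
  obtain j where "r * (snd u - snd v) - p * (fst u - fst v) = 2 * p * j"
    using assms embed_eq_iff by (auto elim!: dvdE)
  then have "p * (fst u - fst v) = p * (2 * (r * k - j))" using k by (simp add: algebra_simps)
  then have "fst u - fst v = 2 * (r * k - j)" using p_ge_2 by simp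
  then show ?thesis using k by (simp add: label_eq_iff)
qed

lemma embed_translate: "embed u = embed v \<Longrightarrow> embed (u + z) = embed (v + z)"
  by (simp add: embed_add)

lemma embed_meridians: "embed (u + (2, 0)) = embed u" "embed (u + (2 * r, 2 * p)) = embed u"
  by (simp_all add: embed_eq_iff algebra_simps)

lemma embed_fundamental:
  obtains v where "v \<in> {0, 1} \<times> {0..<2 * p}" "embed u = embed v"
proof -
  define k where "k = snd u div (2 * p)"
  define x where "x = fst u - 2 * r * k"
  define v where "v = (x mod 2, snd u mod (2 * p))"
  have "v \<in> {0, 1} \<times> {0..<2 * p}" using p_ge_2 by (auto simp: v_def)
  moreover have "embed u = embed v"
  proof -
    have s: "snd u - snd v = 2 * p * k" by (simp add: v_def k_def minus_mod_eq_mult_div)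
    have "fst u - fst v = 2 * (x div 2) + 2 * r * k"
      using minus_mod_eq_mult_div[of x 2] by (simp add: v_def x_def)
    then have "r * (snd u - snd v) - p * (fst u - fst v) = 2 * p * (- (x div 2))"
      using s by (simp add: algebra_simps)
    then show ?thesis using s unfolding embed_eq_iff by (metis dvd_triv_left)
  qed
  ultimately show thesis by (rule that)
qed

definition facet :: "point \<Rightarrow> point \<Rightarrow> point \<Rightarrow> nat \<Rightarrow> complex \<times> complex" where
  "facet P a b i = (if i \<le> 3 then embed (THE u. u \<in> quad P a b \<and> label u = i) else 0)"

lemma facet_label:
  assumes "odd (cross a b)" "u \<in> quad P a b"
  shows "facet P a b (label u) = embed u"
proof -
  have "(THE v. v \<in> quad P a b \<and> label v = label u) = u"
    using assms label_quad(1)[OF assms(1), of P] by (intro the_equality) (auto dest: inj_onD)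
  then show ?thesis by (simp add: facet_def label_le)
qed

lemma facet_above: "3 < i \<Longrightarrow> facet P a b i = 0"
  by (simp add: facet_def)

lemma facet_vertex:
  assumes "odd (cross a b)" "i \<le> 3"
  obtains u where "u \<in> quad P a b" "label u = i" "facet P a b i = embed u"
proof -
  have "i \<in> label ` quad P a b" using label_quad(2)[OF assms(1)] assms(2) by simp
  then obtain u where "u \<in> quad P a b" "label u = i" by auto
  then show thesis using that facet_label[OF assms(1)] by blast
qed

lemma facet_eqI:
  assumes "odd (cross a b)" "\<And>i. 3 < i \<Longrightarrow> f i = 0" "\<And>u. u \<in> quad P a b \<Longrightarrow> f (label u) = embed u"
  shows "facet P a b = f"
proof
  fix i show "facet P a b i = f i"
  proof (cases "i \<le> 3")
    case True
    then obtain u where "u \<in> quad P a b" "label u = i" "facet P a b i = embed u"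
      using facet_vertex[OF assms(1)] by blast
    then show ?thesis using assms(3) by metis
  qed (use assms(2) facet_above in simp)
qed

lemma facet_swap: "facet P b a = facet P a b"
  by (simp add: facet_def quad_swap fun_eq_iff)

lemma facet_cong:
  assumes "odd (cross a b)" "embed P = embed P'"
  shows "facet P a b = facet P' a b"
proof (rule facet_eqI[OF assms(1) facet_above])
  fix u assume u: "u \<in> quad P a b"
  define z where "z = u - P"
  have z: "u = P + z" "P' + z \<in> quad P' a b"
    using u by (auto simp: z_def quad_def algebra_simps)
  have "embed u = embed (P' + z)" unfolding z using assms(2) by (rule embed_translate)
  then show "facet P' a b (label u) = embed u"
    using facet_label[OF assms(1) z(2)] embed_eq_parity by metis
qed

text \<open>When twice a side acts trivially, translation by this side only permutes the points spanning the tetrahedron.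
This is the folding at the ends of a Farey path.\<close>

lemma facet_shift:
  assumes odd: "odd (cross a b)" and per: "embed (P + a + a) = embed P"
  shows "facet P a b = facet (P + a) a b"
proof (rule facet_eqI[OF odd facet_above])
  fix u assume u: "u \<in> quad P a b"
  have "\<exists>v\<in>quad (P + a) a b. embed v = embed u"
  proof -
    have "embed (P + a + a + b) = embed (P + b)" using embed_translate[OF per] .
    moreover have "P + a + a + b = P + a + a + b" "P + a + b \<in> quad (P + a) a b" "P + a \<in> quad (P + a) a b"
      "P + a + a \<in> quad (P + a) a b" "P + a + a + b \<in> quad (P + a) a b"
      by (auto simp: quad_def)
    ultimately show ?thesis using u per unfolding quad_def[of P] by auto
  qed
  then obtain v where "v \<in> quad (P + a) a b" "embed v = embed u" by blast
  then show "facet (P + a) a b (label u) = embed u"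
    using facet_label[OF odd] embed_eq_parity by metis
qed

lemma shared_face:
  assumes odd: "odd (cross a b)" "odd (cross a' b')"
    and u: "u \<in> quad P a b" "u' \<in> quad P' a' b'" "label u' = label u"
    and sub: "quad P a b - {u} \<subseteq> quad P' a' b'" and ne: "embed u' \<noteq> embed u"
  shows "facet P' a' b' (label u) \<noteq> facet P a b (label u)"
    and "k \<le> 3 \<Longrightarrow> k \<noteq> label u \<Longrightarrow> facet P' a' b' k = facet P a b k"
proof -
  show "facet P' a' b' (label u) \<noteq> facet P a b (label u)"
    using facet_label[OF odd(1) u(1)] facet_label[OF odd(2) u(2)] u(3) ne by simp
  assume k: "k \<le> 3" "k \<noteq> label u"
  obtain v where v: "v \<in> quad P a b" "label v = k" "facet P a b k = embed v"
    using facet_vertex[OF odd(1) k(1)] by blast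
  then have "v \<in> quad P' a' b'" using sub k(2) by blast
  then show "facet P' a' b' k = facet P a b k" using facet_label[OF odd(2)] v by metis
qed

lemma embed_ne:
  assumes "0 < snd c" "snd c < p"
  shows "embed (u + c + c) \<noteq> embed u" "embed u \<noteq> embed (u + c + c)"
proof -
  have "\<not> p dvd snd c" using assms zdvd_not_zless by blast
  then have "\<not> 2 * p dvd snd (u + c + c) - snd u" by (simp add: mult_2[symmetric] dvd_mult_cancel_left)
  then show "embed (u + c + c) \<noteq> embed u" using embed_eq_iff by blast
  then show "embed u \<noteq> embed (u + c + c)" by metis
qed

abbreviation "opposes \<equiv> adjacent_facets 3"

text \<open>Parallelograms with sides \<open>a\<close>, \<open>b\<close> and those with sides \<open>a\<close>, \<open>a + b\<close> have the triangles with edges \<open>a\<close>, \<open>b\<close>,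
\<open>a + b\<close> in common; the opposite vertices in the two tetrahedra differ by \<open>2 a\<close>. The bounds on \<open>a\<close> say that
this difference acts nontrivially.\<close>

lemma layer_interface:
  assumes odd: "odd (cross a b)" and c: "0 < snd a" "snd a < p"
  shows "opposes (label (P + b)) (facet P a b) (facet P a (a + b))"
    and "opposes (label (P + a)) (facet P a b) (facet (P - a) a (a + b))"
    and "opposes (label P) (facet P a (a + b)) (facet (P + a) a b)"
    and "opposes (label (P + a + (a + b))) (facet P a (a + b)) (facet P a b)"
proof -
  have odd': "odd (cross a (a + b))" using odd by (simp add: cross_def algebra_simps)
  have s: "P + a + (a + b) = P + b + a + a" "P - a + a = P" by (simp_all add: algebra_simps)
  show "opposes (label (P + b)) (facet P a b) (facet P a (a + b))"
    unfolding adjacent_facets_def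
    using shared_face[OF odd odd', of "P + b" P "P + a + (a + b)" P] embed_ne(1)[OF c, of "P + b"]
    by (auto simp: quad_def s label_eq_iff algebra_simps)
  show "opposes (label (P + a)) (facet P a b) (facet (P - a) a (a + b))"
    unfolding adjacent_facets_def
    using shared_face[OF odd odd', of "P + a" P "P - a" "P - a"] embed_ne(2)[OF c, of "P - a"]
    by (auto simp: quad_def s label_eq_iff algebra_simps)
  show "opposes (label P) (facet P a (a + b)) (facet (P + a) a b)"
    unfolding adjacent_facets_def
    using shared_face[OF odd' odd, of P P "P + a + a" "P + a"] embed_ne(1)[OF c, of P]
    by (auto simp: quad_def label_eq_iff algebra_simps)
  show "opposes (label (P + a + (a + b))) (facet P a (a + b)) (facet P a b)"
    unfolding adjacent_facets_def
    using shared_face[OF odd' odd, of "P + a + (a + b)" P "P + b" P] embed_ne(2)[OF c, of "P + b"]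
    by (auto simp: quad_def s label_eq_iff algebra_simps)
qed

end


section \<open>Farey paths and lens spaces\<close>

text \<open>A Farey path as a sequence of bases; a word in two letters selects the vector that is replaced by the
sum.\<close>

fun frame :: "(nat \<Rightarrow> bool) \<Rightarrow> nat \<Rightarrow> point \<times> point" where
  "frame D 0 = ((1, 0), (0, 1))"
| "frame D (Suc l) = (let (a, b) = frame D l in if D l then (a + b, b) else (a, a + b))"

text \<open>The first step must discard \<open>(1, 0)\<close>, which is the meridian at this end of the path.\<close>

locale lens_word =
  fixes D :: "nat \<Rightarrow> bool" and N :: nat
  assumes D0: "D 0" and N2: "2 \<le> N"
begin

definition fa :: "nat \<Rightarrow> point" where "fa l = fst (frame D l)"
definition fb :: "nat \<Rightarrow> point" where "fb l = snd (frame D l)"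

lemma frame_0: "fa 0 = (1, 0)" "fb 0 = (0, 1)"
  by (simp_all add: fa_def fb_def)

lemma frame_Suc: "fa (Suc l) = (if D l then fa l + fb l else fa l)"
  "fb (Suc l) = (if D l then fb l else fa l + fb l)"
  by (simp_all add: fa_def fb_def Let_def case_prod_beta)

lemma frame_1: "fa 1 = (1, 1)" "fb 1 = (0, 1)"
  using frame_Suc[of 0] D0 by (simp_all add: frame_0)

text \<open>The vector created by the last step; it is the meridian at the other end.\<close>

definition slope :: point where "slope = fa (N - 1) + fb (N - 1)"

abbreviation "p \<equiv> snd slope"
abbreviation "r \<equiv> fst slope"

lemma cross_frame: "cross (fa l) (fb l) = 1"
proof (induction l)
  case 0
  show ?case by (simp add: frame_0 cross_def)
next
  case (Suc l)
  then show ?case by (simp add: frame_Suc cross_def algebra_simps)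
qed

lemma snd_frame_pos: "1 \<le> snd (fa (Suc l)) \<and> 1 \<le> snd (fb (Suc l))"
proof (induction l)
  case 0
  show ?case using frame_1 by simp
next
  case (Suc l)
  then show ?case by (simp add: frame_Suc[of "Suc l"])
qed

lemma snd_frame: "0 \<le> snd (fa l)" "1 \<le> snd (fb l)"
  using snd_frame_pos by (cases l; simp add: frame_0 less_imp_le order_trans[OF zero_le_one])+

text \<open>Coordinates of the slope with respect to the basis of layer \<open>l\<close>. Going backwards along the path they only
grow, which gives their positivity.\<close>

definition x1 :: "nat \<Rightarrow> int" where "x1 l = cross slope (fb l)"
definition y1 :: "nat \<Rightarrow> int" where "y1 l = cross (fa l) slope"

lemma slope_coords_Suc:
  "x1 l = (if D l then x1 (Suc l) else x1 (Suc l) + y1 (Suc l))"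
  "y1 l = (if D l then x1 (Suc l) + y1 (Suc l) else y1 (Suc l))"
  by (simp_all add: x1_def y1_def frame_Suc cross_def algebra_simps)

lemma slope_coords_last: "x1 (N - 1) = 1" "y1 (N - 1) = 1"
  using cross_frame[of "N - 1"] by (simp_all add: x1_def y1_def slope_def cross_def algebra_simps)

lemma slope_coords_pos: "l \<le> N - 1 \<Longrightarrow> 1 \<le> x1 l \<and> 1 \<le> y1 l"
proof (induction l rule: inc_induct)
  case base
  show ?case using slope_coords_last by simp
next
  case (step l)
  then show ?case using slope_coords_Suc[of l] by simp
qed

lemma slope_coords_end: "D (N - 1) \<Longrightarrow> x1 N = 1 \<and> y1 N = 0" "\<not> D (N - 1) \<Longrightarrow> x1 N = 0 \<and> y1 N = 1"
  using slope_coords_Suc[of "N - 1"] slope_coords_last N2 by (simp_all add: Suc_diff_Suc numeral_2_eq_2)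

lemma p_sum: "p = snd (fb l) * y1 l + snd (fa l) * x1 l"
proof -
  have "snd (fb l) * y1 l + snd (fa l) * x1 l = p * cross (fa l) (fb l)"
    by (simp add: x1_def y1_def cross_def algebra_simps)
  then show ?thesis using cross_frame by simp
qed

lemma p_ge_2': "2 \<le> p"
proof -
  have "N - 1 = Suc (N - 2)" using N2 by simp
  then show ?thesis using snd_frame_pos[of "N - 2"] by (simp add: slope_def)
qed

sublocale torus_lattice p r
  by unfold_locales (rule p_ge_2')

lemma frame_end: "D (N - 1) \<Longrightarrow> fa N = slope \<and> fb N = fb (N - 1)"
  "\<not> D (N - 1) \<Longrightarrow> fb N = slope \<and> fa N = fa (N - 1)"
  using frame_Suc[of "N - 1"] N2 by (simp_all add: slope_def)

lemma lattice_square: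
  assumes "l \<le> N"
  shows "lattice_square p (snd (fb l)) (snd (fa l)) (x1 l) (y1 l)"
proof
  have last: "Suc (N - 2) = N - 1" using N2 by simp
  have ends: "1 \<le> snd (fa (N - 1))" "snd (fa (N - 1)) < p" "1 \<le> snd (fb (N - 1))" "snd (fb (N - 1)) < p"
    using snd_frame_pos[of "N - 2"] unfolding last slope_def by simp_all
  show "2 \<le> p" by (rule p_ge_2')
  show "p = snd (fb l) * y1 l + snd (fa l) * x1 l" by (rule p_sum)
  consider "l = 0" | "1 \<le> l" "l \<le> N - 1" | "l = N" using assms by linarith
  then have "0 \<le> x1 l \<and> 0 \<le> y1 l \<and>
    ((1 \<le> snd (fb l) \<and> 1 \<le> snd (fa l) \<and> 1 \<le> x1 l \<and> 1 \<le> y1 l) \<or>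
     (snd (fa l) = 0 \<and> snd (fb l) = 1 \<and> 1 \<le> x1 l \<and> x1 l < p) \<or>
     (y1 l = 0 \<and> x1 l = 1 \<and> 1 \<le> snd (fb l) \<and> snd (fb l) < p) \<or>
     (x1 l = 0 \<and> y1 l = 1 \<and> 1 \<le> snd (fa l) \<and> snd (fa l) < p))"
  proof cases
    case 1
    have "y1 1 = p - r" "x1 0 = r" using frame_1 by (simp_all add: x1_def y1_def cross_def frame_0)
    moreover have "1 \<le> N - 1" using N2 by simp
    ultimately show ?thesis using 1 slope_coords_pos[of 0] slope_coords_pos[of 1] by (simp add: frame_0)
  next
    case 2
    then show ?thesis using slope_coords_pos[of l] snd_frame_pos[of "l - 1"] by simp
  next
    case 3
    then show ?thesis using slope_coords_end frame_end ends by (cases "D (N - 1)") simp_all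
  qed
  then show "0 \<le> x1 l" "0 \<le> y1 l"
    "(1 \<le> snd (fb l) \<and> 1 \<le> snd (fa l) \<and> 1 \<le> x1 l \<and> 1 \<le> y1 l) \<or>
     (snd (fa l) = 0 \<and> snd (fb l) = 1 \<and> 1 \<le> x1 l \<and> x1 l < p) \<or>
     (y1 l = 0 \<and> x1 l = 1 \<and> 1 \<le> snd (fb l) \<and> snd (fb l) < p) \<or>
     (x1 l = 0 \<and> y1 l = 1 \<and> 1 \<le> snd (fa l) \<and> snd (fa l) < p)" by blast+
  show "0 \<le> snd (fb l)" "0 \<le> snd (fa l)" using snd_frame[of l] by auto
qed


definition centre1 :: "point \<Rightarrow> nat \<Rightarrow> complex" where
  "centre1 P l = cis (half_angle p (2 * snd P + snd (fa l) + snd (fb l)))"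
definition centre2 :: "point \<Rightarrow> nat \<Rightarrow> complex" where
  "centre2 P l = cis (half_angle p (2 * (r * snd P - p * fst P) + x1 l - y1 l))"

text \<open>The lattice point with odd centred coordinates \<open>(x, y)\<close>, for which the vertices are \<open>(\<plusminus>1, \<plusminus>1)\<close>.\<close>

definition centred :: "point \<Rightarrow> nat \<Rightarrow> int \<Rightarrow> int \<Rightarrow> point" where
  "centred P l x y = (fst P + ((x + 1) div 2) * fst (fa l) + ((y + 1) div 2) * fst (fb l),
     snd P + ((x + 1) div 2) * snd (fa l) + ((y + 1) div 2) * snd (fb l))"

lemma centred_vertices:
  "centred P l (- 1) (- 1) = P" "centred P l 1 (- 1) = P + fa l"
  "centred P l (- 1) 1 = P + fb l" "centred P l 1 1 = P + fa l + fb l"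
  by (simp_all add: centred_def prod_eq_iff)

lemma quad_centred: "quad P (fa l) (fb l) = (\<lambda>(x, y). centred P l x y) ` ({1, - 1} \<times> {1, - 1})"
  by (auto simp: quad_def centred_vertices)

lemma centred_exists:
  obtains x y where "odd x" "odd y" "w = centred P l x y"
proof -
  define X where "X = cross (w - P) (fb l)"
  define Y where "Y = cross (fa l) (w - P)"
  have c: "fst (fa l) * snd (fb l) = 1 + snd (fa l) * fst (fb l)"
    using cross_frame[of l] by (simp add: cross_def)
  have "fst P + X * fst (fa l) + Y * fst (fb l) = fst P + (fst w - fst P) * cross (fa l) (fb l)"
    "snd P + X * snd (fa l) + Y * snd (fb l) = snd P + (snd w - snd P) * cross (fa l) (fb l)"
    unfolding X_def Y_def by (simp_all add: cross_def algebra_simps)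
  then have "w = (fst P + X * fst (fa l) + Y * fst (fb l), snd P + X * snd (fa l) + Y * snd (fb l))"
    using cross_frame[of l] by (simp add: prod_eq_iff)
  then have "w = centred P l (2 * X - 1) (2 * Y - 1)" by (simp add: centred_def)
  moreover have "odd (2 * X - 1)" "odd (2 * Y - 1)" by simp_all
  ultimately show thesis using that by blast
qed

lemma root_of_half_angle: "root_of p m = cis (half_angle p (2 * m))"
  by (simp add: root_of_def half_angle_def)

context
  fixes l assumes l: "l \<le> N"
begin

interpretation S: lattice_square p "snd (fb l)" "snd (fa l)" "x1 l" "y1 l"
  by (rule lattice_square[OF l])

lemma embed_centred:
  assumes "odd x" "odd y"
  shows "embed (centred P l x y) = (centre1 P l * cis (S.angle1 x y), centre2 P l * cis (S.angle2 x y))"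
proof -
  from assms(1) obtain j where "x = 2 * j + 1" by (rule oddE)
  moreover from assms(2) obtain k where "y = 2 * k + 1" by (rule oddE)
  moreover define X Y where "X = j + 1" and "Y = k + 1"
  ultimately have XY: "x = 2 * X - 1" "y = 2 * Y - 1" by simp_all
  have a: "r * snd (fa l) - p * fst (fa l) = - y1 l" "r * snd (fb l) - p * fst (fb l) = x1 l"
    by (simp_all add: x1_def y1_def cross_def algebra_simps)
  have "2 * snd (centred P l x y) = (2 * snd P + snd (fa l) + snd (fb l)) + (snd (fa l) * x + snd (fb l) * y)"
    by (simp add: centred_def XY algebra_simps)
  moreover have "r * snd (centred P l x y) - p * fst (centred P l x y) =
      (r * snd P - p * fst P) + X * (r * snd (fa l) - p * fst (fa l)) + Y * (r * snd (fb l) - p * fst (fb l))"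
    by (simp add: centred_def XY algebra_simps)
  then have "2 * (r * snd (centred P l x y) - p * fst (centred P l x y)) =
      (2 * (r * snd P - p * fst P) + x1 l - y1 l) + (x1 l * y - y1 l * x)"
    unfolding a by (simp add: XY algebra_simps)
  ultimately show ?thesis
    by (simp add: embed_def root_of_half_angle centre1_def centre2_def S.angle1_def S.angle2_def
        half_angle_add cis_mult)
qed

definition normal :: "point \<Rightarrow> complex \<times> complex" where
  "normal P = (S.weight1 *\<^sub>R centre1 P l, S.weight2 *\<^sub>R centre2 P l)"

lemma inner_unit: "inner (c *\<^sub>R cis t) (cis t * cis u) = c * cos u"
proof -
  have "inner (cis t) (cis t * cis u) = cos (t + u - t)"
    unfolding cos_diff by (simp add: inner_complex_def cis_mult mult.commute)
  then show ?thesis by simp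
qed

lemma inner_normal:
  "odd x \<Longrightarrow> odd y \<Longrightarrow> inner (normal P) (embed (centred P l x y)) = S.height x y"
proof -
  assume xy: "odd x" "odd y"
  show ?thesis
    unfolding embed_centred[OF xy] normal_def inner_prod_def fst_conv snd_conv centre1_def centre2_def
      inner_unit S.height_def ..
qed

lemma embed_congruent:
  assumes "odd x" "odd y" "odd x'" "odd y'" "S.congruent x y x' y'"
  shows "embed (centred P l x y) = embed (centred P l x' y')"
proof -
  have cis4: "cis (half_angle p m) = cis (half_angle p n)" if mn: "4 * p dvd m - n" for m n
  proof -
    from mn obtain k where "m - n = 4 * p * k" by (rule dvdE)
    then have "half_angle p m = half_angle p n + 2 * pi * of_int k"
      using half_angle_period[of p k] p_ge_2 half_angle_diff[of p m n] by simp
    then show ?thesis by (simp add: cis_mult[symmetric])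
  qed
  have "cis (S.angle1 x y) = cis (S.angle1 x' y')" "cis (S.angle2 x y) = cis (S.angle2 x' y')"
    using assms(5) unfolding S.congruent_def S.angle1_def S.angle2_def
    by (auto intro!: cis4 simp: algebra_simps)
  then show ?thesis using embed_centred assms by simp
qed

lemma facet_support:
  "\<forall>u\<in>quad P (fa l) (fb l). inner (normal P) (embed u) = 1"
  "inner (normal P) (embed w) \<le> 1"
  "inner (normal P) (embed w) = 1 \<Longrightarrow> \<exists>u\<in>quad P (fa l) (fb l). embed w = embed u"
proof -
  show "\<forall>u\<in>quad P (fa l) (fb l). inner (normal P) (embed u) = 1"
    unfolding quad_centred using inner_normal S.height_vertex by auto
  obtain x y where xy: "odd x" "odd y" "w = centred P l x y" by (rule centred_exists)
  then have h: "inner (normal P) (embed w) = S.height x y" using inner_normal by simp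
  show "inner (normal P) (embed w) \<le> 1" using h S.height_le_1(1)[OF xy(1,2)] by simp
  assume "inner (normal P) (embed w) = 1"
  then obtain x' y' where x': "x' \<in> {1, - 1}" "y' \<in> {1, - 1}" "S.congruent x y x' y'"
    using h S.height_le_1(2)[OF xy(1,2)] by auto
  moreover have "odd x'" "odd y'" using x'(1,2) by auto
  ultimately have "embed w = embed (centred P l x' y')"
    using embed_congruent[OF xy(1,2)] xy(3) by simp
  moreover have "centred P l x' y' \<in> quad P (fa l) (fb l)" unfolding quad_centred using x' by auto
  ultimately show "\<exists>u\<in>quad P (fa l) (fb l). embed w = embed u" by blast
qed

lemma odd_cross_frame: "odd (cross (fa l) (fb l))"
  by (simp add: cross_frame)

lemma facet_independent:
  assumes z: "(\<Sum>i\<le>3. c i *\<^sub>R facet P (fa l) (fb l) i) = 0" and i: "i \<le> 3"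
  shows "c i = 0"
proof -
  let ?Q = "quad P (fa l) (fb l)" and ?v = "\<lambda>x y. centred P l x y"
  note inj = label_quad(1)[OF odd_cross_frame] and im = label_quad(2)[OF odd_cross_frame]
  define c' where "c' = (\<lambda>x y. c (label (?v x y)))"
  have "inj_on (\<lambda>(x, y). ?v x y) ({1, - 1} \<times> {1, - 1})"
  proof (rule eq_card_imp_inj_on)
    have "card ?Q = card {..3::nat}" using card_image[OF inj] im by metis
    then show "card ((\<lambda>(x, y). ?v x y) ` ({1, - 1} \<times> {1, - 1})) = card ({1, - 1::int} \<times> {1, - 1::int})"
      by (simp add: quad_centred)
  qed simp
  then have "(\<Sum>(x, y)\<in>{1, - 1} \<times> {1, - 1}. c' x y *\<^sub>R embed (?v x y)) = (\<Sum>u\<in>?Q. c (label u) *\<^sub>R embed u)"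
    unfolding quad_centred by (subst sum.reindex) (auto simp: c'_def case_prod_beta)
  also have "\<dots> = (\<Sum>u\<in>?Q. c (label u) *\<^sub>R facet P (fa l) (fb l) (label u))"
    using facet_label[OF odd_cross_frame] by simp
  also have "\<dots> = (\<Sum>i\<in>label ` ?Q. c i *\<^sub>R facet P (fa l) (fb l) i)"
    by (subst sum.reindex[OF inj]) simp
  also have "\<dots> = 0" using z im by simp
  finally have s: "(\<Sum>x\<in>{1, - 1}. \<Sum>y\<in>{1, - 1}. c' x y *\<^sub>R embed (?v x y)) = 0"
    by (simp only: sum.cartesian_product)
  have e: "(\<Sum>x\<in>{1, - 1}. \<Sum>y\<in>{1, - 1}. c' x y *\<^sub>R embed (?v x y)) =
      (\<Sum>x\<in>{1, - 1}. \<Sum>y\<in>{1, - 1}. c' x y *\<^sub>R (centre1 P l * cis (S.angle1 x y), centre2 P l * cis (S.angle2 x y)))"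
    by (intro sum.cong) (auto simp: embed_centred)
  have "centre1 P l * (\<Sum>x\<in>{1, - 1}. \<Sum>y\<in>{1, - 1}. c' x y *\<^sub>R cis (S.angle1 x y)) = 0"
    using arg_cong[OF s[unfolded e], of fst] by (simp add: algebra_simps)
  moreover have "centre2 P l * (\<Sum>x\<in>{1, - 1}. \<Sum>y\<in>{1, - 1}. c' x y *\<^sub>R cis (S.angle2 x y)) = 0"
    using arg_cong[OF s[unfolded e], of snd] by (simp add: algebra_simps)
  moreover have "centre1 P l \<noteq> 0" "centre2 P l \<noteq> 0" by (simp_all add: centre1_def centre2_def)
  ultimately have "(\<Sum>x\<in>{1, - 1}. \<Sum>y\<in>{1, - 1}. c' x y *\<^sub>R cis (S.angle1 x y)) = 0"
    "(\<Sum>x\<in>{1, - 1}. \<Sum>y\<in>{1, - 1}. c' x y *\<^sub>R cis (S.angle2 x y)) = 0"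
    using mult_eq_0_iff by blast+
  note c0 = S.independent_vertices[OF this]
  obtain u where "u \<in> ?Q" "label u = i" using facet_vertex[OF odd_cross_frame i] by blast
  then obtain x y where "x \<in> {1, - 1}" "y \<in> {1, - 1}" "label (?v x y) = i"
    unfolding quad_centred by auto
  then show "c i = 0" using c0[of x y] by (simp add: c'_def)
qed

end

end

lemma lens_factor: "exp (2 * of_real pi * \<i> * of_int q / of_int p) = root_of p (2 * q)"
  by (simp add: root_of_def cis_conv_exp ac_simps)

lemma label_eqD:
  assumes "label u = label v"
  obtains s t where "fst u - fst v = 2 * s" "snd u - snd v = 2 * t"
  using assms unfolding label_eq_iff dvd_def by blast

lemma odd_cross_swap: "odd (cross b a) \<longleftrightarrow> odd (cross a b)"
  unfolding cross_def by (metis (no_types, lifting) even_diff mult.commute even_add)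

context lens_word begin

abbreviation "gen \<equiv> lens_generator p r"

lemma gen_embed: "gen (embed u) = embed (u + (0, 2))"
proof -
  have "gen (embed u) = (root_of p (2 * 1) * root_of p (snd u), root_of p (2 * r) * root_of p (r * snd u - p * fst u))"
    using lens_factor[of 1 p] lens_factor[of r p] by (simp add: lens_generator_def embed_def)
  then show ?thesis by (simp add: embed_def root_of_add[symmetric] algebra_simps)
qed

lemma gen_pow_embed: "(gen ^^ j) (embed u) = embed (u + (0, 2 * int j))"
proof (induction j)
  case 0
  show ?case by (simp add: zero_prod_def[symmetric])
next
  case (Suc j)
  have "u + (0, 2 * int j) + (0, 2) = u + (0, 2 * int (Suc j))" by (simp add: prod_eq_iff)
  moreover have "(gen ^^ Suc j) (embed u) = embed (u + (0, 2 * int j) + (0, 2))"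
    using Suc gen_embed[of "u + (0, 2 * int j)"] by (simp del: of_nat_Suc)
  ultimately show ?case by (simp only:)
qed

text \<open>The first coordinate can be corrected for free, since translation by \<open>(2, 0)\<close> is trivial.\<close>

lemma same_label_translate:
  assumes "label u = label w"
  obtains j where "embed (u + (0, 2 * int j)) = embed w"
proof -
  obtain s t where st: "fst w - fst u = 2 * s" "snd w - snd u = 2 * t"
    using assms[symmetric] by (rule label_eqD)
  define j where "j = nat (t mod p)"
  have j: "int j = t - p * (t div p)" using p_ge_2 by (simp add: j_def minus_mult_div_eq_mod)
  have a1: "snd (u + (0, 2 * int j)) - snd w = 2 * p * (- (t div p))"
    using st(2) j by (simp add: algebra_simps)
  have a2: "fst (u + (0, 2 * int j)) - fst w = 2 * (- s)" using st(1) by simp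
  have "r * (2 * p * (- (t div p))) - p * (2 * (- s)) = 2 * p * (s - r * (t div p))"
    by (simp add: algebra_simps)
  then have "embed (u + (0, 2 * int j)) = embed w"
    unfolding embed_eq_iff a1 a2 by (metis dvd_triv_left)
  then show thesis by (rule that)
qed

definition facets :: "(nat \<Rightarrow> complex \<times> complex) set" where
  "facets = (\<Union>l\<le>N. range (\<lambda>P. facet P (fa l) (fb l)))"

definition deck :: "(complex \<times> complex \<Rightarrow> complex \<times> complex) set" where
  "deck = range (\<lambda>j. gen ^^ j)"

lemma facets_cases:
  assumes "f \<in> facets"
  obtains l P where "l \<le> N" "f = facet P (fa l) (fb l)"
  using assms by (auto simp: facets_def)

lemma facet_in: "l \<le> N \<Longrightarrow> facet P (fa l) (fb l) \<in> facets"
  by (auto simp: facets_def)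

lemma linear_gen_pow: "linear (gen ^^ j)"
proof (rule linearI)
  show "(gen ^^ j) (x + y) = (gen ^^ j) x + (gen ^^ j) y" for x y
    by (cases x; cases y) (simp add: lens_generator_funpow distrib_left)
  show "(gen ^^ j) (c *\<^sub>R x) = c *\<^sub>R (gen ^^ j) x" for c x
    by (cases x) (simp add: lens_generator_funpow)
qed

lemma norm_gen_pow: "norm ((gen ^^ j) x) = norm x"
proof (cases x)
  case (Pair z1 z2)
  then show ?thesis
    using cmod_lens_root[of 1 p] cmod_lens_root[of r p]
    by (simp add: lens_generator_funpow norm_Pair norm_mult norm_power)
qed

lemma gen_pow_facet:
  assumes "l \<le> N"
  shows "(gen ^^ j) \<circ> facet P (fa l) (fb l) = facet (P + (0, 2 * int j)) (fa l) (fb l)"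
proof (rule sym, rule facet_eqI[OF odd_cross_frame[OF assms]])
  fix i :: nat assume "3 < i"
  then show "((gen ^^ j) \<circ> facet P (fa l) (fb l)) i = 0"
    using linear_0[OF linear_gen_pow] facet_above by simp
next
  fix u assume u: "u \<in> quad (P + (0, 2 * int j)) (fa l) (fb l)"
  define v where "v = u - (0, 2 * int j)"
  have v: "v \<in> quad P (fa l) (fb l)" "u = v + (0, 2 * int j)"
    using u by (auto simp: v_def quad_def algebra_simps)
  moreover have "label u = label v" by (simp add: v_def label_eq_iff)
  ultimately show "((gen ^^ j) \<circ> facet P (fa l) (fb l)) (label u) = embed u"
    using facet_label[OF odd_cross_frame[OF assms] v(1)] gen_pow_embed by simp
qed

text \<open>The side common to two consecutive layers is not a meridian: its intersection number with the meridian
\<open>(1, 0)\<close> lies strictly between 0 and \<open>p\<close>.\<close>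

lemma retained_side:
  assumes "l < N"
  shows "D l \<Longrightarrow> 0 < snd (fb l) \<and> snd (fb l) < p" "\<not> D l \<Longrightarrow> 0 < snd (fa l) \<and> snd (fa l) < p"
proof -
  have *: "0 < snd (fa l) \<and> snd (fa l) < p \<and> 0 < snd (fb l) \<and> snd (fb l) < p" if "l \<noteq> 0"
  proof -
    have "1 \<le> snd (fa l) \<and> 1 \<le> snd (fb l)" using snd_frame_pos[of "l - 1"] that by simp
    moreover have "1 \<le> x1 l \<and> 1 \<le> y1 l" using slope_coords_pos[of l] assms by simp
    moreover have "lattice_square p (snd (fb l)) (snd (fa l)) (x1 l) (y1 l)"
      using lattice_square assms by simp
    ultimately show ?thesis using lattice_square.lt_p(1,2) by fastforce
  qed
  show "D l \<Longrightarrow> 0 < snd (fb l) \<and> snd (fb l) < p"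
    using * p_ge_2 by (cases "l = 0") (auto simp: frame_0)
  show "\<not> D l \<Longrightarrow> 0 < snd (fa l) \<and> snd (fa l) < p"
    using * D0 by (cases "l = 0") auto
qed

lemma interface:
  assumes l: "l < N"
  defines "f \<equiv> \<lambda>P. facet P (fa l) (fb l)" and "g \<equiv> \<lambda>P. facet P (fa (Suc l)) (fb (Suc l))"
  shows "\<exists>P'. opposes (label (P + fa l)) (f P) (g P')"
    and "\<exists>P'. opposes (label (P + fb l)) (f P) (g P')"
    and "\<exists>P'. opposes (label P) (g P) (f P')"
    and "\<exists>P'. opposes (label (P + fa (Suc l) + fb (Suc l))) (g P) (f P')"
proof -
  have odd: "odd (cross (fa l) (fb l))" "odd (cross (fb l) (fa l))"
    unfolding odd_cross_swap[of "fb l"] by (simp_all add: cross_frame)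
  have "(\<exists>P'. opposes (label (P + fa l)) (f P) (g P')) \<and> (\<exists>P'. opposes (label (P + fb l)) (f P) (g P')) \<and>
    (\<exists>P'. opposes (label P) (g P) (f P')) \<and>
    (\<exists>P'. opposes (label (P + fa (Suc l) + fb (Suc l))) (g P) (f P'))"
  proof (cases "D l")
    case True
    have g: "g P = facet P (fb l) (fb l + fa l)" for P
      using True facet_swap[of P "fb l" "fa l + fb l"] by (simp add: g_def frame_Suc add.commute)
    have f: "f P = facet P (fb l) (fa l)" for P by (simp add: f_def facet_swap)
    have s: "P + fa (Suc l) + fb (Suc l) = P + fb l + (fb l + fa l)"
      using True by (simp add: frame_Suc ac_simps)
    have c: "0 < snd (fb l)" "snd (fb l) < p" using retained_side(1)[OF l True] by auto
    show ?thesis unfolding f g s using layer_interface[OF odd(2) c, of P] by blast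
  next
    case False
    have g: "g P = facet P (fa l) (fa l + fb l)" for P
      using False by (simp add: g_def frame_Suc)
    have s: "P + fa (Suc l) + fb (Suc l) = P + fa l + (fa l + fb l)"
      using False by (simp add: frame_Suc ac_simps)
    have c: "0 < snd (fa l)" "snd (fa l) < p" using retained_side(2)[OF l False] by auto
    show ?thesis unfolding f_def g s using layer_interface[OF odd(1) c, of P] by blast
  qed
  then show "\<exists>P'. opposes (label (P + fa l)) (f P) (g P')"
    "\<exists>P'. opposes (label (P + fb l)) (f P) (g P')"
    "\<exists>P'. opposes (label P) (g P) (f P')"
    "\<exists>P'. opposes (label (P + fa (Suc l) + fb (Suc l))) (g P) (f P')" by blast+
qed

lemma period_first: "embed (P + fa 0 + fa 0) = embed P"
proof -
  have "P + fa 0 + fa 0 = P + (2, 0)" by (simp add: frame_0 prod_eq_iff)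
  then show ?thesis using embed_meridians(1)[of P] by (simp only:)
qed

lemma period_last:
  assumes "c = slope"
  shows "embed (P + c + c) = embed P"
proof -
  have "P + slope + slope = P + (2 * r, 2 * p)" by (simp add: prod_eq_iff)
  then show ?thesis unfolding assms using embed_meridians(2)[of P] by (simp only:)
qed

text \<open>The faces opposite to \<open>P + a\<close> and \<open>P + b\<close> are shared with the next layer, those opposite to \<open>P\<close> and
\<open>P + a + b\<close> with the previous one. At an end of the path, translation by the meridian exchanges the two pairs of vertices, so
that the facet, written with the translated base point, has all its neighbours on the other side.\<close>

lemma neighbour_exists:
  assumes f: "f \<in> facets" and i: "i \<le> 3"
  shows "\<exists>g\<in>facets. opposes i f g"
proof -
  obtain l P where l: "l \<le> N" and fP: "f = facet P (fa l) (fb l)" using f by (rule facets_cases)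
  note odd = odd_cross_frame[OF l]
  obtain u where u: "u \<in> quad P (fa l) (fb l)" "label u = i" using facet_vertex[OF odd i] by blast
  have up: "\<exists>g\<in>facets. opposes (label v) (facet Q (fa l) (fb l)) g"
    if "l < N" "v = Q + fa l \<or> v = Q + fb l" for Q v
    using interface(1,2)[OF that(1), of Q] that facet_in[of "Suc l"] by auto
  have down: "\<exists>g\<in>facets. opposes (label v) (facet Q (fa l) (fb l)) g"
    if l0: "l \<noteq> 0" and v: "v = Q \<or> v = Q + fa l + fb l" for Q v
  proof -
    obtain l' where l': "l = Suc l'" "l' < N" using l0 l by (cases l) auto
    show ?thesis using interface(3,4)[OF l'(2), of Q] v facet_in[of l'] l' by auto
  qed
  consider (up) "u = P + fa l \<or> u = P + fb l" | (down) "u = P \<or> u = P + fa l + fb l"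
    using u(1) by (auto simp: quad_def)
  then show ?thesis
  proof cases
    case up': up
    show ?thesis
    proof (cases "l = N")
      case False
      then show ?thesis using up[of u P] up' l u(2) fP by simp
    next
      case True
      define c where "c = (if D (N - 1) then fa l else fb l)"
      have per: "embed (Q + c + c) = embed Q" for Q
        using period_last[of c Q] frame_end True by (auto simp: c_def)
      have fc: "f = facet (P + c) (fa l) (fb l)"
      proof (cases "D (N - 1)")
        case True
        then have c: "c = fa l" by (simp add: c_def)
        show ?thesis unfolding fP c by (rule facet_shift[OF odd per[of P, unfolded c]])
      next
        case False
        then have c: "c = fb l" by (simp add: c_def)
        have "odd (cross (fb l) (fa l))" using odd odd_cross_swap by blast
        then have "facet P (fb l) (fa l) = facet (P + fb l) (fb l) (fa l)"
          by (rule facet_shift[OF _ per[of P, unfolded c]])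
        then show ?thesis unfolding fP c by (simp only: facet_swap[of _ "fb l"])
      qed
      have "\<exists>v. label v = i \<and> (v = P + c \<or> v = P + c + fa l + fb l)"
      proof -
        have "label (P + fb l + fa l + fb l) = label (P + fa l)" "label (P + fa l + fa l + fb l) = label (P + fb l)"
          by (simp_all add: label_eq_iff)
        moreover have "c = fa l \<or> c = fb l" by (simp add: c_def)
        ultimately show ?thesis using up' u(2) by metis
      qed
      then obtain v where "label v = i" "v = (P + c) \<or> v = (P + c) + fa l + fb l" by blast
      then show ?thesis using down[of v "P + c"] True N2 fc by auto
    qed
  next
    case down': down
    show ?thesis
    proof (cases "l = 0")
      case False
      then show ?thesis using down[of u P] down' u(2) fP by simp
    next
      case True
      have fc: "f = facet (P + fa l) (fa l) (fb l)"
        unfolding fP by (rule facet_shift[OF odd period_first[of P, folded True]])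
      have "\<exists>v. label v = i \<and> (v = (P + fa l) + fa l \<or> v = (P + fa l) + fb l)"
      proof -
        have "label (P + fa l + fa l) = label P" by (simp add: label_eq_iff)
        then show ?thesis using down' u(2) by metis
      qed
      then obtain v where "label v = i" "v = (P + fa l) + fa l \<or> v = (P + fa l) + fb l" by blast
      then show ?thesis using up[of v "P + fa l"] True N2 fc by auto
    qed
  qed
qed

lemma finite_facets: "finite facets"
proof -
  have "finite (range (\<lambda>P. facet P (fa l) (fb l)))" if l: "l \<le> N" for l
  proof (rule finite_subset)
    show "range (\<lambda>P. facet P (fa l) (fb l)) \<subseteq> (\<lambda>P. facet P (fa l) (fb l)) ` ({0, 1} \<times> {0..<2 * p})"
    proof
      fix f assume "f \<in> range (\<lambda>P. facet P (fa l) (fb l))"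
      then obtain P where P: "f = facet P (fa l) (fb l)" by blast
      obtain v where "v \<in> {0, 1} \<times> {0..<2 * p}" "embed P = embed v" by (rule embed_fundamental)
      then show "f \<in> (\<lambda>P. facet P (fa l) (fb l)) ` ({0, 1} \<times> {0..<2 * p})"
        using P facet_cong[OF odd_cross_frame[OF l]] by blast
    qed
  qed simp
  then show ?thesis unfolding facets_def by simp
qed

lemma gen_pow_period: "gen ^^ (j mod nat p) = gen ^^ j"
proof
  fix x
  have "(gen ^^ nat p) x = x" using p_ge_2 by (intro lens_generator_order) simp
  then show "(gen ^^ (j mod nat p)) x = (gen ^^ j) x" by (rule funpow_mod_eq)
qed

sublocale tiling: spherical_tiling 3 facets deck
proof (intro spherical_tiling.intro simplicial_fan.intro spherical_tiling_axioms.intro)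
  show "DIM(complex \<times> complex) = Suc 3" by simp
  show "finite facets" by (rule finite_facets)
  show "facets \<noteq> {}" using facet_in[of 0] by auto
  show "\<exists>n. (\<forall>i\<le>3. n \<bullet> f i = 1) \<and> (\<forall>g\<in>facets. \<forall>i\<le>3. n \<bullet> g i \<le> 1 \<and> (n \<bullet> g i = 1 \<longrightarrow> g i = f i))"
    if f: "f \<in> facets" for f
  proof -
    obtain l P where l: "l \<le> N" and fP: "f = facet P (fa l) (fb l)" using f by (rule facets_cases)
    note odd = odd_cross_frame[OF l]
    let ?n = "normal l P"
    have "?n \<bullet> f i = 1" if i: "i \<le> 3" for i
    proof -
      obtain u where "u \<in> quad P (fa l) (fb l)" "facet P (fa l) (fb l) i = embed u"
        using facet_vertex[OF odd i] by blast
      then show ?thesis using facet_support(1)[OF l] fP by simp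
    qed
    moreover have "?n \<bullet> g i \<le> 1 \<and> (?n \<bullet> g i = 1 \<longrightarrow> g i = f i)" if g: "g \<in> facets" and i: "i \<le> 3" for g i
    proof -
      obtain l' P' where l': "l' \<le> N" and gP: "g = facet P' (fa l') (fb l')" using g by (rule facets_cases)
      obtain w where w: "label w = i" "g i = embed w"
        using facet_vertex[OF odd_cross_frame[OF l'] i] gP by blast
      have "g i = f i" if eq: "?n \<bullet> g i = 1"
      proof -
        obtain u where u: "u \<in> quad P (fa l) (fb l)" "embed w = embed u"
          using facet_support(3)[OF l, of P w] eq w(2) by auto
        then have "label u = i" using embed_eq_parity w(1) by metis
        then show ?thesis using facet_label[OF odd u(1)] u(2) w(2) fP by simp
      qed
      then show ?thesis using facet_support(2)[OF l] w(2) by simp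
    qed
    ultimately show ?thesis by blast
  qed
  show "c i = 0" if f: "f \<in> facets" and z: "(\<Sum>i\<le>3. c i *\<^sub>R f i) = 0" and i: "i \<le> 3" for f c i
  proof -
    obtain l P where "l \<le> N" "f = facet P (fa l) (fb l)" using f by (rule facets_cases)
    then show ?thesis using facet_independent[of l c P i] z i by simp
  qed
  show "\<exists>g\<in>facets. opposes i f g" if "f \<in> facets" "i \<le> 3" for f i
    by (rule neighbour_exists[OF that])
  show "finite deck"
  proof (rule finite_subset)
    show "deck \<subseteq> (\<lambda>j. gen ^^ j) ` {..<nat p}"
    proof
      fix \<gamma> assume "\<gamma> \<in> deck"
      then obtain j where "\<gamma> = gen ^^ j" by (auto simp: deck_def)
      moreover have "j mod nat p < nat p" using p_ge_2 by (intro mod_less_divisor) simp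
      ultimately show "\<gamma> \<in> (\<lambda>j. gen ^^ j) ` {..<nat p}" using gen_pow_period[of j]
        by (intro image_eqI[of _ _ "j mod nat p"]) simp_all
    qed
  qed simp
  show "id \<in> deck" using rangeI[of "\<lambda>j. gen ^^ j" 0] by (simp add: deck_def id_def[symmetric])
  show "\<gamma> \<circ> \<delta> \<in> deck" if \<gamma>\<delta>: "\<gamma> \<in> deck" "\<delta> \<in> deck" for \<gamma> \<delta>
  proof -
    obtain i j where "\<gamma> = gen ^^ i" "\<delta> = gen ^^ j" using \<gamma>\<delta> by (auto simp: deck_def)
    then have "\<gamma> \<circ> \<delta> = gen ^^ (i + j)" by (simp add: funpow_add)
    then show ?thesis by (simp add: deck_def)
  qed
  show "\<exists>\<delta>\<in>deck. \<delta> \<circ> \<gamma> = id \<and> \<gamma> \<circ> \<delta> = id" if g: "\<gamma> \<in> deck" for \<gamma>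
  proof -
    obtain j where j: "\<gamma> = gen ^^ j" using g by (auto simp: deck_def)
    have "1 \<le> nat p" using p_ge_2 by simp
    then have le: "j \<le> j * nat p" by simp
    have "gen ^^ (j * nat p) = id" using gen_pow_period[of "j * nat p"] by (simp add: id_def)
    then have "gen ^^ (j * nat p - j) \<circ> \<gamma> = id" "\<gamma> \<circ> gen ^^ (j * nat p - j) = id"
      unfolding j funpow_add[symmetric] using le by simp_all
    then show ?thesis by (auto simp: deck_def)
  qed
  show "linear \<gamma>" if "\<gamma> \<in> deck" for \<gamma> using that linear_gen_pow by (auto simp: deck_def)
  show "norm (\<gamma> x) = norm x" if "\<gamma> \<in> deck" for \<gamma> x
    using that unfolding deck_def by (elim rangeE) (simp only: norm_gen_pow)
  show "\<gamma> \<circ> f \<in> facets" if g: "\<gamma> \<in> deck" and f: "f \<in> facets" for \<gamma> f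
  proof -
    obtain l P where l: "l \<le> N" and fP: "f = facet P (fa l) (fb l)" using f by (rule facets_cases)
    obtain j where j: "\<gamma> = gen ^^ j" using g by (auto simp: deck_def)
    show ?thesis unfolding fP j gen_pow_facet[OF l] by (rule facet_in[OF l])
  qed
  show "\<exists>\<gamma>\<in>deck. \<gamma> (f i) = g i" if f: "f \<in> facets" and g: "g \<in> facets" and i: "i \<le> 3" for f g i
  proof -
    obtain l P where "l \<le> N" "f = facet P (fa l) (fb l)" using f by (rule facets_cases)
    then obtain u where u: "label u = i" "f i = embed u" using facet_vertex[OF odd_cross_frame i] by metis
    obtain l' P' where "l' \<le> N" "g = facet P' (fa l') (fb l')" using g by (rule facets_cases)
    then obtain w where w: "label w = i" "g i = embed w" using facet_vertex[OF odd_cross_frame i] by metis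
    have "label u = label w" using u w by simp
    then obtain j where "embed (u + (0, 2 * int j)) = embed w" by (rule same_label_translate)
    then have "(gen ^^ j) (f i) = g i" using gen_pow_embed u w by simp
    then show ?thesis by (auto simp: deck_def)
  qed
  show "f i = 0" if f: "f \<in> facets" and i: "3 < i" for f i
  proof -
    obtain l P where "f = facet P (fa l) (fb l)" using f by (rule facets_cases)
    then show ?thesis using facet_above i by simp
  qed
qed

lemma lens_space_eq: "lens_space p r = tiling.orbit_space"
proof -
  have "unit_sphere3 = sphere 0 1"
    by (auto simp: unit_sphere3_def norm_Pair)
  moreover from this have "lens_orbit_rel p r = tiling.orbit_rel"
    unfolding lens_orbit_rel_def tiling.orbit_rel_def by (simp add: deck_def)
  ultimately show ?thesis by (simp add: lens_space_def tiling.orbit_space_def)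
qed

lemma facet_orbit_parity:
  assumes l: "l \<le> N" and par: "label P = label Q"
  shows "tiling.facet_orbit (facet P (fa l) (fb l)) = tiling.facet_orbit (facet Q (fa l) (fb l))"
proof -
  obtain j where "embed (Q + (0, 2 * int j)) = embed P"
    using par[symmetric] by (rule same_label_translate)
  then have "facet P (fa l) (fb l) = (gen ^^ j) \<circ> facet Q (fa l) (fb l)"
    using gen_pow_facet[OF l] facet_cong[OF odd_cross_frame[OF l]] by metis
  then have "facet P (fa l) (fb l) \<in> tiling.facet_orbit (facet Q (fa l) (fb l))"
    unfolding tiling.facet_orbit_def by (simp add: deck_def image_image)
  then show ?thesis by (rule tiling.facet_orbit_eq)
qed

definition layer_orbits :: "nat \<Rightarrow> (nat \<Rightarrow> complex \<times> complex) set set" where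
  "layer_orbits l = tiling.facet_orbit ` range (\<lambda>P. facet P (fa l) (fb l))"

lemma layer_orbits_quad:
  assumes l: "l \<le> N"
  shows "layer_orbits l = (\<lambda>P. tiling.facet_orbit (facet P (fa l) (fb l))) ` quad 0 (fa l) (fb l)"
proof
  show "layer_orbits l \<subseteq> (\<lambda>P. tiling.facet_orbit (facet P (fa l) (fb l))) ` quad 0 (fa l) (fb l)"
  proof
    fix X assume "X \<in> layer_orbits l"
    then obtain P where P: "X = tiling.facet_orbit (facet P (fa l) (fb l))" by (auto simp: layer_orbits_def)
    have "label P \<in> label ` quad 0 (fa l) (fb l)"
      using label_quad(2)[OF odd_cross_frame[OF l]] label_le by simp
    then obtain u where "u \<in> quad 0 (fa l) (fb l)" "label P = label u" by blast
    then show "X \<in> (\<lambda>P. tiling.facet_orbit (facet P (fa l) (fb l))) ` quad 0 (fa l) (fb l)"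
      using P facet_orbit_parity[OF l] by blast
  qed
qed (auto simp: layer_orbits_def)

text \<open>An orbit of tetrahedra in a layer is determined by the class of its base point modulo 2.\<close>

lemma card_layer_orbits: "l \<le> N \<Longrightarrow> card (layer_orbits l) \<le> 4"
proof -
  assume l: "l \<le> N"
  have "card (quad 0 (fa l) (fb l)) \<le> 4"
    unfolding quad_def by (simp add: card_insert_if)
  moreover have "finite (quad 0 (fa l) (fb l))" by (simp add: quad_def)
  ultimately show ?thesis unfolding layer_orbits_quad[OF l] using card_image_le order_trans by blast
qed

text \<open>A side that is a meridian identifies the four classes of base points in pairs.\<close>

lemma card_cap_orbits:
  assumes l: "l \<le> N" and c: "c = fa l \<or> c = fb l" and per: "\<And>P. embed (P + c + c) = embed P"
  shows "card (layer_orbits l) \<le> 2"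
proof -
  let ?h = "\<lambda>P. tiling.facet_orbit (facet P (fa l) (fb l))"
  have odd: "odd (cross (fa l) (fb l))" "odd (cross (fb l) (fa l))"
    unfolding odd_cross_swap[of "fb l"] by (simp_all add: cross_frame)
  \<comment> \<open>One of \<open>0\<close> and \<open>c\<close>, and one of \<open>e\<close> and \<open>e + c\<close>, suffices to represent the base points.\<close>
  have shift: "?h (P + c) = ?h P" for P
    using c facet_shift[OF odd(1), of P] facet_shift[OF odd(2), of P] per[of P] by (auto simp: facet_swap)
  define e where "e = (if c = fa l then fb l else fa l)"
  have "quad 0 (fa l) (fb l) = {0, e, 0 + c, e + c}"
    using c by (auto simp: quad_def e_def add.commute)
  then have "layer_orbits l = {?h 0, ?h e}"
    unfolding layer_orbits_quad[OF l] using shift[of 0] shift[of e] by auto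
  then show ?thesis by (simp add: card_insert_if)
qed

lemma card_orbits: "card (tiling.facet_orbit ` facets) \<le> 4 * N"
proof -
  have "tiling.facet_orbit ` facets = (\<Union>l\<in>{..N}. layer_orbits l)"
    by (auto simp: facets_def layer_orbits_def)
  then have "card (tiling.facet_orbit ` facets) \<le> (\<Sum>l\<in>{..N}. card (layer_orbits l))"
    using card_UN_le[of "{..N}" layer_orbits] by simp
  also have "{..N} = insert 0 (insert N {1..<N})" using N2 by auto
  also have "(\<Sum>l\<in>insert 0 (insert N {1..<N}). card (layer_orbits l)) =
      card (layer_orbits 0) + card (layer_orbits N) + (\<Sum>l\<in>{1..<N}. card (layer_orbits l))"
    using N2 by simp
  also have "\<dots> \<le> 2 + 2 + (\<Sum>l\<in>{1..<N}. 4)"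
  proof (intro add_mono sum_mono)
    show "card (layer_orbits 0) \<le> 2" by (rule card_cap_orbits[of 0 "fa 0"]) (use period_first in auto)
    show "card (layer_orbits N) \<le> 2"
    proof (rule card_cap_orbits)
      show "slope = fa N \<or> slope = fb N" using frame_end by metis
      show "embed (P + slope + slope) = embed P" for P by (rule period_last[OF refl])
    qed simp
    show "card (layer_orbits l) \<le> 4" if "l \<in> {1..<N}" for l using card_layer_orbits that by simp
  qed
  also have "\<dots> = 4 * N" using N2 by simp
  finally show ?thesis .
qed

text \<open>The bound for a general Farey path; the continued fraction of \<open>p / r\<close> tells how long a path to the slope
\<open>(r, p)\<close> is.\<close>

theorem Psi_lens_space: "Psi (lens_space p r) \<le> enat (4 * N)"
proof -
  obtain G :: "(nat, nat) cgraph" where G: "card (verts G) = card (tiling.facet_orbit ` facets)"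
    "crystallization 3 G (lens_space p r)"
    using tiling.crystallization_orbit_space unfolding lens_space_eq by blast
  have "Psi (lens_space p r) \<le> enat (card (verts G))"
    unfolding Psi_def using G(2) by (intro Inf_lower) auto
  also have "\<dots> \<le> enat (4 * N)" using G(1) card_orbits by simp
  finally show ?thesis .
qed

end

lemma frame_run_left:
  assumes "\<And>j. m \<le> j \<Longrightarrow> j < m + n \<Longrightarrow> D j"
  shows "frame D (m + n) = (fst (frame D m) +
    (int n * fst (snd (frame D m)), int n * snd (snd (frame D m))), snd (frame D m))"
  using assms
proof (induction n)
  case 0
  show ?case by (simp add: prod_eq_iff)
next
  case (Suc n)
  then have "D (m + n)" by simp
  then show ?case using Suc by (simp add: Let_def case_prod_beta prod_eq_iff algebra_simps)
qed

lemma frame_run_right: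
  assumes "\<And>j. m \<le> j \<Longrightarrow> j < m + n \<Longrightarrow> \<not> D j"
  shows "frame D (m + n) = (fst (frame D m), snd (frame D m) +
    (int n * fst (fst (frame D m)), int n * snd (fst (frame D m))))"
  using assms
proof (induction n)
  case 0
  show ?case by (simp add: prod_eq_iff)
next
  case (Suc n)
  then have "\<not> D (m + n)" by simp
  then show ?case using Suc by (simp add: Let_def case_prod_beta prod_eq_iff algebra_simps)
qed

theorem Psi_lens_plus:
  fixes k q :: nat
  assumes "1 \<le> k" "1 \<le> q"
  shows "Psi (lens_space (int k * int q + 1) (int q)) \<le> enat (4 * (k + q))"
proof -
  define D where "D = (\<lambda>l. l < k)"
  interpret lens_word D "k + q" by unfold_locales (use assms in \<open>auto simp: D_def\<close>)
  have "frame D (0 + k) = ((1, int k), (0, 1))" by (subst frame_run_left) (auto simp: D_def)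
  moreover have "frame D (k + (q - 1)) = (fst (frame D k), snd (frame D k) +
      (int (q - 1) * fst (fst (frame D k)), int (q - 1) * snd (fst (frame D k))))"
    by (rule frame_run_right) (auto simp: D_def)
  moreover have "k + q - 1 = k + (q - 1)" using assms by simp
  ultimately have "slope = (int q, int k * int q + 1)"
    unfolding slope_def fa_def fb_def using assms by (simp add: of_nat_diff algebra_simps)
  then show ?thesis using Psi_lens_space by simp
qed

theorem Psi_lens_minus:
  fixes k q :: nat
  assumes "2 \<le> k" "2 \<le> q"
  shows "Psi (lens_space (int k * int q - 1) (int q)) \<le> enat (4 * (k + q - 1))"
proof -
  define D where "D = (\<lambda>l. l \<noteq> k - 1)"
  interpret lens_word D "k + q - 1" by unfold_locales (use assms in \<open>auto simp: D_def\<close>)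
  have "frame D (0 + (k - 1)) = ((1, int (k - 1)), (0, 1))"
    by (subst frame_run_left) (auto simp: D_def)
  then have "frame D (Suc (k - 1)) = ((1, int (k - 1)), (1, int (k - 1) + 1))"
    by (simp add: D_def)
  then have "frame D k = ((1, int (k - 1)), (1, int (k - 1) + 1))" using assms by simp
  moreover have "frame D (k + (q - 2)) = (fst (frame D k) +
      (int (q - 2) * fst (snd (frame D k)), int (q - 2) * snd (snd (frame D k))), snd (frame D k))"
    by (rule frame_run_left) (use assms in \<open>auto simp: D_def\<close>)
  moreover have "k + q - 1 - 1 = k + (q - 2)" using assms by simp
  ultimately have "slope = (int q, int k * int q - 1)"
    unfolding slope_def fa_def fb_def using assms by (simp add: of_nat_diff algebra_simps)
  then show ?thesis using Psi_lens_space by simp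
qed

theorem theorem1p8:
  shows "(\<forall>k q :: int. k \<ge> 2 \<and> q \<ge> 2 \<longrightarrow>
            Psi (lens_space (k * q - 1) q) \<le> enat (nat (4 * (k + q - 1)))) \<and>
         (\<forall>k q :: int. k \<ge> 1 \<and> q \<ge> 1 \<longrightarrow>
            Psi (lens_space (k * q + 1) q) \<le> enat (nat (4 * (k + q))))"
proof (intro conjI allI impI)
  fix k q :: int assume kq: "2 \<le> k \<and> 2 \<le> q"
  then have "int (nat k + nat q - 1) = k + q - 1" by linarith
  then have "4 * (k + q - 1) = int (4 * (nat k + nat q - 1))" by (simp only: of_nat_mult of_nat_numeral)
  then have "nat (4 * (k + q - 1)) = 4 * (nat k + nat q - 1)" by (simp only: nat_int)
  then show "Psi (lens_space (k * q - 1) q) \<le> enat (nat (4 * (k + q - 1)))"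
    using Psi_lens_minus[of "nat k" "nat q"] kq nat_mono[of 2 k] nat_mono[of 2 q] by simp
next
  fix k q :: int assume kq: "1 \<le> k \<and> 1 \<le> q"
  then have "4 * (k + q) = int (4 * (nat k + nat q))" by simp
  then have "nat (4 * (k + q)) = 4 * (nat k + nat q)" by (simp only: nat_int)
  then show "Psi (lens_space (k * q + 1) q) \<le> enat (nat (4 * (k + q)))"
    using Psi_lens_plus[of "nat k" "nat q"] kq nat_mono[of 1 k] nat_mono[of 1 q] by simp
qed

end
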